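(* Let $Y=\{Y(t),\ t\in\mathbb{R}\}$ be a supOU process with characteristic quadruple $(a,b,\mu,\pi)$ and let $X(t)=\int_0^tY(s)\,ds$, $t\ge0$. Assume: (1) $P(Y(1)>x)\sim p_0\,k(x)x^{-\gamma}$ and $P(Y(1)\le-x)\sim q_0\,k(x)x^{-\gamma}$ as $x\to\infty$, for some $p_0,q_0\ge0$ with $p_0+q_0>0$, some $0<\gamma<2$ and some slowly varying function $k$; if $\gamma=1$ then $p_0=q_0$; (2) $\mathbb{E}Y(1)=0$ if the mean is finite; (3) $\pi$ has a density $p$ with $p(x)\sim\alpha\,\ell(x^{-1})x^{\alpha-1}$ as $x\to0$, for some $\alpha>0$ and some slowly varying function $\ell$; (4) $\mu([x,\infty))\sim c^+x^{-\beta}$ and $\mu((-\infty,-x])\sim c^-x^{-\beta}$ as $x\to0$, for some $c^+,c^-\ge0$ with $c^++c^->0$ and some $0\le\beta<2$; (5) the scaling function $\tau(q)=\lim_{t\to\infty}\frac{\log\mathbb{E}|X(t)|^q}{\log t}$ exists in the extended reals for every $q\in\mathbb{R}$, and $0\in\operatorname{Int}(\mathcal{D}_\tau)$, where $\mathcal{D}_\tau=\{q:\tau(q)<\infty\}$. Then: (i) If $b=0$ and $\beta<1+\alpha<\gamma$, then for every $\varepsilon$ with $0<\varepsilon<1-1/(1+\alpha)$, $$-\alpha\le\liminf_{t\to\infty}\frac{1}{\log t}\log P\left(t^{1-\varepsilon}<|X(t)|<t^{1+\varepsilon}\right)\le\limsup_{t\to\infty}\frac{1}{\log t}\log P\left(t^{1-\varepsilon}<|X(t)|<t^{1+\varepsilon}\right)\le-(\alpha-(1+\alpha)\varepsilon).$$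 (ii) If $b=0$ and $1+\alpha<\beta\le\gamma$, then for every $\varepsilon$ with $0<\varepsilon<\alpha/\beta$, $$-\alpha\le\liminf_{t\to\infty}\frac{1}{\log t}\log P\left(t^{1-\varepsilon}<|X(t)|<t^{1+\varepsilon}\right)\le\limsup_{t\to\infty}\frac{1}{\log t}\log P\left(t^{1-\varepsilon}<|X(t)|<t^{1+\varepsilon}\right)\le-(\alpha-\beta\varepsilon).$$
   Context: A supOU process is $Y(t)=\int_{\mathbb{R}_+}\int_{\mathbb{R}}e^{-\xi t+s}\mathbf{1}_{[0,\infty)}(\xi t-s)\,\Lambda(d\xi,ds)$, where $\Lambda$ is a homogeneous infinitely divisible random measure (Lévy basis) on $\mathbb{R}_+\times\mathbb{R}$ with $\log\mathbb{E}e^{i\zeta\Lambda(A)}=(\pi\times\mathrm{Leb})(A)\,\kappa_L(\zeta)$ for Borel $A$, $\pi$ a probability measure on $\mathbb{R}_+$, and $\kappa_L(\zeta)=i\zeta a-\frac{\zeta^2}{2}b+\int_{\mathbb{R}}(e^{i\zeta x}-1-i\zeta x\mathbf{1}_{[-1,1]}(x))\mu(dx)$ the cumulant function of an infinitely divisible law with Lévy–Khintchine triplet $(a,b,\mu)$; $(a,b,\mu,\pi)$ is the characteristic quadruple. *)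

theory Defs
  imports "HOL-Probability.Probability"
begin

definition levy_measure :: "real measure \<Rightarrow> bool" where
  "levy_measure \<mu> \<longleftrightarrow> sets \<mu> = sets borel \<and> emeasure \<mu> {0} = 0 \<and>
     (\<integral>\<^sup>+ x. ennreal (min 1 (x\<^sup>2)) \<partial>\<mu>) < \<infinity>"

definition levy_cumulant :: "real \<Rightarrow> real \<Rightarrow> real measure \<Rightarrow> real \<Rightarrow> complex" where
  "levy_cumulant a b \<mu> \<zeta> =
     \<i> * complex_of_real (\<zeta> * a) - complex_of_real (\<zeta>\<^sup>2 / 2 * b)
     + integral\<^sup>L \<mu> (\<lambda>x. cis (\<zeta> * x) - 1 - \<i> * complex_of_real (\<zeta> * x * indicator {-1..1} x))"

definition levy_basis ::
  "'w measure \<Rightarrow> ((real \<times> real) set \<Rightarrow> 'w \<Rightarrow> real) \<Rightarrow> (real \<times> real) measure \<Rightarrow> (real \<Rightarrow> complex) \<Rightarrow> bool"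
where
  "levy_basis M \<Lambda> \<nu> \<kappa> \<longleftrightarrow> prob_space M \<and>
     (\<forall>A\<in>sets \<nu>. emeasure \<nu> A < \<infinity> \<longrightarrow> \<Lambda> A \<in> borel_measurable M) \<and>
     (\<forall>A\<in>sets \<nu>. emeasure \<nu> A < \<infinity> \<longrightarrow>
        (\<forall>\<zeta>. integral\<^sup>L M (\<lambda>\<omega>. cis (\<zeta> * \<Lambda> A \<omega>)) = exp (complex_of_real (measure \<nu> A) * \<kappa> \<zeta>))) \<and>
     (\<forall>(F :: nat \<Rightarrow> (real \<times> real) set) (I :: nat set).
        disjoint_family_on F I \<and> (\<forall>i\<in>I. F i \<in> sets \<nu> \<and> emeasure \<nu> (F i) < \<infinity>) \<longrightarrow>
        prob_space.indep_vars M (\<lambda>_. borel) (\<lambda>i. \<Lambda> (F i)) I) \<and>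
     (\<forall>F :: nat \<Rightarrow> (real \<times> real) set.
        disjoint_family F \<and> range F \<subseteq> sets \<nu> \<and> emeasure \<nu> (\<Union>(range F)) < \<infinity> \<longrightarrow>
        (AE \<omega> in M. (\<lambda>n. \<Sum>i<n. \<Lambda> (F i) \<omega>) \<longlonglongrightarrow> \<Lambda> (\<Union>(range F)) \<omega>))"

definition simple_levy_integral :: "((real \<times> real) set \<Rightarrow> 'w \<Rightarrow> real) \<Rightarrow> (real \<times> real \<Rightarrow> real) \<Rightarrow> 'w \<Rightarrow> real" where
  "simple_levy_integral \<Lambda> s \<omega> = (\<Sum>c\<in>s ` UNIV - {0}. c * \<Lambda> (s -` {c}) \<omega>)"

definition conv_in_prob :: "'w measure \<Rightarrow> (nat \<Rightarrow> 'w \<Rightarrow> real) \<Rightarrow> ('w \<Rightarrow> real) \<Rightarrow> bool" where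
  "conv_in_prob M Z Z0 \<longleftrightarrow>
     (\<forall>e>0. (\<lambda>n. measure M {\<omega>\<in>space M. e \<le> \<bar>Z n \<omega> - Z0 \<omega>\<bar>}) \<longlonglongrightarrow> 0)"

text \<open>Z is the (Rajput-Rosinski) integral of f w.r.t. Lambda: the limit in probability of the
  integrals of simple functions converging pointwise to f and dominated by |f|.\<close>
definition levy_integral_of ::
  "'w measure \<Rightarrow> ((real \<times> real) set \<Rightarrow> 'w \<Rightarrow> real) \<Rightarrow> (real \<times> real) measure \<Rightarrow> (real \<times> real \<Rightarrow> real) \<Rightarrow> ('w \<Rightarrow> real) \<Rightarrow> bool"
where
  "levy_integral_of M \<Lambda> \<nu> f Z \<longleftrightarrow> Z \<in> borel_measurable M \<and>
     (\<forall>s :: nat \<Rightarrow> real \<times> real \<Rightarrow> real.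
        (\<forall>n. simple_function \<nu> (s n) \<and> emeasure \<nu> {x\<in>space \<nu>. s n x \<noteq> 0} < \<infinity> \<and>
             (\<forall>x. \<bar>s n x\<bar> \<le> \<bar>f x\<bar>)) \<and>
        (\<forall>x. (\<lambda>n. s n x) \<longlonglongrightarrow> f x) \<longrightarrow>
        conv_in_prob M (\<lambda>n. simple_levy_integral \<Lambda> (s n)) Z)"

definition supou_kernel :: "real \<Rightarrow> real \<times> real \<Rightarrow> real" where
  "supou_kernel t = (\<lambda>(\<xi>, s). if 0 \<le> \<xi> \<and> 0 \<le> \<xi> * t - s then exp (- \<xi> * t + s) else 0)"

definition slowly_varying :: "(real \<Rightarrow> real) \<Rightarrow> bool" where
  "slowly_varying k \<longleftrightarrow> k \<in> borel_measurable borel \<and> (\<forall>\<^sub>F x in at_top. k x > 0) \<and>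
     (\<forall>c>0. ((\<lambda>x. k (c * x) / k x) \<longlongrightarrow> 1) at_top)"

definition eln :: "ennreal \<Rightarrow> ereal" where
  "eln x = (if x = 0 then -\<infinity> else if x = \<infinity> then \<infinity> else ereal (ln (enn2real x)))"

definition abs_moment :: "'w measure \<Rightarrow> ('w \<Rightarrow> real) \<Rightarrow> real \<Rightarrow> ennreal" where
  "abs_moment M Z q = (\<integral>\<^sup>+ \<omega>. (if Z \<omega> = 0 then (if q < 0 then \<infinity> else if q = 0 then 1 else 0)
                                  else ennreal (\<bar>Z \<omega>\<bar> powr q)) \<partial>M)"

definition log_prob_ratio :: "'w measure \<Rightarrow> (real \<Rightarrow> 'w \<Rightarrow> real) \<Rightarrow> real \<Rightarrow> real \<Rightarrow> ereal" where
  "log_prob_ratio M X \<epsilon> t =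
     eln (emeasure M {\<omega>\<in>space M. t powr (1 - \<epsilon>) < \<bar>X t \<omega>\<bar> \<and> \<bar>X t \<omega>\<bar> < t powr (1 + \<epsilon>)})
       / ereal (ln t)"

end

theory Submission
  imports Defs
begin

text \<open>
  Everything is read off characteristic functions. The Riemann sums of the integrated process are
  integrals of explicit kernels with respect to the Levy basis, so \<open>X t\<close> has characteristic function
  \<open>\<phi>\<close> bounded from both sides through integrals of the cumulant function \<open>\<kappa>\<close> over these kernels.
  The tail of \<open>Y 1\<close> gives moments of order below \<open>\<gamma>\<close> for the large jumps and, together with the mean,
  kills the drift, whence \<open>|\<kappa> z| \<le> A |z|^q + B |z|^q'\<close> whenever \<open>1 < q < \<gamma>\<close> and \<open>\<beta> < q' \<le> 2\<close>. As the kernel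
  of \<open>X t\<close> is of size \<open>min t (1/\<xi>)\<close> on a set of \<open>s\<close> of length about \<open>1 + \<xi> t\<close>, its moment of order \<open>r\<close> is at
  most a constant times \<open>t^(r - m)\<close> for \<open>m = min (r - 1) \<alpha>'\<close>, any \<open>\<alpha>' < \<alpha>\<close>; hence
  \<open>P (|X t| \<ge> t^(1 - \<epsilon>))\<close> is at most a constant times \<open>t^(q \<epsilon> - m) + t^(q' \<epsilon> - m')\<close>, which is the upper
  bound. For the lower bound, the slow components \<open>\<xi> < 1/t\<close> alone force
  \<open>1 - Re \<phi> (w/t) \<ge> c \<pi> (0, 1/t)\<close>, which is at least \<open>t^(- \<alpha> - \<delta>)\<close>; by the upper bounds, the events
  \<open>|X t| \<le> t^(1 - \<epsilon>)\<close> and \<open>|X t| \<ge> t^(1 + \<epsilon>)\<close> contribute a smaller power of \<open>t\<close> to \<open>1 - Re \<phi> (w/t)\<close>,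
  so the window must carry the rest.
\<close>

section \<open>Tails from characteristic functions\<close>

text \<open>The random measure is known only through the characteristic functions of the
  \<open>\<Lambda> A\<close>, independence and almost sure additivity, and an integral only as a
  limit in probability. No cumulant formula for general kernels is derived: each one-sided bound is
  proved for step functions, where the exponent is a finite sum, and then passed to the limit.
  Likewise \<open>X t\<close> is a pathwise integral, tied to kernels only because its Riemann sums
  converge to it in mean.

  The tail hypothesis concerns the law of \<open>Y 1\<close>, whereas the cumulant needs the jump
  measure; the tail of \<open>\<mu>\<close> is recovered by bounding \<open>1 - |chf|\<close> of
  \<open>Y 1\<close> from below by the mass of a dyadic shell.

  Second moments are infinite as \<gamma> < 2, so the lower bound works with truncated ones. Where
  \<open>|X t| \<le> t^(1 - \<epsilon>)\<close>, the square of \<open>X t / t\<close> is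
  \<open>t^(-2 \<epsilon>)\<close> times that of \<open>X t / t^(1 - \<epsilon>)\<close>, whose
  truncated mean is of order at most \<open>t^(q \<epsilon> - m)\<close> and its analogue for q';
  exponents below 2 thus gain a power. Beyond \<open>t^(1 + \<epsilon>)\<close> the tail gains
  \<open>t^(- q \<epsilon>)\<close>. Both gains matter only if m can approach \<alpha>, that is, for
  exponents of at least 1 + \<alpha>.\<close>

abbreviation chf :: "'w measure \<Rightarrow> ('w \<Rightarrow> real) \<Rightarrow> real \<Rightarrow> complex" where
  "chf M Z \<zeta> \<equiv> (\<integral>\<omega>. cis (\<zeta> * Z \<omega>) \<partial>M)"

section \<open>Elementary inequalities for \<open>cos\<close> and \<open>cis\<close>\<close>

lemma one_minus_cos_ge:
  fixes u :: real
  assumes "\<bar>u\<bar> \<le> 1"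
  shows "u\<^sup>2 / 4 \<le> 1 - cos u"
proof -
  \<comment> \<open>The cubic Taylor polynomial is chosen because its real part is already
    \<open>1 - u\<^sup>2 / 2\<close>: the remainder is of fourth order and for
    \<open>|u| \<le> 1\<close> at most \<open>u\<^sup>2 / 24\<close>, which is well below
    \<open>u\<^sup>2 / 4\<close>.\<close>
  let ?d = "iexp u - (\<Sum>k\<le>3. (\<i> * u)^k / fact k)"
  have fact3: "fact 3 = (6::complex)" and fact4: "fact 4 = (24::real)" by (simp_all add: fact_numeral)
  have "{..3} = {0, 1, 2, 3::nat}" by auto
  then have "(\<Sum>k\<le>3. (\<i> * complex_of_real u)^k / fact k) = 1 + \<i> * u - u\<^sup>2 / 2 - \<i> * u^3 / 6"
    by (simp add: power_mult_distrib fact3 power3_eq_cube)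
  then have "Re (iexp u - (\<Sum>k\<le>3. (\<i> * u)^k / fact k)) = cos u - 1 + u\<^sup>2 / 2"
    by (simp add: cis_conv_exp[symmetric] flip: of_real_power)
  moreover have "cmod (iexp u - (\<Sum>k\<le>3. (\<i> * u)^k / fact k)) \<le> \<bar>u\<bar>^4 / 24"
  proof -
    have "Suc 3 = 4" by simp
    then show ?thesis using iexp_approx1[of u 3] by (simp only: fact4)
  qed
  ultimately have *: "\<bar>cos u - 1 + u\<^sup>2 / 2\<bar> \<le> \<bar>u\<bar>^4 / 24"
    using abs_Re_le_cmod[of ?d] by linarith
  have "\<bar>u\<bar>^4 = u\<^sup>2 * u\<^sup>2" by (simp add: power_numeral_reduce)
  moreover have "u\<^sup>2 \<le> 1" using assms by (simp add: abs_square_le_1)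
  then have "u\<^sup>2 * u\<^sup>2 \<le> u\<^sup>2" by (intro mult_left_le) simp_all
  ultimately have "\<bar>u\<bar>^4 \<le> u\<^sup>2" by linarith
  moreover have "0 \<le> u\<^sup>2" by simp
  ultimately show ?thesis using * by linarith
qed

text \<open>The quadratic remainder near 0 and the linear one away from 0 meet at
  \<open>|u| = 1\<close>; every power between 1 and 2 dominates both. This interpolation is what
  makes moments of order below 2 sufficient.\<close>

lemma cis_taylor_le_powr:
  fixes u :: real
  assumes "1 \<le> r" "r \<le> 2"
  shows "norm (cis u - 1 - \<i> * complex_of_real u) \<le> 2 * \<bar>u\<bar> powr r"
proof (cases "\<bar>u\<bar> \<le> 1")
  case True
  have "norm (cis u - 1 - \<i> * complex_of_real u) \<le> u\<^sup>2 / 2"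
    using iexp_approx1[of u 1] by (simp add: cis_conv_exp algebra_simps power2_eq_square)
  also have "u\<^sup>2 = \<bar>u\<bar> powr 2" by (simp)
  also have "\<bar>u\<bar> powr 2 / 2 \<le> 2 * \<bar>u\<bar> powr r"
    using powr_mono'[of r 2 "\<bar>u\<bar>"] powr_ge_zero[of "\<bar>u\<bar>" r] True assms by linarith
  finally show ?thesis .
next
  case False
  have "norm (cis u - 1 - \<i> * complex_of_real u) \<le> 2 * \<bar>u\<bar>"
    using iexp_approx2[of u 1] by (simp add: cis_conv_exp algebra_simps)
  also have "\<bar>u\<bar> = \<bar>u\<bar> powr 1" using False by simp
  also have "\<bar>u\<bar> powr 1 \<le> \<bar>u\<bar> powr r"
    using False assms by (intro powr_mono) auto
  finally show ?thesis by simp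
qed

lemma one_minus_cos_le_powr:
  fixes u :: real
  assumes "0 \<le> r" "r \<le> 2"
  shows "1 - cos u \<le> 2 * \<bar>u\<bar> powr r"
proof (cases "\<bar>u\<bar> \<le> 1")
  case True
  have "\<bar>Re (cis u - 1 - \<i> * complex_of_real u)\<bar> \<le> 2 * \<bar>u\<bar> powr 2"
    by (rule order_trans[OF abs_Re_le_cmod cis_taylor_le_powr]) auto
  moreover have "\<bar>u\<bar> powr 2 \<le> \<bar>u\<bar> powr r"
    using powr_mono'[of r 2 "\<bar>u\<bar>"] True assms by simp
  ultimately show ?thesis by simp
next
  case False
  then have "1 \<le> \<bar>u\<bar> powr r" using assms by (simp add: ge_one_powr_ge_zero)
  then show ?thesis using cos_ge_minus_one[of u] by linarith
qed

section \<open>Dyadic decompositions\<close>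

lemma ennreal_le_suminf: "f k \<le> (\<Sum>k. f k)" for f :: "nat \<Rightarrow> ennreal"
  using sum_le_suminf[of f "{k}"] by (simp add: summableI)

text \<open>The least \<open>k\<close> that brings the multiple down to 1 works: one halving less
  would still exceed 1.\<close>

lemma dyadic_reduce:
  fixes y :: real
  assumes "1 \<le> y"
  shows "\<exists>k. (1/2) ^ k * y \<in> {1/2<..1}"
proof -
  have "\<exists>k. (1/2) ^ k * y \<le> 1"
  proof -
    obtain k where "(1/2) ^ k < 1 / y" using real_arch_pow_inv[of "1/y" "1/2"] assms by auto
    then show ?thesis using assms by (intro exI[of _ k]) (simp add: field_simps)
  qed
  then obtain k where k: "(1/2) ^ k * y \<le> 1" and min: "\<And>i. i < k \<Longrightarrow> \<not> (1/2) ^ i * y \<le> 1"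
    using exists_least_iff[of "\<lambda>k. (1/2) ^ k * y \<le> 1"] by blast
  have "1/2 < (1/2) ^ k * y"
  proof (cases k)
    case (Suc i) then show ?thesis using min[of i] by simp
  qed (use assms in auto)
  then show ?thesis using k by auto
qed

text \<open>Every \<open>y\<close> with \<open>|y| \<ge> 1\<close> has a dyadic multiple \<open>2^(-k) y\<close> of modulus in \<open>(1/2, 1]\<close>, where
  \<open>1 - cos\<close> is bounded below; summing over dyadic frequencies replaces the usual averaging over an interval.\<close>
lemma (in prob_space) tail_le_of_chf:
  assumes Z[measurable]: "Z \<in> borel_measurable M" and x: "0 < x"
    and "0 \<le> A" "0 \<le> B" "1 \<le> q" "1 \<le> q'"
    and bound: "\<And>\<zeta>. 0 < \<zeta> \<Longrightarrow> expectation (\<lambda>\<omega>. 1 - cos (\<zeta> * Z \<omega>)) \<le> A * \<zeta> powr q + B * \<zeta> powr q'"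
  shows "prob {\<omega>\<in>space M. x \<le> \<bar>Z \<omega>\<bar>} \<le> 32 * (A * x powr (- q) + B * x powr (- q'))"
proof -
  define z where "z k = (1/2)^k / x" for k :: nat
  define D where "D = A * x powr (- q) + B * x powr (- q')"
  have D: "0 \<le> D" using assms by (simp add: D_def)
  have pt: "indicator {\<omega>\<in>space M. x \<le> \<bar>Z \<omega>\<bar>} \<omega> \<le> (\<Sum>k. ennreal (16 * (1 - cos (z k * Z \<omega>))))" for \<omega>
  proof (cases "\<omega> \<in> space M \<and> x \<le> \<bar>Z \<omega>\<bar>")
    case True
    then obtain k where k: "(1/2) ^ k * (\<bar>Z \<omega>\<bar> / x) \<in> {1/2<..1}"
      using dyadic_reduce[of "\<bar>Z \<omega>\<bar> / x"] x by auto
    then have k': "\<bar>z k * Z \<omega>\<bar> \<in> {1/2<..1}" using x by (simp add: z_def abs_mult)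
    then have "(1/2)\<^sup>2 \<le> (\<bar>z k * Z \<omega>\<bar>)\<^sup>2" by (intro power_mono) auto
    \<comment> \<open>At modulus above \<open>1 / 2\<close> the quadratic bound gives
      \<open>(1 / 2)^2 / 4 = 1 / 16\<close>, hence the weight 16.\<close>
    with k' have "1/16 \<le> 1 - cos (z k * Z \<omega>)"
      using one_minus_cos_ge[of "z k * Z \<omega>"] by (simp add: power2_eq_square)
    then have "1 \<le> ennreal (16 * (1 - cos (z k * Z \<omega>)))"
      by (simp add: ennreal_1[symmetric] del: ennreal_1)
    also have "\<dots> \<le> (\<Sum>k. ennreal (16 * (1 - cos (z k * Z \<omega>))))"
      by (rule ennreal_le_suminf)
    finally show ?thesis using True by simp
  qed auto
  have "emeasure M {\<omega>\<in>space M. x \<le> \<bar>Z \<omega>\<bar>} = (\<integral>\<^sup>+\<omega>. indicator {\<omega>\<in>space M. x \<le> \<bar>Z \<omega>\<bar>} \<omega> \<partial>M)"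
    by simp
  also have "\<dots> \<le> (\<integral>\<^sup>+\<omega>. (\<Sum>k. ennreal (16 * (1 - cos (z k * Z \<omega>)))) \<partial>M)"
    by (intro nn_integral_mono pt)
  also have "\<dots> = (\<Sum>k. \<integral>\<^sup>+\<omega>. ennreal (16 * (1 - cos (z k * Z \<omega>))) \<partial>M)"
    by (intro nn_integral_suminf) auto
  also have "\<dots> \<le> (\<Sum>k. ennreal (16 * D * (1/2)^k))"
  proof (intro suminf_le allI)
    fix k
    have zk: "0 < z k" using x by (simp add: z_def)
    have "\<bar>16 * (1 - cos y)\<bar> \<le> 32" for y :: real
      using cos_ge_minus_one[of y] cos_le_one[of y] unfolding abs_le_iff by argo
    then have int: "integrable M (\<lambda>\<omega>. 16 * (1 - cos (z k * Z \<omega>)))"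
      by (intro integrable_const_bound[where B = 32] AE_I2) (simp_all only: real_norm_def, measurable)
    \<comment> \<open>Exponents of at least 1 make the frequencies decay at least geometrically with
      ratio \<open>1 / 2\<close>; one series of sum 2 then serves both terms, and 16 times 2 is the
      final 32.\<close>
    have p: "z k powr r \<le> (1/2)^k * x powr (- r)" if "1 \<le> r" for r
    proof -
      have "z k powr r = ((1/2)^k) powr r * x powr (- r)"
        using x by (simp add: z_def powr_divide powr_minus_divide)
      also have "((1/2)^k) powr r \<le> ((1/2)^k) powr 1"
        using that by (intro powr_mono') (auto simp: power_le_one)
      finally show ?thesis by (simp add: mult_right_mono)
    qed
    have "expectation (\<lambda>\<omega>. 16 * (1 - cos (z k * Z \<omega>))) = 16 * expectation (\<lambda>\<omega>. 1 - cos (z k * Z \<omega>))"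
      by (rule integral_mult_right_zero)
    also have "\<dots> \<le> 16 * (A * z k powr q + B * z k powr q')"
      using bound[OF zk] by simp
    also have "\<dots> \<le> 16 * (A * ((1/2)^k * x powr (- q)) + B * ((1/2)^k * x powr (- q')))"
      using p assms by (intro mult_left_mono add_mono) auto
    also have "\<dots> = 16 * D * (1/2)^k" by (simp add: D_def algebra_simps)
    finally show "(\<integral>\<^sup>+\<omega>. ennreal (16 * (1 - cos (z k * Z \<omega>))) \<partial>M) \<le> ennreal (16 * D * (1/2)^k)"
      by (subst nn_integral_eq_integral[OF int]) (auto intro!: ennreal_leI)
  qed auto
  also have "\<dots> = ennreal (16 * D * 2)"
  proof -
    have "(\<lambda>k. 16 * D * (1/2)^k) sums (16 * D * 2)"
      using sums_mult[OF geometric_sums[of "1/2::real"], of "16 * D"] by simp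
    then show ?thesis using D by (intro suminf_ennreal_eq) auto
  qed
  finally show ?thesis using D
    by (simp add: emeasure_eq_measure D_def[symmetric] mult.commute)
qed

text \<open>The shells may overlap: a point lying in several of them is counted more than once,
  which is harmless for an upper bound. The lemma serves large values as well as values near
  0.\<close>

lemma nn_integral_shells_finite:
  fixes f :: "'a \<Rightarrow> ennreal" and w :: "nat \<Rightarrow> real"
  assumes S[measurable]: "\<And>j. S j \<in> sets N"
    and f: "\<And>x. x \<in> space N \<Longrightarrow> f x \<noteq> 0 \<Longrightarrow> \<exists>j. x \<in> S j \<and> f x \<le> ennreal (w j)"
    and bound: "\<And>j. ennreal (w j) * emeasure N (S j) \<le> ennreal (C * \<rho> ^ j)"
    and "0 \<le> C" "0 \<le> \<rho>" "\<rho> < 1"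
  shows "(\<integral>\<^sup>+x. f x \<partial>N) < \<infinity>"
proof -
  have "(\<integral>\<^sup>+x. f x \<partial>N) \<le> (\<integral>\<^sup>+x. (\<Sum>j. ennreal (w j) * indicator (S j) x) \<partial>N)"
  proof (intro nn_integral_mono)
    fix x assume x: "x \<in> space N"
    show "f x \<le> (\<Sum>j. ennreal (w j) * indicator (S j) x)"
    proof (cases "f x = 0")
      case False
      then obtain j where j: "x \<in> S j" "f x \<le> ennreal (w j)" using f[OF x] by auto
      then have "f x \<le> ennreal (w j) * indicator (S j) x" by simp
      also have "\<dots> \<le> (\<Sum>j. ennreal (w j) * indicator (S j) x)"
        by (rule ennreal_le_suminf)
      finally show ?thesis .
    qed simp
  qed
  also have "\<dots> = (\<Sum>j. ennreal (w j) * emeasure N (S j))"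
    by (subst nn_integral_suminf) (auto simp: nn_integral_cmult_indicator)
  also have "\<dots> \<le> (\<Sum>j. ennreal (C * \<rho> ^ j))"
    by (intro suminf_le bound) auto
  also have "\<dots> = ennreal (C * (1 / (1 - \<rho>)))"
    using assms by (intro suminf_ennreal_eq sums_mult geometric_sums) auto
  finally show ?thesis by (simp add: le_less_trans)
qed

text \<open>On the closed left half-plane, which is convex, the derivative of \<open>exp\<close> has
  modulus at most 1, so the mean value bound applies.\<close>

lemma norm_one_minus_exp_le:
  fixes w :: complex
  assumes "Re w \<le> 0"
  shows "norm (1 - exp w) \<le> norm w"
proof -
  have "norm (exp w - exp 0) \<le> 1 * norm (w - 0)"
  proof (rule field_differentiable_bound[where S = "{z. Re z \<le> 0}" and f = exp and f' = exp])
    show "convex {z. Re z \<le> 0}" by (rule convex_halfspace_Re_le)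
  qed (use assms in \<open>auto intro!: derivative_eq_intros\<close>)
  then show ?thesis by (simp add: norm_minus_commute)
qed

lemma norm_cis_diff_le: "norm (cis a - cis b) \<le> \<bar>a - b\<bar>"
proof -
  have "norm (1 - exp (\<i> * complex_of_real (a - b))) \<le> norm (\<i> * complex_of_real (a - b))"
    by (rule norm_one_minus_exp_le) simp
  moreover have "cis a - cis b = - cis b * (1 - cis (a - b))"
    by (simp add: right_diff_distrib cis_mult)
  ultimately show ?thesis by (simp add: norm_mult cis_conv_exp[symmetric] flip: of_real_diff)
qed

section \<open>Integrals of step functions\<close>

lemma borel_measurable_cis [measurable]: "cis \<in> borel_measurable borel"
  by (intro borel_measurable_continuous_onI continuous_intros)

definition finite_step :: "'a measure \<Rightarrow> ('a \<Rightarrow> real) \<Rightarrow> bool" where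
  "finite_step \<nu> s \<longleftrightarrow> simple_function \<nu> s \<and> emeasure \<nu> {x\<in>space \<nu>. s x \<noteq> 0} < \<infinity>"

text \<open>The control measure is kept abstract, since the calculus of step integrals uses nothing
  about its product form. \<open>\<kappa> 0 = 0\<close> lets the zero level of a step function,
  which may have infinite measure, drop out of the exponent.\<close>

locale levy_random_measure = prob_space M
  for M :: "'w measure" +
  fixes \<Lambda> :: "(real \<times> real) set \<Rightarrow> 'w \<Rightarrow> real" and \<nu> :: "(real \<times> real) measure" and \<kappa> :: "real \<Rightarrow> complex"
  assumes basis: "levy_basis M \<Lambda> \<nu> \<kappa>" and space_nu [simp]: "space \<nu> = UNIV"
    and kappa_0: "\<kappa> 0 = 0"
begin

section \<open>The axioms of the random measure and finite additivity\<close>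

lemma Lambda_measurable: "A \<in> sets \<nu> \<Longrightarrow> emeasure \<nu> A < \<infinity> \<Longrightarrow> \<Lambda> A \<in> borel_measurable M"
  using basis unfolding levy_basis_def by blast

lemma chf_Lambda:
  "A \<in> sets \<nu> \<Longrightarrow> emeasure \<nu> A < \<infinity> \<Longrightarrow> chf M (\<Lambda> A) \<zeta> = exp (complex_of_real (measure \<nu> A) * \<kappa> \<zeta>)"
  using basis unfolding levy_basis_def by blast

lemma indep_Lambda:
  fixes F :: "nat \<Rightarrow> (real \<times> real) set"
  assumes "disjoint_family_on F I" "\<And>i. i \<in> I \<Longrightarrow> F i \<in> sets \<nu>" "\<And>i. i \<in> I \<Longrightarrow> emeasure \<nu> (F i) < \<infinity>"
  shows "indep_vars (\<lambda>_. borel) (\<lambda>i. \<Lambda> (F i)) I"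
  using basis assms unfolding levy_basis_def by blast

lemma Lambda_countable_Union:
  fixes F :: "nat \<Rightarrow> (real \<times> real) set"
  assumes "disjoint_family F" "range F \<subseteq> sets \<nu>" "emeasure \<nu> (\<Union>(range F)) < \<infinity>"
  shows "AE \<omega> in M. (\<lambda>n. \<Sum>i<n. \<Lambda> (F i) \<omega>) \<longlonglongrightarrow> \<Lambda> (\<Union>(range F)) \<omega>"
  using basis assms unfolding levy_basis_def by blast

text \<open>Countable additivity for the constant empty family says that the multiples
  \<open>n * \<Lambda> {}\<close> converge almost surely; their consecutive differences
  \<open>\<Lambda> {}\<close> must then vanish.\<close>

lemma Lambda_empty: "AE \<omega> in M. \<Lambda> {} \<omega> = 0"
proof -
  have "AE \<omega> in M. (\<lambda>n. \<Sum>i<n. \<Lambda> {} \<omega>) \<longlonglongrightarrow> \<Lambda> {} \<omega>"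
    using Lambda_countable_Union[of "\<lambda>_. {}"] by (simp add: disjoint_family_on_def)
  then show ?thesis
  proof (eventually_elim)
    case (elim \<omega>)
    have "(\<lambda>n. (\<Sum>i<Suc n. \<Lambda> {} \<omega>) - (\<Sum>i<n. \<Lambda> {} \<omega>)) \<longlonglongrightarrow> \<Lambda> {} \<omega> - \<Lambda> {} \<omega>"
      by (intro tendsto_diff elim LIMSEQ_Suc[OF elim])
    then have "(\<lambda>n::nat. \<Lambda> {} \<omega>) \<longlonglongrightarrow> 0" by (simp add: algebra_simps)
    then show ?case by (simp add: tendsto_const_iff)
  qed
qed

text \<open>The finite family is padded with empty sets to a sequence. As
  \<open>\<Lambda> {}\<close> vanishes almost surely, the partial sums in countable additivity are
  eventually constant.\<close>

lemma Lambda_finite_Union: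
  assumes V: "finite V" and disj: "disjoint_family_on A V"
    and sets: "\<And>v. v \<in> V \<Longrightarrow> A v \<in> sets \<nu>" and fin: "\<And>v. v \<in> V \<Longrightarrow> emeasure \<nu> (A v) < \<infinity>"
  shows "AE \<omega> in M. \<Lambda> (\<Union>v\<in>V. A v) \<omega> = (\<Sum>v\<in>V. \<Lambda> (A v) \<omega>)"
proof -
  obtain e where e: "bij_betw e {..<card V} V"
    using ex_bij_betw_nat_finite[OF V] by (auto simp: atLeast0LessThan)
  define F where "F i = (if i < card V then A (e i) else {})" for i
  have eV: "e i \<in> V" if "i < card V" for i using e that by (auto simp: bij_betw_def)
  have inj: "i = j" if "e i = e j" "i < card V" "j < card V" for i j
    using e that by (auto simp: bij_betw_def inj_on_def)
  have disjF: "disjoint_family F"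
    unfolding disjoint_family_on_def
  proof (intro ballI impI)
    fix i j :: nat assume "i \<noteq> j"
    then have "A (e i) \<inter> A (e j) = {}" if "i < card V" "j < card V"
      using disj eV[OF that(1)] eV[OF that(2)] inj[OF _ that] unfolding disjoint_family_on_def by blast
    then show "F i \<inter> F j = {}" by (simp add: F_def)
  qed
  have U: "\<Union>(range F) = (\<Union>v\<in>V. A v)"
  proof -
    have "\<Union>(range F) = (\<Union>i<card V. A (e i))" by (auto simp: F_def split: if_splits)
    also have "\<dots> = \<Union>(A ` (e ` {..<card V}))" by auto
    finally show ?thesis using bij_betw_imp_surj_on[OF e] by (simp only:)
  qed
  have "emeasure \<nu> (\<Union>v\<in>V. A v) \<le> (\<Sum>v\<in>V. emeasure \<nu> (A v))"
    using sets by (intro emeasure_subadditive_finite V) auto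
  also have "\<dots> < \<infinity>" using fin by (simp add: V)
  finally have "AE \<omega> in M. (\<lambda>n. \<Sum>i<n. \<Lambda> (F i) \<omega>) \<longlonglongrightarrow> \<Lambda> (\<Union>v\<in>V. A v) \<omega>"
    using Lambda_countable_Union[OF disjF] sets eV unfolding U by (auto simp: F_def)
  with Lambda_empty show ?thesis
  proof eventually_elim
    case (elim \<omega>)
    have "(\<Sum>i<n. \<Lambda> (F i) \<omega>) = (\<Sum>v\<in>V. \<Lambda> (A v) \<omega>)" if "card V \<le> n" for n
    proof -
      have "(\<Sum>i<n. \<Lambda> (F i) \<omega>) = (\<Sum>i<card V. \<Lambda> (F i) \<omega>)"
        using that elim(1) by (intro sum.mono_neutral_right) (auto simp: F_def)
      also have "\<dots> = (\<Sum>i<card V. \<Lambda> (A (e i)) \<omega>)" by (simp add: F_def)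
      also have "\<dots> = (\<Sum>v\<in>V. \<Lambda> (A v) \<omega>)" by (rule sum.reindex_bij_betw[OF e])
      finally show ?thesis .
    qed
    then have "(\<lambda>n. \<Sum>i<n. \<Lambda> (F i) \<omega>) \<longlonglongrightarrow> (\<Sum>v\<in>V. \<Lambda> (A v) \<omega>)"
      by (intro tendsto_eventually) (auto simp: eventually_sequentially)
    then show ?case using elim(2) LIMSEQ_unique by blast
  qed
qed

section \<open>Linearity of the integral of step functions\<close>

lemma finite_step_level_sets:
  assumes "finite_step \<nu> s"
  shows "s -` {c} \<in> sets \<nu>" and "c \<noteq> 0 \<Longrightarrow> emeasure \<nu> (s -` {c}) < \<infinity>" and "finite (range s)"
proof -
  have s: "simple_function \<nu> s" and fin: "emeasure \<nu> {x. s x \<noteq> 0} < \<infinity>"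
    using assms by (auto simp: finite_step_def)
  show "s -` {c} \<in> sets \<nu>" using simple_functionD(2)[OF s, of "{c}"] by simp
  show "finite (range s)" using simple_functionD(1)[OF s] by simp
  show "emeasure \<nu> (s -` {c}) < \<infinity>" if "c \<noteq> 0"
  proof (rule le_less_trans[OF _ fin], rule emeasure_mono)
    have "{x. s x \<noteq> 0} = s -` (- {0}) \<inter> space \<nu>" by auto
    then show "{x. s x \<noteq> 0} \<in> sets \<nu>" using simple_functionD(2)[OF s] by metis
  qed (use that in auto)
qed

text \<open>\<open>simple_levy_integral\<close> groups points by the value of the step function, and
  the level sets of a sum are unrelated to those of the summands. Here the integral is evaluated
  over the finer partition generated by \<open>g\<close>, at the price of an exceptional null
  set.\<close>

lemma simple_levy_integral_compose:
  assumes g: "simple_function \<nu> g" and fs: "finite_step \<nu> (\<lambda>x. h (g x))"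
  shows "AE \<omega> in M. simple_levy_integral \<Lambda> (\<lambda>x. h (g x)) \<omega> = (\<Sum>v\<in>range g. h v * \<Lambda> (g -` {v}) \<omega>)"
proof -
  let ?s = "\<lambda>x. h (g x)"
  define R where "R = range g"
  define C where "C = range ?s - {0}"
  have finR: "finite R" using simple_functionD(1)[OF g] by (simp add: R_def)
  have finC: "finite C" using finite_step_level_sets(3)[OF fs] by (simp add: C_def)
  have "AE \<omega> in M. \<forall>c\<in>C. \<Lambda> (?s -` {c}) \<omega> = (\<Sum>v\<in>{v\<in>R. h v = c}. \<Lambda> (g -` {v}) \<omega>)"
  proof (rule AE_finite_allI[OF finC])
    fix c assume c: "c \<in> C"
    have U: "(\<Union>v\<in>{v\<in>R. h v = c}. g -` {v}) = ?s -` {c}" by (auto simp: R_def)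
    have gs: "g -` {v} \<in> sets \<nu>" for v using simple_functionD(2)[OF g, of "{v}"] by simp
    have "emeasure \<nu> (g -` {v}) < \<infinity>" if "h v = c" for v
      using finite_step_level_sets(2)[OF fs, of c] c that
      by (intro le_less_trans[OF emeasure_mono finite_step_level_sets(2)[OF fs, of c]])
         (auto simp: C_def finite_step_level_sets(1)[OF fs])
    then show "AE \<omega> in M. \<Lambda> (?s -` {c}) \<omega> = (\<Sum>v\<in>{v\<in>R. h v = c}. \<Lambda> (g -` {v}) \<omega>)"
      unfolding U[symmetric] using finR gs
      by (intro Lambda_finite_Union) (auto simp: disjoint_family_on_def)
  qed
  then show ?thesis
  proof eventually_elim
    case (elim \<omega>)
    \<comment> \<open>Levels of \<open>g\<close> with \<open>h v = 0\<close> may have infinite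
      measure, where nothing is known of \<open>\<Lambda>\<close>; they are set aside while the sum
      is regrouped and return with weight 0.\<close>
    define S where "S = {v\<in>R. h v \<noteq> 0}"
    have "simple_levy_integral \<Lambda> ?s \<omega> = (\<Sum>c\<in>C. c * (\<Sum>v\<in>{v\<in>R. h v = c}. \<Lambda> (g -` {v}) \<omega>))"
      unfolding simple_levy_integral_def C_def[symmetric] using elim by (intro sum.cong) auto
    also have "\<dots> = (\<Sum>c\<in>C. \<Sum>v\<in>{v\<in>S. h v = c}. h v * \<Lambda> (g -` {v}) \<omega>)"
    proof (intro sum.cong refl)
      fix c assume "c \<in> C"
      then have "{v\<in>S. h v = c} = {v\<in>R. h v = c}" by (auto simp: S_def C_def)
      then show "c * (\<Sum>v\<in>{v\<in>R. h v = c}. \<Lambda> (g -` {v}) \<omega>) = (\<Sum>v\<in>{v\<in>S. h v = c}. h v * \<Lambda> (g -` {v}) \<omega>)"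
        by (simp add: sum_distrib_left)
    qed
    also have "\<dots> = (\<Sum>v\<in>S. h v * \<Lambda> (g -` {v}) \<omega>)"
      using finR finC by (intro sum.group) (auto simp: S_def C_def R_def)
    also have "\<dots> = (\<Sum>v\<in>R. h v * \<Lambda> (g -` {v}) \<omega>)"
      using finR by (intro sum.mono_neutral_left) (auto simp: S_def)
    finally show ?case by (simp add: R_def)
  qed
qed

lemma finite_step_add:
  assumes "finite_step \<nu> s" "finite_step \<nu> s'"
  shows "finite_step \<nu> (\<lambda>x. s x + s' x)"
proof -
  have *: "{x. u x \<noteq> 0} \<in> sets \<nu>" if "simple_function \<nu> u" for u :: "real \<times> real \<Rightarrow> real"
  proof -
    have "{x. u x \<noteq> 0} = u -` (- {0}) \<inter> space \<nu>" by auto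
    then show ?thesis using simple_functionD(2)[OF that] by metis
  qed
  have "emeasure \<nu> {x. s x + s' x \<noteq> 0} \<le> emeasure \<nu> ({x. s x \<noteq> 0} \<union> {x. s' x \<noteq> 0})"
    using assms * by (intro emeasure_mono sets.Un) (auto simp: finite_step_def)
  also have "\<dots> \<le> emeasure \<nu> {x. s x \<noteq> 0} + emeasure \<nu> {x. s' x \<noteq> 0}"
    using assms * by (intro emeasure_subadditive) (auto simp: finite_step_def)
  also have "\<dots> < \<infinity>" using assms by (simp add: finite_step_def)
  finally show ?thesis using assms by (auto simp: finite_step_def simple_function_compose2)
qed

lemma finite_step_cmult: "finite_step \<nu> s \<Longrightarrow> finite_step \<nu> (\<lambda>x. c * s x)"
  by (cases "c = 0") (auto simp: finite_step_def simple_function_compose1)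

text \<open>Both summands and their sum are functions of the pair \<open>(s, s')\<close>, so all
  three integrals can be expanded over its level sets.\<close>

lemma simple_levy_integral_add:
  assumes s: "finite_step \<nu> s" "finite_step \<nu> s'"
  shows "AE \<omega> in M. simple_levy_integral \<Lambda> (\<lambda>x. s x + s' x) \<omega> = simple_levy_integral \<Lambda> s \<omega> + simple_levy_integral \<Lambda> s' \<omega>"
proof -
  have g: "simple_function \<nu> (\<lambda>x. (s x, s' x))" using s by (auto simp: finite_step_def)
  from simple_levy_integral_compose[OF g, of "\<lambda>v. fst v + snd v"]
    simple_levy_integral_compose[OF g, of fst] simple_levy_integral_compose[OF g, of snd]
  show ?thesis using s finite_step_add[OF s] by (auto simp: distrib_right sum.distrib)
qed

lemma simple_levy_integral_cmult:
  assumes s: "finite_step \<nu> s"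
  shows "AE \<omega> in M. simple_levy_integral \<Lambda> (\<lambda>x. c * s x) \<omega> = c * simple_levy_integral \<Lambda> s \<omega>"
proof -
  have g: "simple_function \<nu> s" using s by (auto simp: finite_step_def)
  from simple_levy_integral_compose[OF g, of "\<lambda>v. c * v"] simple_levy_integral_compose[OF g, of "\<lambda>v. v"]
  show ?thesis using s finite_step_cmult[OF s] by (auto simp: sum_distrib_left mult.assoc)
qed

lemma simple_levy_integral_lincomb:
  assumes "finite J" "\<And>j. j \<in> J \<Longrightarrow> finite_step \<nu> (s j)"
  shows "finite_step \<nu> (\<lambda>x. \<Sum>j\<in>J. c j * s j x) \<and>
    (AE \<omega> in M. simple_levy_integral \<Lambda> (\<lambda>x. \<Sum>j\<in>J. c j * s j x) \<omega> = (\<Sum>j\<in>J. c j * simple_levy_integral \<Lambda> (s j) \<omega>))"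
  using assms
proof (induction J)
  case empty
  then show ?case by (simp add: finite_step_def simple_levy_integral_def)
next
  case (insert i J)
  let ?g = "\<lambda>x. \<Sum>j\<in>J. c j * s j x"
  have IH: "finite_step \<nu> ?g" "AE \<omega> in M. simple_levy_integral \<Lambda> ?g \<omega> = (\<Sum>j\<in>J. c j * simple_levy_integral \<Lambda> (s j) \<omega>)"
    using insert by auto
  have i: "finite_step \<nu> (s i)" using insert by auto
  have "AE \<omega> in M. simple_levy_integral \<Lambda> (\<lambda>x. c i * s i x + ?g x) \<omega> =
      c i * simple_levy_integral \<Lambda> (s i) \<omega> + (\<Sum>j\<in>J. c j * simple_levy_integral \<Lambda> (s j) \<omega>)"
    using simple_levy_integral_add[OF finite_step_cmult[OF i, of "c i"] IH(1)] simple_levy_integral_cmult[OF i, of "c i"] IH(2)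
    by eventually_elim simp
  then show ?case using insert.hyps finite_step_add[OF finite_step_cmult[OF i] IH(1)] by simp
qed

section \<open>Characteristic functions of step integrals\<close>

lemma measurable_simple_levy_integral:
  assumes "finite_step \<nu> s"
  shows "simple_levy_integral \<Lambda> s \<in> borel_measurable M"
  unfolding simple_levy_integral_def[abs_def]
  using finite_step_level_sets[OF assms]
  by (intro borel_measurable_sum borel_measurable_times borel_measurable_const Lambda_measurable) auto

lemma chf_simple_levy_integral:
  assumes s: "finite_step \<nu> s"
  shows "chf M (simple_levy_integral \<Lambda> s) \<zeta> =
    exp (\<Sum>c\<in>range s - {0}. complex_of_real (measure \<nu> (s -` {c})) * \<kappa> (\<zeta> * c))"
proof -
  let ?C = "range s - {0}"
  note L = finite_step_level_sets[OF s]
  have fin: "finite ?C" using L by simp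
  \<comment> \<open>Independence of the random measure is stated for sets indexed by naturals, so
    the nonzero levels are enumerated.\<close>
  obtain e where e: "bij_betw e {..<card ?C} ?C"
    using ex_bij_betw_nat_finite[OF fin] by (auto simp: atLeast0LessThan)
  let ?I = "{..<card ?C}"
  have eC: "e i \<noteq> 0" if "i \<in> ?I" for i using e that by (auto simp: bij_betw_def)
  have "indep_vars (\<lambda>_. borel) (\<lambda>i. \<Lambda> (s -` {e i})) ?I"
    using L eC e by (intro indep_Lambda) (auto simp: disjoint_family_on_def bij_betw_def inj_on_def)
  then have ind: "indep_vars (\<lambda>_. borel) (\<lambda>i \<omega>. cis (\<zeta> * (e i * \<Lambda> (s -` {e i}) \<omega>))) ?I"
    by (rule indep_vars_compose2) measurable
  have "cis (\<zeta> * simple_levy_integral \<Lambda> s \<omega>) = (\<Prod>i\<in>?I. cis (\<zeta> * (e i * \<Lambda> (s -` {e i}) \<omega>)))" for \<omega>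
  proof -
    have "simple_levy_integral \<Lambda> s \<omega> = (\<Sum>i\<in>?I. e i * \<Lambda> (s -` {e i}) \<omega>)"
      unfolding simple_levy_integral_def by (rule sum.reindex_bij_betw[OF e, symmetric])
    then show ?thesis by (simp add: cis_conv_exp exp_sum sum_distrib_left)
  qed
  moreover have "integrable M (\<lambda>\<omega>. cis (\<zeta> * (e i * \<Lambda> (s -` {e i}) \<omega>)))" if "i \<in> ?I" for i
  proof -
    have [measurable]: "\<Lambda> (s -` {e i}) \<in> borel_measurable M"
      using Lambda_measurable[OF L(1) L(2)] eC that by auto
    show ?thesis by (rule integrable_const_bound[where B = 1]) auto
  qed
  ultimately have "chf M (simple_levy_integral \<Lambda> s) \<zeta> = (\<Prod>i\<in>?I. \<integral>\<omega>. cis (\<zeta> * (e i * \<Lambda> (s -` {e i}) \<omega>)) \<partial>M)"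
    using indep_vars_lebesgue_integral[OF _ ind] by simp
  also have "\<dots> = (\<Prod>i\<in>?I. exp (complex_of_real (measure \<nu> (s -` {e i})) * \<kappa> (\<zeta> * e i)))"
    using chf_Lambda[OF L(1) L(2)] eC by (intro prod.cong) (auto simp: mult.assoc[symmetric])
  also have "\<dots> = exp (\<Sum>i\<in>?I. complex_of_real (measure \<nu> (s -` {e i})) * \<kappa> (\<zeta> * e i))"
    by (simp add: exp_sum)
  also have "(\<Sum>i\<in>?I. complex_of_real (measure \<nu> (s -` {e i})) * \<kappa> (\<zeta> * e i)) =
      (\<Sum>c\<in>?C. complex_of_real (measure \<nu> (s -` {c})) * \<kappa> (\<zeta> * c))"
    by (rule sum.reindex_bij_betw[OF e])
  finally show ?thesis .
qed

lemma
  fixes F :: "real \<Rightarrow> 'b :: {banach, second_countable_topology}"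
  assumes s: "finite_step \<nu> s" and "F 0 = 0"
  shows integrable_finite_step: "integrable \<nu> (\<lambda>x. F (s x))"
    and integral_finite_step: "(\<integral>x. F (s x) \<partial>\<nu>) = (\<Sum>c\<in>range s - {0}. measure \<nu> (s -` {c}) *\<^sub>R F c)"
proof -
  note L = finite_step_level_sets[OF s]
  have "F (s x) = (\<Sum>c\<in>range s - {0}. indicat_real (s -` {c}) x *\<^sub>R F c)" for x
  proof (cases "s x = 0")
    case True
    then show ?thesis using \<open>F 0 = 0\<close> by (auto intro!: sum.neutral[symmetric] simp: indicator_def)
  next
    case False
    then have "(\<Sum>c\<in>range s - {0}. indicat_real (s -` {c}) x *\<^sub>R F c) = (\<Sum>c\<in>{s x}. indicat_real (s -` {c}) x *\<^sub>R F c)"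
      using L(3) by (intro sum.mono_neutral_right) (auto simp: indicator_def)
    then show ?thesis by simp
  qed
  then have eq: "(\<lambda>x. F (s x)) = (\<lambda>x. \<Sum>c\<in>range s - {0}. indicat_real (s -` {c}) x *\<^sub>R F c)" by auto
  have ind: "integrable \<nu> (indicat_real (s -` {c}))" if "c \<noteq> 0" for c
    using L(1) L(2)[OF that] by (simp add: integrable_indicator_iff)
  then have int: "integrable \<nu> (\<lambda>x. indicat_real (s -` {c}) x *\<^sub>R F c)" if "c \<noteq> 0" for c
    using that by (intro integrable_scaleR_left)
  show "integrable \<nu> (\<lambda>x. F (s x))"
    unfolding eq using int by (intro Bochner_Integration.integrable_sum) auto
  show "(\<integral>x. F (s x) \<partial>\<nu>) = (\<Sum>c\<in>range s - {0}. measure \<nu> (s -` {c}) *\<^sub>R F c)"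
    unfolding eq using int ind L(1)
    by (subst Bochner_Integration.integral_sum) (auto intro!: sum.cong simp: integral_scaleR_left)
qed

text \<open>Written as an integral, the exponent is open to dominated convergence and Fatou's lemma
  along approximating step functions.\<close>

lemma chf_simple_levy_integral_eq_exp:
  assumes s: "finite_step \<nu> s"
  shows "chf M (simple_levy_integral \<Lambda> s) \<zeta> = exp (\<integral>x. \<kappa> (\<zeta> * s x) \<partial>\<nu>)"
  using integral_finite_step[OF s, of "\<lambda>c. \<kappa> (\<zeta> * c)"]
  by (simp add: chf_simple_levy_integral[OF s] kappa_0 scaleR_conv_of_real)

end

section \<open>Limits of step integrals\<close>

lemma finite_step_approximation:
  fixes f :: "'a \<Rightarrow> real"
  assumes f[measurable]: "f \<in> borel_measurable \<nu>" and nonneg: "\<And>x. 0 \<le> f x"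
    and fin: "\<And>c. 0 < c \<Longrightarrow> emeasure \<nu> {x\<in>space \<nu>. c \<le> f x} < \<infinity>"
  obtains s where "\<And>n. finite_step \<nu> (s n)" "\<And>n x. \<bar>s n x\<bar> \<le> f x" "\<And>x. (\<lambda>n. s n x) \<longlonglongrightarrow> f x"
proof -
  obtain U :: "nat \<Rightarrow> 'a \<Rightarrow> ennreal" where U: "\<And>i. simple_function \<nu> (U i)" "incseq U" "\<And>i x. U i x < top"
      "\<And>x. (SUP i. U i x) = ennreal (f x)"
    using borel_measurable_implies_simple_function_sequence'[of "\<lambda>x. ennreal (f x)" \<nu>] by auto
  define E where "E n = {x\<in>space \<nu>. 1 / real (Suc n) \<le> f x}" for n
  \<comment> \<open>Cutting off below \<open>1 / (n + 1)\<close> forces a support of finite measure.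
    Where \<open>f x > 0\<close> the cut-off is inactive from some \<open>n\<close> on, so the limit
    is that of the uncut approximants.\<close>
  define s where "s n x = enn2real (U n x) * (if x \<in> space \<nu> \<longrightarrow> 1 / real (Suc n) \<le> f x then 1 else 0)" for n x
  have Uf: "U n x \<le> ennreal (f x)" for n x by (metis SUP_upper UNIV_I U(4))
  then have Uf': "enn2real (U n x) \<le> f x" for n x
    using enn2real_mono[OF Uf] nonneg by simp
  show thesis
  proof
    fix n
    have E[measurable]: "E n \<in> sets \<nu>" unfolding E_def by measurable
    have "simple_function \<nu> (\<lambda>x. enn2real (U n x) * indicator (E n) x)"
      using U(1) E by (intro simple_function_mult simple_function_indicator simple_function_compose1[OF U(1)])
    also have "?this \<longleftrightarrow> simple_function \<nu> (s n)"
      by (intro simple_function_cong) (auto simp: s_def E_def)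
    finally have 1: "simple_function \<nu> (s n)" .
    have "emeasure \<nu> {x\<in>space \<nu>. s n x \<noteq> 0} \<le> emeasure \<nu> (E n)"
      by (intro emeasure_mono E) (auto simp: s_def E_def split: if_splits)
    also have "\<dots> < \<infinity>" unfolding E_def by (intro fin) simp
    finally show "finite_step \<nu> (s n)" using 1 by (simp add: finite_step_def)
  next
    show "\<bar>s n x\<bar> \<le> f x" for n x using Uf'[of n x] nonneg[of x] by (simp add: s_def)
  next
    fix x
    have "(\<lambda>n. U n x) \<longlonglongrightarrow> ennreal (f x)"
      unfolding U(4)[symmetric] using U(2) by (intro LIMSEQ_SUP) (auto simp: incseq_def le_fun_def)
    then have lim: "(\<lambda>n. enn2real (U n x)) \<longlonglongrightarrow> f x"
      using tendsto_enn2real[of "\<lambda>n. U n x" "f x" sequentially] nonneg[of x] by simp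
    show "(\<lambda>n. s n x) \<longlonglongrightarrow> f x"
    proof (cases "f x = 0")
      case True
      then have "s n x = 0" for n
        using Uf'[of n x] enn2real_nonneg[of "U n x"] by (simp add: s_def)
      then show ?thesis using True by simp
    next
      case False
      then have "0 < f x" using nonneg[of x] by simp
      then obtain N where N: "1 / real (Suc N) < f x" using nat_approx_posE by blast
      have "1 / real (Suc n) \<le> f x" if "N \<le> n" for n
      proof -
        have "1 / real (Suc n) \<le> 1 / real (Suc N)" using that by (intro divide_left_mono) auto
        then show ?thesis using N by simp
      qed
      then have "\<forall>\<^sub>F n in sequentially. enn2real (U n x) = s n x"
        by (auto simp: eventually_sequentially s_def)
      then show ?thesis using lim by (rule Lim_transform_eventually[rotated])
    qed
  qed
qed

text \<open>\<open>cis\<close> is both Lipschitz and bounded: the Lipschitz bound handles the set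
  where \<open>Z n\<close> is close to \<open>Z0\<close>, and the bound 2 the rest, whose
  probability is below \<open>e / 4\<close>.\<close>

lemma (in prob_space) conv_in_prob_imp_cis:
  assumes [measurable]: "\<And>n. Z n \<in> borel_measurable M" "Z0 \<in> borel_measurable M"
    and conv: "conv_in_prob M Z Z0"
  shows "(\<lambda>n. \<integral>\<omega>. norm (cis (\<zeta> * Z n \<omega>) - cis (\<zeta> * Z0 \<omega>)) \<partial>M) \<longlonglongrightarrow> 0"
proof (rule LIMSEQ_I)
  fix e :: real assume e: "0 < e"
  \<comment> \<open>Adding 1 to \<open>|\<zeta>|\<close> avoids a division by 0 at frequency
    0.\<close>
  define d where "d = e / (2 * (\<bar>\<zeta>\<bar> + 1))"
  have d: "0 < d" using e by (simp add: d_def add_nonneg_pos)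
  have zd: "\<bar>\<zeta>\<bar> * d \<le> e / 2"
  proof -
    have "\<bar>\<zeta>\<bar> * d \<le> (\<bar>\<zeta>\<bar> + 1) * d" using d by simp
    also have "\<dots> = e / 2" by (simp add: d_def field_simps)
    finally show ?thesis .
  qed
  have "(\<lambda>n. prob {\<omega>\<in>space M. d \<le> \<bar>Z n \<omega> - Z0 \<omega>\<bar>}) \<longlonglongrightarrow> 0"
    using conv d by (simp add: conv_in_prob_def)
  then have "\<forall>\<^sub>F n in sequentially. prob {\<omega>\<in>space M. d \<le> \<bar>Z n \<omega> - Z0 \<omega>\<bar>} < e / 4"
    by (rule order_tendstoD) (use e in simp)
  then obtain N where N: "\<And>n. N \<le> n \<Longrightarrow> prob {\<omega>\<in>space M. d \<le> \<bar>Z n \<omega> - Z0 \<omega>\<bar>} < e / 4"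
    by (auto simp: eventually_sequentially)
  have "norm ((\<integral>\<omega>. norm (cis (\<zeta> * Z n \<omega>) - cis (\<zeta> * Z0 \<omega>)) \<partial>M) - 0) < e" if "N \<le> n" for n
  proof -
    let ?B = "{\<omega>\<in>space M. d \<le> \<bar>Z n \<omega> - Z0 \<omega>\<bar>}"
    have *: "norm (cis (\<zeta> * Z n \<omega>) - cis (\<zeta> * Z0 \<omega>)) \<le> e / 2 + 2 * indicator ?B \<omega>" if "\<omega> \<in> space M" for \<omega>
    proof (cases "\<omega> \<in> ?B")
      case True
      have "norm (cis (\<zeta> * Z n \<omega>) - cis (\<zeta> * Z0 \<omega>)) \<le> 2"
        by (rule order_trans[OF norm_triangle_ineq4]) simp
      then show ?thesis using True e by simp
    next
      case False
      have "norm (cis (\<zeta> * Z n \<omega>) - cis (\<zeta> * Z0 \<omega>)) \<le> \<bar>\<zeta> * Z n \<omega> - \<zeta> * Z0 \<omega>\<bar>"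
        by (rule norm_cis_diff_le)
      also have "\<dots> = \<bar>\<zeta>\<bar> * \<bar>Z n \<omega> - Z0 \<omega>\<bar>" by (simp add: abs_mult[symmetric] right_diff_distrib)
      also have "\<dots> \<le> \<bar>\<zeta>\<bar> * d" using False that by (intro mult_left_mono) auto
      finally show ?thesis using zd False by simp
    qed
    have "(\<integral>\<omega>. norm (cis (\<zeta> * Z n \<omega>) - cis (\<zeta> * Z0 \<omega>)) \<partial>M) \<le> (\<integral>\<omega>. e / 2 + 2 * indicator ?B \<omega> \<partial>M)"
    proof (rule integral_mono)
      have "norm (cis (\<zeta> * Z n \<omega>) - cis (\<zeta> * Z0 \<omega>)) \<le> 2" for \<omega>
        by (rule order_trans[OF norm_triangle_ineq4]) simp
      then show "integrable M (\<lambda>\<omega>. norm (cis (\<zeta> * Z n \<omega>) - cis (\<zeta> * Z0 \<omega>)))"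
        by (intro integrable_const_bound[where B = 2]) auto
    qed (use * in \<open>auto intro!: integrable_real_indicator simp: less_top[symmetric]\<close>)
    also have "\<dots> = e / 2 + 2 * prob ?B"
      by (subst Bochner_Integration.integral_add) (auto intro!: integrable_real_indicator simp: less_top[symmetric] prob_space)
    also have "\<dots> < e" using N[OF that] by simp
    finally show ?thesis by (simp add: Bochner_Integration.integral_nonneg)
  qed
  then show "\<exists>N. \<forall>n\<ge>N. norm ((\<integral>\<omega>. norm (cis (\<zeta> * Z n \<omega>) - cis (\<zeta> * Z0 \<omega>)) \<partial>M) - 0) < e" by blast
qed

text \<open>Near 0 the quadratic Taylor remainder takes away at most half of the linear term. This
  converse of the half-plane bound recovers the size of a small exponent from a characteristic
  function.\<close>

lemma norm_exp_minus_one_ge: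
  fixes w :: complex
  assumes "norm w \<le> 1/4"
  shows "norm w / 2 \<le> norm (1 - exp w)"
proof -
  have "norm (exp w - (1 + w)) \<le> exp (norm w) * (norm w)\<^sup>2"
    using Taylor_exp_field[of w 1] by (simp add: numeral_2_eq_2)
  also have "\<dots> \<le> 2 * (norm w * (1/4))"
  proof (rule mult_mono)
    have "exp (norm w) \<le> exp (1/2)" using assms by simp
    also have "\<dots> \<le> 2" using exp_half_le2 by simp
    finally show "exp (norm w) \<le> 2" .
    show "(norm w)\<^sup>2 \<le> norm w * (1/4)" unfolding power2_eq_square using assms by (intro mult_left_mono) auto
  qed auto
  finally have "norm (exp w - (1 + w)) \<le> norm w / 2" by simp
  moreover have "norm w \<le> norm (exp w - (1 + w)) + norm (1 - exp w)"
    using norm_triangle_ineq[of "exp w - (1 + w)" "1 - exp w"] by simp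
  ultimately show ?thesis by linarith
qed

section \<open>Random variables approximated by step integrals\<close>

context levy_random_measure
begin

text \<open>This keeps just what the bounds need: dominated step functions converging to
  \<open>g\<close>, with convergent characteristic functions. \<open>G\<close> is separate from
  \<open>g\<close> because a combination with coefficients of both signs is dominated by the sum of
  the moduli, not by its own modulus.\<close>

definition step_limit :: "(real \<times> real \<Rightarrow> real) \<Rightarrow> (real \<times> real \<Rightarrow> real) \<Rightarrow> ('w \<Rightarrow> real) \<Rightarrow> bool" where
  "step_limit g G Z \<longleftrightarrow> Z \<in> borel_measurable M \<and>
     (\<exists>s. (\<forall>n. finite_step \<nu> (s n)) \<and> (\<forall>n x. \<bar>s n x\<bar> \<le> G x) \<and> (\<forall>x. (\<lambda>n. s n x) \<longlonglongrightarrow> g x) \<and>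
       (\<forall>\<zeta>. (\<lambda>n. chf M (simple_levy_integral \<Lambda> (s n)) \<zeta>) \<longlonglongrightarrow> chf M Z \<zeta>))"

lemma finite_step_measurable: "finite_step \<nu> s \<Longrightarrow> s \<in> borel_measurable \<nu>"
  by (simp add: finite_step_def borel_measurable_simple_function)

text \<open>The hypotheses speak of each integral separately, so each kernel gets its own
  approximants and these are combined afterwards. Nonnegative kernels allow the domination by
  \<open>f j\<close> itself.\<close>

lemma step_limit_lincomb:
  fixes f :: "nat \<Rightarrow> real \<times> real \<Rightarrow> real" and Z :: "nat \<Rightarrow> 'w \<Rightarrow> real"
  assumes J: "finite J"
    and f[measurable]: "\<And>j. j \<in> J \<Longrightarrow> f j \<in> borel_measurable \<nu>"
    and nonneg: "\<And>j x. j \<in> J \<Longrightarrow> 0 \<le> f j x"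
    and fin: "\<And>j c. j \<in> J \<Longrightarrow> 0 < c \<Longrightarrow> emeasure \<nu> {x. c \<le> f j x} < \<infinity>"
    and Z: "\<And>j. j \<in> J \<Longrightarrow> levy_integral_of M \<Lambda> \<nu> (f j) (Z j)"
  shows "step_limit (\<lambda>x. \<Sum>j\<in>J. c j * f j x) (\<lambda>x. \<Sum>j\<in>J. \<bar>c j\<bar> * f j x) (\<lambda>\<omega>. \<Sum>j\<in>J. c j * Z j \<omega>)"
proof -
  have "\<exists>s. (\<forall>n. finite_step \<nu> (s n)) \<and> (\<forall>n x. \<bar>s n x\<bar> \<le> f j x) \<and> (\<forall>x. (\<lambda>n. s n x) \<longlonglongrightarrow> f j x)"
    if "j \<in> J" for j
  proof -
    have "emeasure \<nu> {x\<in>space \<nu>. c \<le> f j x} < \<infinity>" if "0 < c" for c using fin[OF \<open>j \<in> J\<close> that] by simp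
    from finite_step_approximation[of "f j" \<nu>, OF f[OF that] nonneg[OF that] this]
    obtain s where "\<And>n. finite_step \<nu> (s n)" "\<And>n x. \<bar>s n x\<bar> \<le> f j x" "\<And>x. (\<lambda>n. s n x) \<longlonglongrightarrow> f j x"
      by metis
    then show ?thesis by (intro exI[of _ s]) simp
  qed
  then obtain s where s: "\<And>j n. j \<in> J \<Longrightarrow> finite_step \<nu> (s j n)" "\<And>j n x. j \<in> J \<Longrightarrow> \<bar>s j n x\<bar> \<le> f j x"
      "\<And>j x. j \<in> J \<Longrightarrow> (\<lambda>n. s j n x) \<longlonglongrightarrow> f j x"
    by metis
  have Zm[measurable]: "\<And>j. j \<in> J \<Longrightarrow> Z j \<in> borel_measurable M" using Z by (simp add: levy_integral_of_def)
  have conv: "conv_in_prob M (\<lambda>n. simple_levy_integral \<Lambda> (s j n)) (Z j)" if "j \<in> J" for j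
  proof -
    have "\<forall>n. simple_function \<nu> (s j n) \<and> emeasure \<nu> {x\<in>space \<nu>. s j n x \<noteq> 0} < \<infinity> \<and> (\<forall>x. \<bar>s j n x\<bar> \<le> \<bar>f j x\<bar>)"
      using s(1)[OF that] s(2)[OF that] nonneg[OF that] by (auto simp: finite_step_def)
    then show ?thesis using Z[OF that] s(3)[OF that] unfolding levy_integral_of_def by blast
  qed
  define t where "t n x = (\<Sum>j\<in>J. c j * s j n x)" for n x
  define I where "I j n = simple_levy_integral \<Lambda> (s j n)" for j n
  have Im[measurable]: "\<And>j n. j \<in> J \<Longrightarrow> I j n \<in> borel_measurable M"
    using s(1) by (simp add: I_def measurable_simple_levy_integral)
  have t: "finite_step \<nu> (t n)" "AE \<omega> in M. simple_levy_integral \<Lambda> (t n) \<omega> = (\<Sum>j\<in>J. c j * I j n \<omega>)" for n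
    using simple_levy_integral_lincomb[OF J, of "\<lambda>j. s j n" c] s(1) unfolding t_def I_def by auto
  have "\<bar>t n x\<bar> \<le> (\<Sum>j\<in>J. \<bar>c j\<bar> * f j x)" for n x
    unfolding t_def by (rule order_trans[OF sum_abs]) (auto intro!: sum_mono mult_left_mono s(2) simp: abs_mult)
  moreover have "(\<lambda>n. t n x) \<longlonglongrightarrow> (\<Sum>j\<in>J. c j * f j x)" for x
    unfolding t_def by (intro tendsto_sum tendsto_mult tendsto_const s(3))
  moreover have "(\<lambda>n. chf M (simple_levy_integral \<Lambda> (t n)) \<zeta>) \<longlonglongrightarrow> chf M (\<lambda>\<omega>. \<Sum>j\<in>J. c j * Z j \<omega>) \<zeta>" for \<zeta>
  proof -
    let ?d = "\<lambda>n j \<omega>. norm (cis (\<zeta> * c j * I j n \<omega>) - cis (\<zeta> * c j * Z j \<omega>))"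
    have tm[measurable]: "simple_levy_integral \<Lambda> (t n) \<in> borel_measurable M" for n
      by (rule measurable_simple_levy_integral[OF t(1)])
    have icis: "integrable M (\<lambda>\<omega>. cis (W \<omega>))" if [measurable]: "W \<in> borel_measurable M" for W
      by (rule integrable_const_bound[where B = 1]) auto
    have chft: "chf M (simple_levy_integral \<Lambda> (t n)) \<zeta> = chf M (\<lambda>\<omega>. \<Sum>j\<in>J. c j * I j n \<omega>) \<zeta>" for n
    proof (rule integral_cong_AE)
      show "AE \<omega> in M. cis (\<zeta> * simple_levy_integral \<Lambda> (t n) \<omega>) = cis (\<zeta> * (\<Sum>j\<in>J. c j * I j n \<omega>))"
        using t(2)[of n] by eventually_elim simp
    qed measurable
    have dint: "integrable M (?d n j)" if "j \<in> J" for n j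
      using that by (intro integrable_norm Bochner_Integration.integrable_diff icis) auto
    have le: "norm (chf M (simple_levy_integral \<Lambda> (t n)) \<zeta> - chf M (\<lambda>\<omega>. \<Sum>j\<in>J. c j * Z j \<omega>) \<zeta>) \<le> (\<Sum>j\<in>J. \<integral>\<omega>. ?d n j \<omega> \<partial>M)" for n
    proof -
      have "norm (cis (\<zeta> * (\<Sum>j\<in>J. c j * I j n \<omega>)) - cis (\<zeta> * (\<Sum>j\<in>J. c j * Z j \<omega>))) \<le> (\<Sum>j\<in>J. ?d n j \<omega>)" for \<omega>
      proof -
        \<comment> \<open>As a product of factors of modulus 1, the difference of two such terms is
          at most the sum of the differences of the factors. Each factor converges in mean by
          convergence in probability.\<close>
        have *: "cis (\<zeta> * (\<Sum>j\<in>J. c j * u j)) = (\<Prod>j\<in>J. cis (\<zeta> * c j * u j))" for u :: "nat \<Rightarrow> real"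
          by (simp add: cis_conv_exp exp_sum[OF J, symmetric] sum_distrib_left mult.assoc)
        show ?thesis unfolding * by (rule norm_prod_diff) auto
      qed
      then have "norm (chf M (\<lambda>\<omega>. \<Sum>j\<in>J. c j * I j n \<omega>) \<zeta> - chf M (\<lambda>\<omega>. \<Sum>j\<in>J. c j * Z j \<omega>) \<zeta>) \<le> (\<integral>\<omega>. (\<Sum>j\<in>J. ?d n j \<omega>) \<partial>M)"
        by (subst Bochner_Integration.integral_diff[symmetric])
           (auto intro!: icis integral_norm_bound[THEN order_trans] integral_mono Bochner_Integration.integrable_sum dint integrable_norm Bochner_Integration.integrable_diff)
      also have "\<dots> = (\<Sum>j\<in>J. \<integral>\<omega>. ?d n j \<omega> \<partial>M)"
        using dint by (intro Bochner_Integration.integral_sum)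
      finally show ?thesis by (simp add: chft)
    qed
    have sum0: "(\<lambda>n. \<Sum>j\<in>J. \<integral>\<omega>. ?d n j \<omega> \<partial>M) \<longlonglongrightarrow> (\<Sum>j\<in>J. 0)"
      using conv by (intro tendsto_sum conv_in_prob_imp_cis) (auto simp: I_def[symmetric])
    have "(\<lambda>n. chf M (simple_levy_integral \<Lambda> (t n)) \<zeta> - chf M (\<lambda>\<omega>. \<Sum>j\<in>J. c j * Z j \<omega>) \<zeta>) \<longlonglongrightarrow> 0"
      by (rule Lim_null_comparison[OF always_eventually sum0[unfolded sum.neutral_const]]) (rule allI, rule le)
    then show ?thesis by (rule LIM_zero_cancel)
  qed
  ultimately show ?thesis
    unfolding step_limit_def using t(1) by (auto intro!: exI[of _ t])
qed

text \<open>For a step integral the exponent has nonpositive real part, so \<open>1 - exp\<close> is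
  bounded by the exponent and hence by the integral of \<open>H\<close>. It is \<open>H\<close>, not
  \<open>\<kappa>\<close>, that passes to the limit: \<open>H\<close> is continuous and monotone in
  the modulus, so its values at \<open>G\<close> dominate.\<close>

lemma step_limit_one_minus_chf_le:
  assumes sl: "step_limit g G Z" and [measurable]: "g \<in> borel_measurable \<nu>"
    and Re_kappa: "\<And>z. Re (\<kappa> z) \<le> 0"
    and kappa: "\<And>z. norm (\<kappa> z) \<le> A * \<bar>z\<bar> powr q + B * \<bar>z\<bar> powr q'"
    and "0 \<le> A" "0 \<le> B" "0 < q" "0 < q'"
    and int: "integrable \<nu> (\<lambda>x. A * \<bar>\<zeta> * G x\<bar> powr q + B * \<bar>\<zeta> * G x\<bar> powr q')"
  shows "norm (1 - chf M Z \<zeta>) \<le> (\<integral>x. A * \<bar>\<zeta> * g x\<bar> powr q + B * \<bar>\<zeta> * g x\<bar> powr q' \<partial>\<nu>)"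
proof -
  obtain s where s: "\<And>n. finite_step \<nu> (s n)" "\<And>n x. \<bar>s n x\<bar> \<le> G x" "\<And>x. (\<lambda>n. s n x) \<longlonglongrightarrow> g x"
      "\<And>\<zeta>. (\<lambda>n. chf M (simple_levy_integral \<Lambda> (s n)) \<zeta>) \<longlonglongrightarrow> chf M Z \<zeta>"
    using sl unfolding step_limit_def by auto
  have [measurable]: "s n \<in> borel_measurable \<nu>" for n by (rule finite_step_measurable[OF s(1)])
  define H where "H c = A * \<bar>\<zeta> * c\<bar> powr q + B * \<bar>\<zeta> * c\<bar> powr q'" for c
  have H0: "H 0 = 0" by (simp add: H_def)
  have [measurable]: "H \<in> borel_measurable borel" unfolding H_def[abs_def] by measurable
  have Hcont: "(\<lambda>n. H (u n)) \<longlonglongrightarrow> H l" if "u \<longlonglongrightarrow> l" for u l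
    unfolding H_def using that assms by (intro tendsto_intros tendsto_powr') auto
  have Hmono: "\<bar>H c\<bar> \<le> H d" if "\<bar>c\<bar> \<le> d" for c d
    unfolding H_def using that assms by (auto simp: abs_mult intro!: add_mono mult_left_mono powr_mono2 order_trans[OF abs_triangle_ineq])
  have "(\<lambda>n. \<integral>x. H (s n x) \<partial>\<nu>) \<longlonglongrightarrow> (\<integral>x. H (g x) \<partial>\<nu>)"
  proof (rule integral_dominated_convergence)
    show "integrable \<nu> (\<lambda>x. H (G x))" using int by (simp add: H_def)
  qed (use s Hmono Hcont in auto)
  moreover have "norm (1 - chf M (simple_levy_integral \<Lambda> (s n)) \<zeta>) \<le> (\<integral>x. H (s n x) \<partial>\<nu>)" for n
  proof -
    have ik: "integrable \<nu> (\<lambda>x. \<kappa> (\<zeta> * s n x))"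
      using integrable_finite_step[OF s(1), of "\<lambda>c. \<kappa> (\<zeta> * c)"] by (simp add: kappa_0)
    have "Re (\<integral>x. \<kappa> (\<zeta> * s n x) \<partial>\<nu>) = (\<integral>x. Re (\<kappa> (\<zeta> * s n x)) \<partial>\<nu>)"
      using ik by simp
    also have "\<dots> \<le> (\<integral>x. 0 \<partial>\<nu>)"
      using ik Re_kappa by (intro integral_mono) auto
    also have "\<dots> = 0" by simp
    finally have "norm (1 - exp (\<integral>x. \<kappa> (\<zeta> * s n x) \<partial>\<nu>)) \<le> norm (\<integral>x. \<kappa> (\<zeta> * s n x) \<partial>\<nu>)"
      by (rule norm_one_minus_exp_le)
    also have "\<dots> \<le> (\<integral>x. norm (\<kappa> (\<zeta> * s n x)) \<partial>\<nu>)" by (rule integral_norm_bound)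
    also have "\<dots> \<le> (\<integral>x. H (s n x) \<partial>\<nu>)"
      using integrable_norm[OF ik] integrable_finite_step[OF s(1), of H, OF H0] kappa
      by (intro integral_mono) (auto simp: H_def)
    finally show ?thesis by (simp add: chf_simple_levy_integral_eq_exp[OF s(1)])
  qed
  moreover have "(\<lambda>n. norm (1 - chf M (simple_levy_integral \<Lambda> (s n)) \<zeta>)) \<longlonglongrightarrow> norm (1 - chf M Z \<zeta>)"
    by (intro tendsto_intros s)
  ultimately show ?thesis unfolding H_def by (intro LIMSEQ_le) auto
qed

text \<open>The interval is open so that its indicator is lower semicontinuous, as Fatou's lemma requires.\<close>
lemma step_limit_norm_chf_le:
  assumes sl: "step_limit g G Z"
    and Re_kappa: "\<And>z. Re (\<kappa> z) \<le> 0"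
    and lower: "\<And>z. z \<in> {a<..<b} \<Longrightarrow> Re (\<kappa> z) \<le> - c" and "0 \<le> c" "0 \<le> a"
    and y: "0 \<le> y" "ennreal y < emeasure \<nu> {x. \<zeta> * g x \<in> {a<..<b}}"
    and [measurable]: "g \<in> borel_measurable \<nu>"
  shows "norm (chf M Z \<zeta>) \<le> exp (- c * y)"
proof -
  obtain s where s: "\<And>n. finite_step \<nu> (s n)" "\<And>x. (\<lambda>n. s n x) \<longlonglongrightarrow> g x"
      "\<And>\<zeta>. (\<lambda>n. chf M (simple_levy_integral \<Lambda> (s n)) \<zeta>) \<longlonglongrightarrow> chf M Z \<zeta>"
    using sl unfolding step_limit_def by auto
  have [measurable]: "s n \<in> borel_measurable \<nu>" for n by (rule finite_step_measurable[OF s(1)])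
  define E where "E n = {x. \<zeta> * s n x \<in> {a<..<b}}" for n
  have E[measurable]: "E n \<in> sets \<nu>" for n
  proof -
    have "{x\<in>space \<nu>. \<zeta> * s n x \<in> {a<..<b}} \<in> sets \<nu>" by measurable
    then show ?thesis by (simp add: E_def)
  qed
  have Eg: "{x. \<zeta> * g x \<in> {a<..<b}} \<in> sets \<nu>"
  proof -
    have "{x\<in>space \<nu>. \<zeta> * g x \<in> {a<..<b}} \<in> sets \<nu>" by measurable
    then show ?thesis by simp
  qed
  have "emeasure \<nu> {x. \<zeta> * g x \<in> {a<..<b}} = (\<integral>\<^sup>+x. indicator {x. \<zeta> * g x \<in> {a<..<b}} x \<partial>\<nu>)"
    using Eg by simp
  also have "\<dots> \<le> (\<integral>\<^sup>+x. liminf (\<lambda>n. indicator (E n) x) \<partial>\<nu>)"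
  proof (intro nn_integral_mono)
    fix x
    show "indicator {x. \<zeta> * g x \<in> {a<..<b}} x \<le> liminf (\<lambda>n. indicator (E n) x :: ennreal)"
    proof (cases "\<zeta> * g x \<in> {a<..<b}")
      case True
      have "(\<lambda>n. \<zeta> * s n x) \<longlonglongrightarrow> \<zeta> * g x" by (intro tendsto_intros s)
      then have "\<forall>\<^sub>F n in sequentially. \<zeta> * s n x \<in> {a<..<b}"
        using True by (intro topological_tendstoD) auto
      then have "\<forall>\<^sub>F n in sequentially. (1::ennreal) \<le> indicator (E n) x"
        by eventually_elim (simp add: E_def)
      then show ?thesis using True by (simp add: Liminf_bounded)
    qed simp
  qed
  also have "\<dots> \<le> liminf (\<lambda>n. \<integral>\<^sup>+x. indicator (E n) x \<partial>\<nu>)"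
    by (intro nn_integral_liminf) measurable
  finally have "ennreal y < liminf (\<lambda>n. emeasure \<nu> (E n))" using y by simp
  \<comment> \<open>Strictness is essential here: it carries over from the lower limit to all large
    \<open>n\<close>.\<close>
  then have "\<forall>\<^sub>F n in sequentially. ennreal y < emeasure \<nu> (E n)" by (rule less_LiminfD)
  then have "\<forall>\<^sub>F n in sequentially. norm (chf M (simple_levy_integral \<Lambda> (s n)) \<zeta>) \<le> exp (- c * y)"
  proof eventually_elim
    case (elim n)
    let ?I = "indicat_real {a<..<b}"
    have I0: "c * ?I (\<zeta> * 0) = 0" using \<open>0 \<le> a\<close> by simp
    have ik: "integrable \<nu> (\<lambda>x. \<kappa> (\<zeta> * s n x))"
      using integrable_finite_step[OF s(1), of "\<lambda>c. \<kappa> (\<zeta> * c)"] by (simp add: kappa_0)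
    have II: "integrable \<nu> (\<lambda>x. ?I (\<zeta> * s n x))"
      using integrable_finite_step[OF s(1), of "\<lambda>v. ?I (\<zeta> * v)"] \<open>0 \<le> a\<close> by simp
    have EI: "(\<lambda>x. ?I (\<zeta> * s n x)) = indicat_real (E n)" by (auto simp: E_def indicator_def)
    have "integrable \<nu> (indicat_real (E n))" using II by (simp add: EI)
    then have finE: "emeasure \<nu> (E n) < \<infinity>" using E by (simp add: integrable_indicator_iff)
    have "c * y \<le> c * measure \<nu> (E n)"
    proof (rule mult_left_mono)
      have "ennreal y < ennreal (measure \<nu> (E n))"
        using elim finE by (simp add: emeasure_eq_ennreal_measure less_top[symmetric])
      then show "y \<le> measure \<nu> (E n)" using y by (simp add: ennreal_less_iff)
    qed fact
    also have "measure \<nu> (E n) = (\<integral>x. ?I (\<zeta> * s n x) \<partial>\<nu>)" unfolding EI by simp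
    also have "c * \<dots> = (\<integral>x. c * ?I (\<zeta> * s n x) \<partial>\<nu>)" by simp
    also have "\<dots> \<le> (\<integral>x. - Re (\<kappa> (\<zeta> * s n x)) \<partial>\<nu>)"
    proof (rule integral_mono)
      show "c * ?I (\<zeta> * s n x) \<le> - Re (\<kappa> (\<zeta> * s n x))" for x
        using lower[of "\<zeta> * s n x"] Re_kappa[of "\<zeta> * s n x"] by (cases "\<zeta> * s n x \<in> {a<..<b}") auto
    qed (use II ik in auto)
    also have "\<dots> = - Re (\<integral>x. \<kappa> (\<zeta> * s n x) \<partial>\<nu>)" using ik by simp
    finally show ?case by (simp add: chf_simple_levy_integral_eq_exp[OF s(1)])
  qed
  then show ?thesis
    by (intro tendsto_upperbound[OF tendsto_norm[OF s(3)]]) auto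
qed

text \<open>The kernel has integral 1, so the drift contributes \<open>\<zeta> m\<close> to the
  exponent in the limit, while everything else is of order \<open>\<zeta>\<close> to a power above
  1. Dividing by \<zeta> and letting \<zeta> tend to 0 leaves \<open>m = 0\<close>.\<close>

lemma step_limit_drift_zero:
  assumes sl: "step_limit g g Z" and g: "integrable \<nu> g" "(\<integral>x. g x \<partial>\<nu>) = 1"
    and g01: "\<And>x. 0 \<le> g x" "\<And>x. g x \<le> 1"
    and kappa: "\<And>z. \<kappa> z = \<i> * complex_of_real (z * m) + \<kappa>' z"
    and kappa': "\<And>z. norm (\<kappa>' z) \<le> A * \<bar>z\<bar> powr q + B * \<bar>z\<bar> powr q'"
    and "0 \<le> A" "0 \<le> B" "1 < q" "1 < q'" "0 \<le> K"
    and chf: "\<And>\<zeta>. norm (1 - chf M Z \<zeta>) \<le> K * \<bar>\<zeta>\<bar> powr q"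
  shows "m = 0"
proof -
  obtain s where s: "\<And>n. finite_step \<nu> (s n)" "\<And>n x. \<bar>s n x\<bar> \<le> g x" "\<And>x. (\<lambda>n. s n x) \<longlonglongrightarrow> g x"
      "\<And>\<zeta>. (\<lambda>n. chf M (simple_levy_integral \<Lambda> (s n)) \<zeta>) \<longlonglongrightarrow> chf M Z \<zeta>"
    using sl unfolding step_limit_def by auto
  have [measurable]: "s n \<in> borel_measurable \<nu>" for n by (rule finite_step_measurable[OF s(1)])
  have int_s: "integrable \<nu> (s n)" for n
    using integrable_finite_step[OF s(1), of "\<lambda>c. c"] by simp
  have k'0: "\<kappa>' 0 = 0" using kappa[of 0] by (simp add: kappa_0)
  have "(\<lambda>n. \<integral>x. s n x \<partial>\<nu>) \<longlonglongrightarrow> (\<integral>x. g x \<partial>\<nu>)"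
    by (rule integral_dominated_convergence[where w = g]) (use g s in \<open>auto\<close>)
  then have lim1: "(\<lambda>n. \<integral>x. s n x \<partial>\<nu>) \<longlonglongrightarrow> 1" using g by simp
  have V: "norm (\<integral>x. \<kappa>' (\<zeta> * s n x) \<partial>\<nu>) \<le> A * \<zeta> powr q + B * \<zeta> powr q'" if z: "0 < \<zeta>" for \<zeta> n
  proof -
    have ik: "integrable \<nu> (\<lambda>x. \<kappa>' (\<zeta> * s n x))"
      using integrable_finite_step[OF s(1), of "\<lambda>c. \<kappa>' (\<zeta> * c)"] by (simp add: k'0)
    have "norm (\<integral>x. \<kappa>' (\<zeta> * s n x) \<partial>\<nu>) \<le> (\<integral>x. norm (\<kappa>' (\<zeta> * s n x)) \<partial>\<nu>)" by (rule integral_norm_bound)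
    also have "\<dots> \<le> (\<integral>x. (A * \<zeta> powr q + B * \<zeta> powr q') * g x \<partial>\<nu>)"
    proof (rule integral_mono)
      fix x
      have p: "\<bar>\<zeta> * s n x\<bar> powr r \<le> \<zeta> powr r * g x" if "1 < r" for r
      proof -
        have "\<bar>\<zeta> * s n x\<bar> powr r \<le> (\<zeta> * g x) powr r"
          using z s(2)[of n x] that by (intro powr_mono2) (auto simp: abs_mult)
        also have "\<dots> = \<zeta> powr r * g x powr r" using z g01 by (simp add: powr_mult)
        also have "\<dots> \<le> \<zeta> powr r * g x"
          using powr_mono'[of 1 r "g x"] g01[of x] that by (intro mult_left_mono) auto
        finally show ?thesis .
      qed
      have "norm (\<kappa>' (\<zeta> * s n x)) \<le> A * \<bar>\<zeta> * s n x\<bar> powr q + B * \<bar>\<zeta> * s n x\<bar> powr q'" by (rule kappa')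
      also have "\<dots> \<le> A * (\<zeta> powr q * g x) + B * (\<zeta> powr q' * g x)"
        using assms by (intro add_mono mult_left_mono p) auto
      finally show "norm (\<kappa>' (\<zeta> * s n x)) \<le> (A * \<zeta> powr q + B * \<zeta> powr q') * g x" by (simp add: algebra_simps)
    qed (use g ik in auto)
    finally show ?thesis using g by simp
  qed
  \<comment> \<open>For frequencies up to 1 the smaller exponent dominates both terms.\<close>
  define q0 where "q0 = min q q'"
  define C where "C = 2 * K + 2 * (A + B)"
  have q0: "1 < q0" using assms by (simp add: q0_def)
  have pq: "\<zeta> powr q \<le> \<zeta> powr q0" "\<zeta> powr q' \<le> \<zeta> powr q0" if "0 < \<zeta>" "\<zeta> \<le> 1" for \<zeta> :: real
    using that by (auto simp: q0_def intro!: powr_mono')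
  \<comment> \<open>The smallness condition keeps the exponents of the step integrals in the disc of
    radius \<open>1 / 4\<close>, where they can be recovered from \<open>1 - exp\<close>.\<close>
  have key: "\<zeta> * \<bar>m\<bar> \<le> C * \<zeta> powr q0"
    if z: "0 < \<zeta>" "\<zeta> \<le> 1" "\<zeta> * (\<bar>m\<bar> * 2) + (A + B) * \<zeta> powr q0 \<le> 1/4" for \<zeta>
  proof -
    let ?I = "\<lambda>n. \<integral>x. s n x \<partial>\<nu>"
    have V': "norm (\<integral>x. \<kappa>' (\<zeta> * s n x) \<partial>\<nu>) \<le> (A + B) * \<zeta> powr q0" for n
    proof -
      have "A * \<zeta> powr q + B * \<zeta> powr q' \<le> A * \<zeta> powr q0 + B * \<zeta> powr q0"
        using pq[OF z(1,2)] assms by (intro add_mono mult_left_mono) auto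
      then show ?thesis using V[OF z(1), of n] by (simp add: algebra_simps)
    qed
    \<comment> \<open>The integrals of the step functions tend to 1; the eventual bound 2 is the
      factor in the smallness condition on \<zeta>.\<close>
    have "\<forall>\<^sub>F n in sequentially. \<bar>?I n\<bar> < 2"
      using tendsto_rabs[OF lim1] by (rule order_tendstoD) simp
    then have "\<forall>\<^sub>F n in sequentially. \<zeta> * \<bar>m\<bar> * \<bar>?I n\<bar> \<le>
        2 * norm (1 - chf M (simple_levy_integral \<Lambda> (s n)) \<zeta>) + (A + B) * \<zeta> powr q0"
    proof eventually_elim
      case (elim n)
      define w where "w = (\<integral>x. \<kappa> (\<zeta> * s n x) \<partial>\<nu>)"
      define v where "v = (\<integral>x. \<kappa>' (\<zeta> * s n x) \<partial>\<nu>)"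
      have "w = \<i> * complex_of_real (\<zeta> * m * ?I n) + v"
      proof -
        have "integrable \<nu> (\<lambda>x. \<kappa>' (\<zeta> * s n x))"
          using integrable_finite_step[OF s(1), of "\<lambda>c. \<kappa>' (\<zeta> * c)"] by (simp add: k'0)
        moreover have "w = (\<integral>x. \<i> * complex_of_real (\<zeta> * m * s n x) + \<kappa>' (\<zeta> * s n x) \<partial>\<nu>)"
          unfolding w_def kappa by (simp add: mult_ac)
        ultimately show ?thesis using int_s[of n] by (simp add: v_def)
      qed
      then have wv: "\<i> * complex_of_real (\<zeta> * m * ?I n) = w - v" by simp
      have "norm (\<i> * complex_of_real (\<zeta> * m * ?I n)) = \<zeta> * \<bar>m\<bar> * \<bar>?I n\<bar>" using z by (simp add: norm_mult abs_mult)
      then have n1: "\<zeta> * \<bar>m\<bar> * \<bar>?I n\<bar> \<le> norm w + norm v" and n2: "norm w \<le> \<zeta> * \<bar>m\<bar> * \<bar>?I n\<bar> + norm v"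
        using wv norm_triangle_ineq4[of w v] norm_triangle_ineq2[of w v] by auto
      have "\<zeta> * \<bar>m\<bar> * \<bar>?I n\<bar> \<le> \<zeta> * \<bar>m\<bar> * 2" using elim z by (intro mult_left_mono) auto
      then have "norm w \<le> 1/4" using n2 V'[of n] z unfolding v_def by linarith
      then have "norm w \<le> 2 * norm (1 - exp w)" using norm_exp_minus_one_ge[of w] by simp
      then show ?case using n1 V'[of n] unfolding v_def w_def chf_simple_levy_integral_eq_exp[OF s(1)] by linarith
    qed
    moreover have "(\<lambda>n. \<zeta> * \<bar>m\<bar> * \<bar>?I n\<bar>) \<longlonglongrightarrow> \<zeta> * \<bar>m\<bar> * \<bar>1\<bar>"
      by (intro tendsto_intros lim1)
    moreover have "(\<lambda>n. 2 * norm (1 - chf M (simple_levy_integral \<Lambda> (s n)) \<zeta>) + (A + B) * \<zeta> powr q0)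
        \<longlonglongrightarrow> 2 * norm (1 - chf M Z \<zeta>) + (A + B) * \<zeta> powr q0"
      by (intro tendsto_intros s)
    ultimately have "\<zeta> * \<bar>m\<bar> * \<bar>1\<bar> \<le> 2 * norm (1 - chf M Z \<zeta>) + (A + B) * \<zeta> powr q0"
      by (intro tendsto_le[OF sequentially_bot])
    also have "\<dots> \<le> 2 * (K * \<zeta> powr q0) + (A + B) * \<zeta> powr q0"
      using chf[of \<zeta>] z pq(1)[OF z(1,2)] \<open>0 \<le> K\<close> \<open>0 \<le> A\<close> \<open>0 \<le> B\<close> by (intro add_mono mult_left_mono) (auto intro: order_trans mult_left_mono)
    also have "\<dots> \<le> C * \<zeta> powr q0" using assms by (simp add: C_def algebra_simps)
    finally show ?thesis by simp
  qed
  have lim0: "((\<lambda>\<zeta>::real. \<zeta> powr r) \<longlongrightarrow> 0) (at_right 0)" if "0 < r" for r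
  proof -
    have "\<forall>\<^sub>F \<zeta> in at_right 0. (0::real) \<le> \<zeta>"
      by (rule eventually_mono[OF eventually_at_right_less]) simp
    then show ?thesis using that tendsto_powr'[of "\<lambda>\<zeta>. \<zeta>" 0 "at_right 0" "\<lambda>_. r" r] by simp
  qed
  have "((\<lambda>\<zeta>. \<zeta> * (\<bar>m\<bar> * 2) + (A + B) * \<zeta> powr q0) \<longlongrightarrow> 0 * (\<bar>m\<bar> * 2) + (A + B) * 0) (at_right 0)"
    using q0 by (intro tendsto_intros lim0) auto
  then have "\<forall>\<^sub>F \<zeta> in at_right 0. \<zeta> * (\<bar>m\<bar> * 2) + (A + B) * \<zeta> powr q0 < 1/4"
    by (rule order_tendstoD) simp
  moreover have "\<forall>\<^sub>F \<zeta> in at_right 0. (0::real) < \<zeta>" by (rule eventually_at_right_less)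
  moreover have "\<forall>\<^sub>F \<zeta> in at_right 0. \<zeta> < (1::real)" using eventually_at_right_real[of 0 1] by (auto elim: eventually_mono)
  ultimately have "\<forall>\<^sub>F \<zeta> in at_right 0. \<bar>m\<bar> \<le> C * \<zeta> powr (q0 - 1)"
  proof eventually_elim
    case (elim \<zeta>)
    then have "\<zeta> * \<bar>m\<bar> \<le> C * \<zeta> powr q0" by (intro key) auto
    then show ?case using elim by (simp add: powr_diff field_simps)
  qed
  moreover have "((\<lambda>\<zeta>. C * \<zeta> powr (q0 - 1)) \<longlongrightarrow> C * 0) (at_right 0)"
    using q0 by (intro tendsto_intros lim0) auto
  ultimately have "\<bar>m\<bar> \<le> C * 0" by (intro tendsto_lowerbound) auto
  then show ?thesis by simp
qed

end

section \<open>The supOU kernel and its Riemann sums\<close>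

lemma nn_integral_exp_atMost:
  "(\<integral>\<^sup>+s. (if s \<le> L then ennreal (exp (s - U)) else 0) \<partial>lborel) = ennreal (exp (L - U))"
proof -
  have "(\<integral>\<^sup>+x. ennreal (exp (- x)) * indicator {0..} x \<partial>lborel) = ennreal (0 - (- exp (- 0)))"
  proof (rule nn_integral_FTC_atLeast)
    show "((\<lambda>x::real. - exp (- x)) \<longlongrightarrow> 0) at_top"
      using tendsto_minus[OF filterlim_compose[OF exp_at_bot filterlim_uminus_at_bot_at_top]] by simp
  qed (auto intro!: derivative_eq_intros)
  then have 1: "(\<integral>\<^sup>+x. ennreal (exp (- x)) * indicator {0..} x \<partial>lborel) = 1" by simp
  have "(\<integral>\<^sup>+s. (if s \<le> L then ennreal (exp (s - U)) else 0) \<partial>lborel) =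
      ennreal \<bar>- 1\<bar> * (\<integral>\<^sup>+x. (if L + - 1 * x \<le> L then ennreal (exp (L + - 1 * x - U)) else 0) \<partial>lborel)"
    by (rule nn_integral_real_affine) auto
  also have "\<dots> = (\<integral>\<^sup>+x. ennreal (exp (L - U)) * (ennreal (exp (- x)) * indicator {0..} x) \<partial>lborel)"
    by (auto intro!: nn_integral_cong simp: ennreal_mult[symmetric] exp_add[symmetric] indicator_def algebra_simps)
  also have "\<dots> = ennreal (exp (L - U))"
    by (subst nn_integral_cmult) (auto simp: 1)
  finally show ?thesis .
qed

text \<open>This integrates \<open>|x - y| + 2 min x y = x + y\<close>. Both exponentials have
  integral 1, and their minimum is \<open>?m\<close>: up to \<open>L\<close> the one with the larger
  endpoint is smaller, and beyond \<open>L\<close> the other one is 0.\<close>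

lemma nn_integral_exp_shift_diff:
  fixes L U :: real
  assumes "L \<le> U"
  shows "(\<integral>\<^sup>+s. ennreal \<bar>(if s \<le> L then exp (s - L) else 0) - (if s \<le> U then exp (s - U) else 0)\<bar> \<partial>lborel)
     \<le> ennreal (2 * (1 - exp (L - U)))"
proof -
  let ?f = "\<lambda>V s. if s \<le> V then exp (s - V) else (0::real)"
  let ?m = "\<lambda>s. if s \<le> L then ennreal (exp (s - U)) else 0"
  have f1: "(\<integral>\<^sup>+s. ennreal (?f V s) \<partial>lborel) = 1" for V
    using nn_integral_exp_atMost[of V V] by (simp add: if_distrib cong: if_cong)
  have "(\<integral>\<^sup>+s. ennreal \<bar>?f L s - ?f U s\<bar> \<partial>lborel) + 2 * (\<integral>\<^sup>+s. ?m s \<partial>lborel)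
      = (\<integral>\<^sup>+s. ennreal \<bar>?f L s - ?f U s\<bar> + 2 * ?m s \<partial>lborel)"
    by (simp add: nn_integral_add nn_integral_cmult)
  also have "\<dots> = (\<integral>\<^sup>+s. ennreal (?f L s) + ennreal (?f U s) \<partial>lborel)"
  proof (intro nn_integral_cong)
    fix s
    have "exp (s - U) \<le> exp (s - L)" using assms by simp
    then show "ennreal \<bar>?f L s - ?f U s\<bar> + 2 * ?m s = ennreal (?f L s) + ennreal (?f U s)"
      using assms by (auto simp: ennreal_plus[symmetric] ennreal_numeral[symmetric] ennreal_mult[symmetric]
        simp del: ennreal_plus ennreal_numeral)
  qed
  also have "\<dots> = 2" by (subst nn_integral_add) (auto simp: f1)
  finally have eq: "(\<integral>\<^sup>+s. ennreal \<bar>?f L s - ?f U s\<bar> \<partial>lborel) + ennreal (2 * exp (L - U)) = ennreal 2"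
    by (simp add: nn_integral_exp_atMost ennreal_mult)
  have "(\<integral>\<^sup>+s. ennreal \<bar>?f L s - ?f U s\<bar> \<partial>lborel) =
      (\<integral>\<^sup>+s. ennreal \<bar>?f L s - ?f U s\<bar> \<partial>lborel) + ennreal (2 * exp (L - U)) - ennreal (2 * exp (L - U))"
    by (rule ennreal_add_diff_cancel_right[symmetric]) simp
  also have "\<dots> = ennreal 2 - ennreal (2 * exp (L - U))" unfolding eq ..
  also have "\<dots> = ennreal (2 * (1 - exp (L - U)))" by (subst ennreal_minus) (auto simp: algebra_simps)
  finally show ?thesis by simp
qed

text \<open>This is a geometric series starting at the first grid point to the right of
  \<open>s\<close>. Capping the exponential at 1 makes the terms telescope without locating that
  point.\<close>

lemma sum_exp_grid_le:
  fixes h s :: real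
  assumes h: "0 < h"
  shows "(\<Sum>j=1..n. if s \<le> h * real j then exp (s - h * real j) else 0) \<le> 1 / (1 - exp (- h))"
proof -
  define \<phi> where "\<phi> j = min 1 (exp (s - h * real j))" for j :: nat
  have pos: "0 < 1 - exp (- h)" using h by simp
  have tele: "(if s \<le> h * real j then exp (s - h * real j) else 0) * (1 - exp (- h)) \<le> \<phi> j - \<phi> (Suc j)" for j
  proof -
    have dec: "exp (s - h * real (Suc j)) \<le> exp (s - h * real j)" using h by simp
    have "exp (s - h * real j) * exp (- h) = exp (s - h * real (Suc j))"
      by (simp add: exp_add[symmetric] algebra_simps)
    then show ?thesis using dec by (auto simp: \<phi>_def min_def algebra_simps)
  qed
  have "(\<Sum>j=1..n. if s \<le> h * real j then exp (s - h * real j) else 0) * (1 - exp (- h)) \<le> (\<Sum>j=1..n. \<phi> j - \<phi> (Suc j))"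
    unfolding sum_distrib_right by (intro sum_mono tele)
  also have "\<dots> = \<phi> 1 - \<phi> (Suc n)"
  proof (induction n)
    case (Suc n) then show ?case by simp
  qed simp
  also have "\<dots> \<le> 1"
  proof -
    have "\<phi> 1 \<le> 1" "0 \<le> \<phi> (Suc n)" unfolding \<phi>_def by simp_all
    then show ?thesis by linarith
  qed
  finally show ?thesis using pos by (simp add: field_simps)
qed

lemma one_minus_exp_neg_ge:
  fixes h :: real
  assumes "0 \<le> h" "h \<le> 1"
  shows "h / 2 \<le> 1 - exp (- h)"
proof -
  have "1 + h \<le> exp h" by simp
  then have "exp (- h) \<le> 1 / (1 + h)" using assms by (simp add: exp_minus field_simps)
  moreover have "1 / (1 + h) \<le> 1 - h / 2"
  proof -
    have "h * h \<le> h" using assms by (simp add: mult_left_le)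
    then show ?thesis using assms by (simp add: field_simps)
  qed
  ultimately show ?thesis by linarith
qed

section \<open>The supOU kernel under its intensity measure\<close>

locale supou_intensity = prob_space \<pi>
  for \<pi> :: "real measure" +
  assumes sets_pi [measurable_cong]: "sets \<pi> = sets borel"
    and pi_pos: "AE \<xi> in \<pi>. 0 < \<xi>"
begin

lemma space_pi [simp]: "space \<pi> = UNIV"
  using sets_eq_imp_space_eq[OF sets_pi] by simp

lemma space_intensity: "space (\<pi> \<Otimes>\<^sub>M lborel) = UNIV"
  by (simp add: space_pair_measure)

lemma supou_kernel_measurable [measurable]: "supou_kernel t \<in> borel_measurable (\<pi> \<Otimes>\<^sub>M lborel)"
  unfolding supou_kernel_def by measurable

lemma supou_kernel_bounds: "0 \<le> supou_kernel t x" "supou_kernel t x \<le> 1"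
  unfolding supou_kernel_def by (auto split: prod.split)

lemma supou_kernel_pos: "0 < \<xi> \<Longrightarrow> supou_kernel t (\<xi>, s) = (if s \<le> \<xi> * t then exp (s - \<xi> * t) else 0)"
  by (auto simp: supou_kernel_def)

lemma nn_integral_intensity:
  assumes [measurable]: "F \<in> borel_measurable (\<pi> \<Otimes>\<^sub>M lborel)"
  shows "(\<integral>\<^sup>+x. F x \<partial>(\<pi> \<Otimes>\<^sub>M lborel)) = (\<integral>\<^sup>+\<xi>. (\<integral>\<^sup>+s. F (\<xi>, s) \<partial>lborel) \<partial>\<pi>)"
  by (rule lborel.nn_integral_fst[symmetric]) fact

lemma nn_integral_supou_kernel: "(\<integral>\<^sup>+x. ennreal (supou_kernel t x) \<partial>(\<pi> \<Otimes>\<^sub>M lborel)) = 1"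
proof -
  have "(\<integral>\<^sup>+x. ennreal (supou_kernel t x) \<partial>(\<pi> \<Otimes>\<^sub>M lborel)) = (\<integral>\<^sup>+\<xi>. (\<integral>\<^sup>+s. ennreal (supou_kernel t (\<xi>, s)) \<partial>lborel) \<partial>\<pi>)"
    by (rule nn_integral_intensity) measurable
  also have "\<dots> = (\<integral>\<^sup>+\<xi>. 1 \<partial>\<pi>)"
    using pi_pos nn_integral_exp_atMost[of "_ * t" "_ * t"]
    by (intro nn_integral_cong_AE) (auto elim!: eventually_mono simp: supou_kernel_pos if_distrib cong: if_cong)
  finally show ?thesis by (simp add: emeasure_space_1[simplified])
qed

lemma integrable_supou_kernel: "integrable (\<pi> \<Otimes>\<^sub>M lborel) (supou_kernel t)"
  by (rule integrableI_bounded) (simp_all add: supou_kernel_bounds nn_integral_supou_kernel)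

lemma integral_supou_kernel: "(\<integral>x. supou_kernel t x \<partial>(\<pi> \<Otimes>\<^sub>M lborel)) = 1"
  by (rule integral_eq_nn_integral[THEN trans]) (simp_all add: supou_kernel_bounds nn_integral_supou_kernel)

lemma supou_kernel_superlevel:
  assumes "0 < c"
  shows "emeasure (\<pi> \<Otimes>\<^sub>M lborel) {x. c \<le> supou_kernel t x} < \<infinity>"
proof -
  let ?\<nu> = "\<pi> \<Otimes>\<^sub>M lborel"
  have "emeasure ?\<nu> {x\<in>space ?\<nu>. c \<le> supou_kernel t x} \<le> ennreal (1 / c * (\<integral>x. supou_kernel t x \<partial>?\<nu>))"
    using assms by (intro integral_Markov_inequality integrable_supou_kernel) (auto simp: supou_kernel_bounds)
  then show ?thesis by (simp add: space_intensity le_less_trans)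
qed

text \<open>For fixed \<xi> the two slices are exponentials ending at \<open>\<xi> u\<close> and
  \<open>\<xi> v\<close>. Writing \<open>|\<xi>|\<close> keeps the right-hand integrand between 0
  and 2 also on the negative half-line, which \<pi> does not charge.\<close>

lemma nn_integral_supou_kernel_diff:
  assumes "u \<le> v"
  shows "(\<integral>\<^sup>+x. ennreal \<bar>supou_kernel u x - supou_kernel v x\<bar> \<partial>(\<pi> \<Otimes>\<^sub>M lborel))
    \<le> (\<integral>\<^sup>+\<xi>. ennreal (2 * (1 - exp (- \<bar>\<xi>\<bar> * (v - u)))) \<partial>\<pi>)"
proof -
  have "(\<integral>\<^sup>+x. ennreal \<bar>supou_kernel u x - supou_kernel v x\<bar> \<partial>(\<pi> \<Otimes>\<^sub>M lborel))
      = (\<integral>\<^sup>+\<xi>. (\<integral>\<^sup>+s. ennreal \<bar>supou_kernel u (\<xi>, s) - supou_kernel v (\<xi>, s)\<bar> \<partial>lborel) \<partial>\<pi>)"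
    by (rule nn_integral_intensity) measurable
  also have "\<dots> \<le> (\<integral>\<^sup>+\<xi>. ennreal (2 * (1 - exp (- \<bar>\<xi>\<bar> * (v - u)))) \<partial>\<pi>)"
  proof (rule nn_integral_mono_AE, use pi_pos in eventually_elim)
    fix \<xi> :: real assume \<xi>: "0 < \<xi>"
    then have "\<xi> * u \<le> \<xi> * v" using assms by simp
    from nn_integral_exp_shift_diff[OF this]
    show "(\<integral>\<^sup>+s. ennreal \<bar>supou_kernel u (\<xi>, s) - supou_kernel v (\<xi>, s)\<bar> \<partial>lborel)
        \<le> ennreal (2 * (1 - exp (- \<bar>\<xi>\<bar> * (v - u))))"
      using \<xi> by (simp add: supou_kernel_pos right_diff_distrib)
  qed
  finally show ?thesis .
qed

section \<open>Riemann sums of the kernel\<close>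

definition riemann_kernel :: "real \<Rightarrow> nat \<Rightarrow> real \<times> real \<Rightarrow> real" where
  "riemann_kernel t n x = (\<Sum>j=1..n. t / real n * supou_kernel (real j * (t / real n)) x)"

lemma riemann_kernel_measurable [measurable]: "riemann_kernel t n \<in> borel_measurable (\<pi> \<Otimes>\<^sub>M lborel)"
  unfolding riemann_kernel_def[abs_def] by measurable

lemma riemann_kernel_bounds:
  assumes "0 \<le> t"
  shows "0 \<le> riemann_kernel t n x" "riemann_kernel t n x \<le> t"
proof -
  show "0 \<le> riemann_kernel t n x"
    unfolding riemann_kernel_def using assms by (intro sum_nonneg mult_nonneg_nonneg supou_kernel_bounds) auto
  have "riemann_kernel t n x \<le> (\<Sum>j=1..n. t / real n * 1)"
    unfolding riemann_kernel_def using assms by (intro sum_mono mult_left_mono supou_kernel_bounds) auto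
  also have "\<dots> \<le> t" using assms by (cases "n = 0") auto
  finally show "riemann_kernel t n x \<le> t" .
qed

lemma nn_integral_riemann_kernel:
  assumes "0 \<le> t" "0 < \<xi>" 
  shows "(\<integral>\<^sup>+s. ennreal (riemann_kernel t n (\<xi>, s)) \<partial>lborel) \<le> ennreal t"
proof -
  have f1: "(\<integral>\<^sup>+s. ennreal (supou_kernel u (\<xi>, s)) \<partial>lborel) = 1" for u
    using nn_integral_exp_atMost[of "\<xi> * u" "\<xi> * u"] assms by (simp add: supou_kernel_pos if_distrib cong: if_cong)
  have [measurable]: "(\<lambda>s. supou_kernel u (\<xi>, s)) \<in> borel_measurable borel" for u
    using assms by (simp add: supou_kernel_pos)
  have "(\<integral>\<^sup>+s. ennreal (riemann_kernel t n (\<xi>, s)) \<partial>lborel)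
      = (\<integral>\<^sup>+s. (\<Sum>j=1..n. ennreal (t / real n) * ennreal (supou_kernel (real j * (t / real n)) (\<xi>, s))) \<partial>lborel)"
    unfolding riemann_kernel_def using assms
    by (intro nn_integral_cong) (simp add: supou_kernel_bounds ennreal_mult[symmetric] sum_ennreal)
  also have "\<dots> = (\<Sum>j=1..n. ennreal (t / real n))"
    by (subst nn_integral_sum) (auto simp: nn_integral_cmult f1)
  also have "\<dots> = ennreal (\<Sum>j=1..n. t / real n)"
    using assms by (intro sum_ennreal) auto
  also have "\<dots> \<le> ennreal t" using assms by (intro ennreal_leI) (cases "n = 0", auto)
  finally show ?thesis .
qed

text \<open>The slice is a geometric sum with spacing \<open>h = \<xi> t / n\<close>, and
  \<open>\<xi> \<le> n / t\<close> says \<open>h \<le> 1\<close>. The sum is then at most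
  \<open>2 / h\<close>, and the weight \<open>t / n\<close> turns this into
  \<open>2 / \<xi>\<close>.\<close>

lemma riemann_kernel_le_inverse:
  assumes "0 < t" "0 < \<xi>" "0 < n" "\<xi> \<le> real n / t"
  shows "riemann_kernel t n (\<xi>, s) \<le> 2 / \<xi>"
proof -
  define h where "h = \<xi> * (t / real n)"
  have h: "0 < h" "h \<le> 1" using assms by (auto simp: h_def field_simps)
  have "riemann_kernel t n (\<xi>, s) = t / real n * (\<Sum>j=1..n. if s \<le> h * real j then exp (s - h * real j) else 0)"
    unfolding riemann_kernel_def sum_distrib_left using assms
    by (intro sum.cong) (auto simp: supou_kernel_pos h_def mult_ac)
  also have "\<dots> \<le> t / real n * (1 / (1 - exp (- h)))"
    using assms h by (intro mult_left_mono sum_exp_grid_le) auto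
  also have "\<dots> \<le> t / real n * (1 / (h / 2))"
    using assms h one_minus_exp_neg_ge[of h] by (intro mult_left_mono divide_left_mono) auto
  also have "\<dots> = 2 / \<xi>" using assms by (simp add: h_def field_simps)
  finally show ?thesis .
qed

text \<open>The kernel integrates to at most \<open>t\<close> over \<open>s\<close>, so it suffices to bound its power \<open>r - 1\<close> pointwise by
  interpolating between \<open>t\<close> and \<open>2 / \<xi>\<close>. The latter bound fails for \<open>\<xi> > n / t\<close>, where the grid is too coarse.\<close>
lemma riemann_kernel_slice:
  assumes t: "0 < t" and n: "0 < n" and r: "1 \<le> r" and m: "0 \<le> m" "m \<le> r - 1" and \<xi>: "0 < \<xi>"
  shows "(\<integral>\<^sup>+s. ennreal (riemann_kernel t n (\<xi>, s) powr r) \<partial>lborel)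
    \<le> ennreal (2 powr m * t powr (r - m) * \<xi> powr (- m) + t powr r * indicator {real n / t<..} \<xi>)"
proof -
  define c where "c = (if \<xi> \<le> real n / t then t powr (r - 1 - m) * (2 / \<xi>) powr m else t powr (r - 1))"
  have rk: "0 \<le> riemann_kernel t n x" "riemann_kernel t n x \<le> t" for x
    using riemann_kernel_bounds[of t n x] t by auto
  have [measurable]: "(\<lambda>s. riemann_kernel t n (\<xi>, s)) \<in> borel_measurable borel"
    using \<xi> unfolding riemann_kernel_def by (simp add: supou_kernel_pos)
  have pt: "riemann_kernel t n (\<xi>, s) powr r \<le> c * riemann_kernel t n (\<xi>, s)" for s
  proof (cases "riemann_kernel t n (\<xi>, s) = 0")
    case False
    let ?g = "riemann_kernel t n (\<xi>, s)"
    have g: "0 < ?g" "?g \<le> t" using rk[of "(\<xi>, s)"] False by auto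
    have "?g powr (r - 1) \<le> c"
    proof (cases "\<xi> \<le> real n / t")
      case True
      have "?g powr (r - 1) = ?g powr (r - 1 - m) * ?g powr m" by (simp add: powr_add[symmetric])
      also have "\<dots> \<le> t powr (r - 1 - m) * (2 / \<xi>) powr m"
        using g m riemann_kernel_le_inverse[OF t \<xi> n True, of s] by (intro mult_mono powr_mono2) auto
      finally show ?thesis using True by (simp add: c_def)
    next
      case False
      then show ?thesis using g r by (auto simp: c_def intro!: powr_mono2)
    qed
    then have "?g powr (r - 1) * ?g \<le> c * ?g" using g by (intro mult_right_mono) auto
    moreover have "?g powr r = ?g powr (r - 1) * ?g" using g by (simp add: powr_diff)
    ultimately show ?thesis by simp
  qed simp
  have c0: "0 \<le> c" by (simp add: c_def)
  have "(\<integral>\<^sup>+s. ennreal (riemann_kernel t n (\<xi>, s) powr r) \<partial>lborel)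
      \<le> (\<integral>\<^sup>+s. ennreal c * ennreal (riemann_kernel t n (\<xi>, s)) \<partial>lborel)"
    using pt c0 rk by (intro nn_integral_mono) (simp add: ennreal_mult[symmetric])
  also have "\<dots> = ennreal c * (\<integral>\<^sup>+s. ennreal (riemann_kernel t n (\<xi>, s)) \<partial>lborel)"
    by (rule nn_integral_cmult) measurable
  also have "\<dots> \<le> ennreal c * ennreal t"
    using t \<xi> by (intro mult_left_mono nn_integral_riemann_kernel) auto
  also have "\<dots> = ennreal (c * t)" using c0 t by (simp add: ennreal_mult)
  also have "\<dots> \<le> ennreal (2 powr m * t powr (r - m) * \<xi> powr (- m) + t powr r * indicator {real n / t<..} \<xi>)"
  proof (intro ennreal_leI)
    have e: "t powr (r - 1 - m) * t = t powr (r - m)" "t powr (r - 1) * t = t powr r"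
      using t powr_add[of t "r - 1 - m" 1] powr_add[of t "r - 1" 1] by (simp_all add: algebra_simps)
    show "c * t \<le> 2 powr m * t powr (r - m) * \<xi> powr (- m) + t powr r * indicator {real n / t<..} \<xi>"
    proof (cases "\<xi> \<le> real n / t")
      case True
      then have "c * t = (t powr (r - 1 - m) * t) * (2 / \<xi>) powr m" by (simp add: c_def)
      also have "\<dots> = 2 powr m * t powr (r - m) * \<xi> powr (- m)"
        using \<xi> unfolding e by (simp add: powr_divide powr_minus_divide)
      finally show ?thesis by simp
    next
      case False
      then show ?thesis by (simp add: c_def e)
    qed
  qed
  finally show ?thesis .
qed

lemma riemann_kernel_powr_integral:
  assumes t: "0 < t" and n: "0 < n" and r: "1 \<le> r" and m: "0 \<le> m" "m \<le> r - 1"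
    and mom: "integrable \<pi> (\<lambda>\<xi>. \<xi> powr (- m))"
  shows "(\<integral>\<^sup>+x. ennreal (riemann_kernel t n x powr r) \<partial>(\<pi> \<Otimes>\<^sub>M lborel))
    \<le> ennreal (2 powr m * t powr (r - m) * (\<integral>\<xi>. \<xi> powr (- m) \<partial>\<pi>) + t powr r * measure \<pi> {real n / t<..})"
proof -
  have "(\<integral>\<^sup>+x. ennreal (riemann_kernel t n x powr r) \<partial>(\<pi> \<Otimes>\<^sub>M lborel))
      = (\<integral>\<^sup>+\<xi>. (\<integral>\<^sup>+s. ennreal (riemann_kernel t n (\<xi>, s) powr r) \<partial>lborel) \<partial>\<pi>)"
    by (rule nn_integral_intensity) measurable
  also have "\<dots> \<le> (\<integral>\<^sup>+\<xi>. ennreal (2 powr m * t powr (r - m) * \<xi> powr (- m) + t powr r * indicator {real n / t<..} \<xi>) \<partial>\<pi>)"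
  proof (rule nn_integral_mono_AE, use pi_pos in eventually_elim)
    fix \<xi> :: real assume "0 < \<xi>"
    then show "(\<integral>\<^sup>+s. ennreal (riemann_kernel t n (\<xi>, s) powr r) \<partial>lborel)
      \<le> ennreal (2 powr m * t powr (r - m) * \<xi> powr (- m) + t powr r * indicator {real n / t<..} \<xi>)"
      by (rule riemann_kernel_slice[OF t n r m])
  qed
  also have "\<dots> = ennreal (\<integral>\<xi>. 2 powr m * t powr (r - m) * \<xi> powr (- m) + t powr r * indicator {real n / t<..} \<xi> \<partial>\<pi>)"
    using mom by (intro nn_integral_eq_integral Bochner_Integration.integrable_add integrable_mult_right)
      (auto simp: integrable_indicator_iff less_top[symmetric])
  also have "(\<integral>\<xi>. 2 powr m * t powr (r - m) * \<xi> powr (- m) + t powr r * indicator {real n / t<..} \<xi> \<partial>\<pi>)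
     = 2 powr m * t powr (r - m) * (\<integral>\<xi>. \<xi> powr (- m) \<partial>\<pi>) + t powr r * measure \<pi> {real n / t<..}"
    using mom by (subst Bochner_Integration.integral_add) (auto simp: integrable_indicator_iff less_top[symmetric])
  finally show ?thesis .
qed

text \<open>The contribution of the \<xi> for which the grid is too coarse has \<pi>-mass tending to
  0. Once that mass is below \<open>t powr (- m)\<close>, it is absorbed by the summand 1 in the
  constant.\<close>

lemma eventually_riemann_kernel_powr:
  assumes t: "0 < t" and r: "1 \<le> r" and m: "0 \<le> m" "m \<le> r - 1"
    and mom: "integrable \<pi> (\<lambda>\<xi>. \<xi> powr (- m))"
  shows "\<forall>\<^sub>F n in sequentially. (\<integral>\<^sup>+x. ennreal (riemann_kernel t n x powr r) \<partial>(\<pi> \<Otimes>\<^sub>M lborel))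
    \<le> ennreal ((2 powr m * (\<integral>\<xi>. \<xi> powr (- m) \<partial>\<pi>) + 1) * t powr (r - m))"
proof -
  have "(\<lambda>n. measure \<pi> {real n / t<..}) \<longlonglongrightarrow> measure \<pi> (\<Inter>n. {real n / t<..})"
    using t by (intro finite_Lim_measure_decseq) (auto simp: decseq_def divide_right_mono sets_pi intro: le_less_trans[rotated])
  moreover have "(\<Inter>n. {real n / t<..}) = {}"
  proof -
    have "x \<notin> (\<Inter>n. {real n / t<..})" for x
    proof -
      obtain n where "x * t \<le> real n" using real_arch_simple by blast
      then have "\<not> real n / t < x" using t by (simp add: field_simps)
      then show ?thesis by auto
    qed
    then show ?thesis by auto
  qed
  ultimately have "(\<lambda>n. measure \<pi> {real n / t<..}) \<longlonglongrightarrow> 0" by simp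
  then have "\<forall>\<^sub>F n in sequentially. measure \<pi> {real n / t<..} < t powr (- m)"
    by (rule order_tendstoD) (use t in simp)
  then show ?thesis using eventually_gt_at_top[of 0]
  proof eventually_elim
    case (elim n)
    have "t powr r * measure \<pi> {real n / t<..} \<le> t powr r * t powr (- m)"
      using elim by (intro mult_left_mono) auto
    also have "\<dots> = t powr (r - m)" by (simp add: powr_add[symmetric])
    finally show ?case
      by (intro order_trans[OF riemann_kernel_powr_integral[OF t elim(2) r m mom]] ennreal_leI) (simp add: algebra_simps)
  qed
qed

text \<open>On this box the exponent \<open>s - \<xi> u\<close> stays between -2 and 0 for all
  \<open>u\<close> in \<open>[0, t]\<close>, so every kernel value lies between
  \<open>exp (- 2)\<close> and 1: such slow components hardly decay over the whole time
  interval.\<close>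

lemma riemann_kernel_range:
  assumes t: "0 < t" and n: "0 < n" and "0 < \<xi>" "\<xi> < 1 / t" "-1 < s" "s < 0"
  shows "exp (- 2) * t < riemann_kernel t n (\<xi>, s)" "riemann_kernel t n (\<xi>, s) < t"
proof -
  have k: "exp (- 2) < supou_kernel (real j * (t / real n)) (\<xi>, s)"
    "supou_kernel (real j * (t / real n)) (\<xi>, s) < 1" if "j \<in> {1..n}" for j
  proof -
    have "\<xi> * (real j * (t / real n)) \<le> \<xi> * t"
      using that assms by (intro mult_left_mono) (auto simp: field_simps)
    also have "\<dots> < 1" using assms by (simp add: field_simps)
    finally have 1: "\<xi> * (real j * (t / real n)) < 1" .
    have 0: "0 \<le> \<xi> * (real j * (t / real n))" using assms by simp
    have le: "s \<le> \<xi> * (real j * (t / real n))" using 0 assms(6) by linarith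
    have "- 2 < s - \<xi> * (real j * (t / real n))" using 1 assms(5) by linarith
    then show "exp (- 2) < supou_kernel (real j * (t / real n)) (\<xi>, s)"
      unfolding supou_kernel_pos[OF assms(3)] if_P[OF le] exp_less_cancel_iff .
    have "s - \<xi> * (real j * (t / real n)) < 0" using 0 assms(6) by linarith
    then show "supou_kernel (real j * (t / real n)) (\<xi>, s) < 1"
      unfolding supou_kernel_pos[OF assms(3)] if_P[OF le] exp_less_one_iff .
  qed
  have "exp (- 2) * t = (\<Sum>j=1..n. t / real n * exp (- 2))" using n by simp
  also have "\<dots> < riemann_kernel t n (\<xi>, s)"
    unfolding riemann_kernel_def using t n by (intro sum_strict_mono mult_strict_left_mono k) auto
  finally show "exp (- 2) * t < riemann_kernel t n (\<xi>, s)" .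
  have "riemann_kernel t n (\<xi>, s) < (\<Sum>j=1..n. t / real n * 1)"
    unfolding riemann_kernel_def using t n by (intro sum_strict_mono mult_strict_left_mono k) auto
  also have "\<dots> = t" using n by simp
  finally show "riemann_kernel t n (\<xi>, s) < t" .
qed

lemma riemann_kernel_level_set:
  assumes t: "0 < t" and n: "0 < n" and w: "0 < w"
  shows "ennreal (measure \<pi> {0<..<1/t}) \<le> emeasure (\<pi> \<Otimes>\<^sub>M lborel) {x. w / t * riemann_kernel t n x \<in> {exp (- 2) * w<..<w}}"
proof -
  have "ennreal (measure \<pi> {0<..<1/t}) = emeasure (\<pi> \<Otimes>\<^sub>M lborel) ({0<..<1/t} \<times> {-1<..<0::real})"
    by (subst lborel.emeasure_pair_measure_Times) (auto simp: emeasure_eq_measure sets_pi)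
  also have "\<dots> \<le> emeasure (\<pi> \<Otimes>\<^sub>M lborel) {x. w / t * riemann_kernel t n x \<in> {exp (- 2) * w<..<w}}"
  proof (rule emeasure_mono)
    show "{0<..<1/t} \<times> {-1<..<0::real} \<subseteq> {x. w / t * riemann_kernel t n x \<in> {exp (- 2) * w<..<w}}"
      using riemann_kernel_range[OF t n] t w by (auto simp: field_simps)
    have "{x\<in>space (\<pi> \<Otimes>\<^sub>M lborel). w / t * riemann_kernel t n x \<in> {exp (- 2) * w<..<w}} \<in> sets (\<pi> \<Otimes>\<^sub>M lborel)"
      by measurable
    then show "{x. w / t * riemann_kernel t n x \<in> {exp (- 2) * w<..<w}} \<in> sets (\<pi> \<Otimes>\<^sub>M lborel)"
      by (simp add: space_intensity)
  qed
  finally show ?thesis .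
qed

end

section \<open>Moments and cumulants of jump measures\<close>

lemma integrable_large_powr:
  fixes N :: "real measure"
  assumes sets[measurable_cong]: "sets N = sets borel" and "0 \<le> C" "0 \<le> r" "r < q"
    and bound: "\<And>j::nat. emeasure N {x. 2^j < \<bar>x\<bar> \<and> \<bar>x\<bar> \<le> 2^Suc j} \<le> ennreal (C * 2 powr (- q * real j))"
  shows "integrable N (\<lambda>x. indicator {x. 1 < \<bar>x\<bar>} x * \<bar>x\<bar> powr r)"
proof (rule integrableI_bounded)
  show "(\<lambda>x. indicator {x. 1 < \<bar>x\<bar>} x * \<bar>x\<bar> powr r) \<in> borel_measurable N" by measurable
  show "(\<integral>\<^sup>+x. ennreal (norm (indicator {x. 1 < \<bar>x\<bar>} x * \<bar>x\<bar> powr r)) \<partial>N) < \<infinity>"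
  proof (rule nn_integral_shells_finite[where S = "\<lambda>j. {x. 2^j < \<bar>x\<bar> \<and> \<bar>x\<bar> \<le> 2^Suc j}"
        and w = "\<lambda>j. 2 powr (r * (real j + 1))" and C = "C * 2 powr r" and \<rho> = "2 powr (r - q)"])
    show "{x. 2^j < \<bar>x\<bar> \<and> \<bar>x\<bar> \<le> 2^Suc j} \<in> sets N" for j
    proof -
      have "{x\<in>space borel. 2^j < \<bar>x\<bar> \<and> \<bar>x\<bar> \<le> (2::real)^Suc j} \<in> sets borel" by measurable
      then show ?thesis by (simp add: sets)
    qed
  next
    fix x :: real assume nz: "ennreal (norm (indicator {x. 1 < \<bar>x\<bar>} x * \<bar>x\<bar> powr r)) \<noteq> 0"
    then have x: "1 < \<bar>x\<bar>" by (auto split: split_indicator_asm)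
    have "\<exists>j. \<bar>x\<bar> \<le> 2 ^ j" using real_arch_pow[of 2 "\<bar>x\<bar>"] by (auto intro: less_imp_le)
    then obtain k where k: "\<bar>x\<bar> \<le> 2 ^ k" "\<And>i. i < k \<Longrightarrow> \<not> \<bar>x\<bar> \<le> 2 ^ i"
      using exists_least_iff[of "\<lambda>k. \<bar>x\<bar> \<le> 2 ^ k"] by blast
    then obtain j where j: "k = Suc j" using x by (cases k) auto
    have "\<bar>x\<bar> powr r \<le> (2 ^ Suc j) powr r" using k j \<open>0 \<le> r\<close> by (intro powr_mono2) auto
    also have "\<dots> = 2 powr (r * (real j + 1))"
      by (simp add: powr_realpow[symmetric] powr_powr mult.commute del: power_Suc)
        (simp add: algebra_simps)
    finally show "\<exists>j. x \<in> {x. 2^j < \<bar>x\<bar> \<and> \<bar>x\<bar> \<le> 2^Suc j} \<and>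
        ennreal (norm (indicator {x. 1 < \<bar>x\<bar>} x * \<bar>x\<bar> powr r)) \<le> ennreal (2 powr (r * (real j + 1)))"
      using k j x by (intro exI[of _ j]) (auto simp: not_le)
  next
    fix j :: nat
    have "ennreal (2 powr (r * (real j + 1))) * emeasure N {x. 2^j < \<bar>x\<bar> \<and> \<bar>x\<bar> \<le> 2^Suc j}
        \<le> ennreal (2 powr (r * (real j + 1))) * ennreal (C * 2 powr (- q * real j))"
      by (intro mult_left_mono bound) simp
    also have "\<dots> = ennreal (C * 2 powr r * (2 powr (r - q)) ^ j)"
      using \<open>0 \<le> C\<close> by (simp add: ennreal_mult[symmetric] powr_realpow[symmetric] powr_powr powr_add[symmetric] algebra_simps)
    finally show "ennreal (2 powr (r * (real j + 1))) * emeasure N {x. 2^j < \<bar>x\<bar> \<and> \<bar>x\<bar> \<le> 2^Suc j}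
        \<le> ennreal (C * 2 powr r * (2 powr (r - q)) ^ j)" .
  qed (use assms in \<open>auto intro!: powr_less_one\<close>)
qed

text \<open>Both signs of \<open>r\<close> and \<open>q\<close> occur: small jumps have
  \<open>q = - \<beta>\<close> and \<open>r > \<beta>\<close>, whereas \<pi> has
  \<open>q > 0\<close> and a negative \<open>r\<close>. The factor \<open>2 powr |r|\<close> covers
  either end of the shell at which the power may be largest.\<close>

lemma nn_integral_small_powr_finite:
  fixes N :: "real measure"
  assumes sets[measurable_cong]: "sets N = sets borel" and "0 \<le> C" "x0 > 0" "q + r > 0"
    and bound: "\<And>j::nat. emeasure N {x. x0 * (1/2) ^ Suc j \<le> \<bar>x\<bar> \<and> \<bar>x\<bar> \<le> x0 * (1/2) ^ j} \<le> ennreal (C * 2 powr (- q * real j))"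
  shows "(\<integral>\<^sup>+x. ennreal (indicator {x. 0 < \<bar>x\<bar> \<and> \<bar>x\<bar> \<le> x0} x * \<bar>x\<bar> powr r) \<partial>N) < \<infinity>"
proof -
  let ?w = "\<lambda>j::nat. x0 powr r * 2 powr (\<bar>r\<bar>) * 2 powr (- r * real j)"
  show ?thesis
  proof (rule nn_integral_shells_finite[where S = "\<lambda>j. {x. x0 * (1/2) ^ Suc j \<le> \<bar>x\<bar> \<and> \<bar>x\<bar> \<le> x0 * (1/2) ^ j}"
        and w = ?w and C = "C * x0 powr r * 2 powr \<bar>r\<bar>" and \<rho> = "2 powr (- (q + r))"])
    show "{x. x0 * (1/2) ^ Suc j \<le> \<bar>x\<bar> \<and> \<bar>x\<bar> \<le> x0 * (1/2) ^ j} \<in> sets N" for j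
    proof -
      have "{x\<in>space borel. x0 * (1/2) ^ Suc j \<le> \<bar>x\<bar> \<and> \<bar>x\<bar> \<le> x0 * (1/2) ^ j} \<in> sets borel" by measurable
      then show ?thesis by (simp add: sets)
    qed
  next
    fix x :: real assume nz: "ennreal (indicator {x. 0 < \<bar>x\<bar> \<and> \<bar>x\<bar> \<le> x0} x * \<bar>x\<bar> powr r) \<noteq> 0"
    then have x: "0 < \<bar>x\<bar>" "\<bar>x\<bar> \<le> x0" by (auto split: split_indicator_asm)
    obtain k where k: "(1/2) ^ k * (x0 / \<bar>x\<bar>) \<in> {1/2<..1}"
      using dyadic_reduce[of "x0 / \<bar>x\<bar>"] x by auto
    then have k': "x0 * (1/2) ^ k \<le> \<bar>x\<bar>" "\<bar>x\<bar> < 2 * (x0 * (1/2) ^ k)"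
      using x by (auto simp: field_simps)
    \<comment> \<open>The chosen \<open>k\<close> indexes shells by their lower end,
      \<open>j\<close> by their upper end. The truncated subtraction matters only for
      \<open>k = 0\<close>, which forces \<open>|x| = x0\<close>, a point of shell 0.\<close>
    define j where "j = k - 1"
    have j: "x0 * (1/2) ^ Suc j \<le> \<bar>x\<bar>" "\<bar>x\<bar> \<le> x0 * (1/2) ^ j"
    proof -
      show "x0 * (1/2) ^ Suc j \<le> \<bar>x\<bar>"
        using k' x \<open>x0 > 0\<close> by (cases k) (auto simp: j_def)
      show "\<bar>x\<bar> \<le> x0 * (1/2) ^ j"
        using k' x \<open>x0 > 0\<close> by (cases k) (auto simp: j_def)
    qed
    have e: "(x0 * (1/2) ^ i) powr r = x0 powr r * 2 powr (- r * real i)" for i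
      using \<open>x0 > 0\<close> by (simp add: powr_mult powr_realpow[symmetric] powr_powr powr_divide powr_minus_divide mult.commute)
    have "\<bar>x\<bar> powr r \<le> ?w j"
    proof (cases "0 \<le> r")
      case True
      have "\<bar>x\<bar> powr r \<le> (x0 * (1/2) ^ j) powr r" using j True by (intro powr_mono2) auto
      also have "\<dots> = x0 powr r * 1 * 2 powr (- r * real j)" by (simp add: e)
      also have "\<dots> \<le> ?w j" using True by (intro mult_right_mono mult_left_mono) (auto intro!: ge_one_powr_ge_zero)
      finally show ?thesis .
    next
      case False
      have "\<bar>x\<bar> powr r \<le> (x0 * (1/2) ^ Suc j) powr r"
        using j False \<open>x0 > 0\<close> by (intro powr_mono2') auto
      also have "\<dots> = ?w j" using False unfolding e by (simp add: powr_add[symmetric] algebra_simps)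
      finally show ?thesis .
    qed
    then show "\<exists>j. x \<in> {x. x0 * (1/2) ^ Suc j \<le> \<bar>x\<bar> \<and> \<bar>x\<bar> \<le> x0 * (1/2) ^ j} \<and>
        ennreal (indicator {x. 0 < \<bar>x\<bar> \<and> \<bar>x\<bar> \<le> x0} x * \<bar>x\<bar> powr r) \<le> ennreal (?w j)"
      using j x by (intro exI[of _ j]) auto
  next
    fix j :: nat
    have "ennreal (?w j) * emeasure N {x. x0 * (1/2) ^ Suc j \<le> \<bar>x\<bar> \<and> \<bar>x\<bar> \<le> x0 * (1/2) ^ j}
        \<le> ennreal (?w j) * ennreal (C * 2 powr (- q * real j))"
      by (intro mult_left_mono bound) simp
    also have "\<dots> = ennreal (C * x0 powr r * 2 powr \<bar>r\<bar> * (2 powr (- (q + r))) ^ j)"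
      using \<open>0 \<le> C\<close> by (simp add: ennreal_mult[symmetric] powr_realpow[symmetric] powr_powr powr_add[symmetric] algebra_simps)
    finally show "ennreal (?w j) * emeasure N {x. x0 * (1/2) ^ Suc j \<le> \<bar>x\<bar> \<and> \<bar>x\<bar> \<le> x0 * (1/2) ^ j}
        \<le> ennreal (C * x0 powr r * 2 powr \<bar>r\<bar> * (2 powr (- (q + r))) ^ j)" .
  qed (use assms in \<open>auto intro!: powr_less_one\<close>)
qed


lemma cumulant_integrand_bound:
  fixes z x q q' :: real
  assumes q: "1 \<le> q" "q \<le> 2" and q': "1 \<le> q'" "q' \<le> 2"
  shows "norm (cis (z * x) - 1 - \<i> * complex_of_real (z * x)) \<le>
    2 * \<bar>z\<bar> powr q * (indicator {x. 1 < \<bar>x\<bar>} x * \<bar>x\<bar> powr q) +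
    2 * \<bar>z\<bar> powr q' * (indicator {x. 0 < \<bar>x\<bar> \<and> \<bar>x\<bar> \<le> 1} x * \<bar>x\<bar> powr q')"
proof -
  consider "x = 0" | "x \<noteq> 0" "\<bar>x\<bar> \<le> 1" | "1 < \<bar>x\<bar>" by linarith
  then show ?thesis
  proof cases
    case 2
    then show ?thesis using cis_taylor_le_powr[OF q', of "z * x"] by (simp add: abs_mult powr_mult)
  next
    case 3
    then show ?thesis using cis_taylor_le_powr[OF q, of "z * x"] by (simp add: abs_mult powr_mult)
  qed simp
qed

section \<open>The cumulant function without Gaussian part\<close>

locale levy_jump_measure =
  fixes \<mu> :: "real measure"
  assumes levy: "levy_measure \<mu>"
begin

lemma sets_mu [measurable_cong]: "sets \<mu> = sets borel"
  using levy by (simp add: levy_measure_def)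

lemma space_mu [simp]: "space \<mu> = UNIV"
  using sets_eq_imp_space_eq[OF sets_mu] by simp

lemma integrable_min_sq: "integrable \<mu> (\<lambda>x. min 1 (x\<^sup>2))"
  using levy by (intro integrableI_bounded) (auto simp: levy_measure_def)

lemma emeasure_mu_away:
  assumes "0 < c"
  shows "emeasure \<mu> {x. c \<le> \<bar>x\<bar>} < \<infinity>"
proof -
  have "emeasure \<mu> {x\<in>space \<mu>. min 1 (c\<^sup>2) \<le> min 1 (x\<^sup>2)} \<le> ennreal (1 / min 1 (c\<^sup>2) * (\<integral>x. min 1 (x\<^sup>2) \<partial>\<mu>))"
    using assms by (intro integral_Markov_inequality integrable_min_sq) auto
  then have "emeasure \<mu> {x\<in>space \<mu>. min 1 (c\<^sup>2) \<le> min 1 (x\<^sup>2)} < \<infinity>" by (simp add: le_less_trans)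
  moreover have "{x. c \<le> \<bar>x\<bar>} \<subseteq> {x\<in>space \<mu>. min 1 (c\<^sup>2) \<le> min 1 (x\<^sup>2)}"
  proof
    fix x :: real assume "x \<in> {x. c \<le> \<bar>x\<bar>}"
    then have "c\<^sup>2 \<le> \<bar>x\<bar>\<^sup>2" using assms by (intro power_mono) auto
    then show "x \<in> {x\<in>space \<mu>. min 1 (c\<^sup>2) \<le> min 1 (x\<^sup>2)}" by (auto intro: min.mono)
  qed
  moreover have "{x\<in>space \<mu>. min 1 (c\<^sup>2) \<le> min 1 (x\<^sup>2)} \<in> sets \<mu>" by measurable
  ultimately show ?thesis by (meson emeasure_mono le_less_trans)
qed

text \<open>This ensures that the Bochner integral in \<open>levy_cumulant\<close> is a genuine
  value and not the default 0: the integrand is quadratic on \<open>[-1, 1]\<close> and bounded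
  outside.\<close>

lemma integrable_cumulant_integrand:
  "integrable \<mu> (\<lambda>x. cis (\<zeta> * x) - 1 - \<i> * complex_of_real (\<zeta> * x * indicator {-1..1} x))"
proof (rule Bochner_Integration.integrable_bound)
  show "integrable \<mu> (\<lambda>x. (2 * \<zeta>\<^sup>2 + 2) * min 1 (x\<^sup>2))"
    using integrable_min_sq by (intro integrable_mult_right)
  show "AE x in \<mu>. norm (cis (\<zeta> * x) - 1 - \<i> * complex_of_real (\<zeta> * x * indicator {-1..1} x)) \<le> norm ((2 * \<zeta>\<^sup>2 + 2) * min 1 (x\<^sup>2))"
  proof (rule AE_I2)
    fix x
    show "norm (cis (\<zeta> * x) - 1 - \<i> * complex_of_real (\<zeta> * x * indicator {-1..1} x)) \<le> norm ((2 * \<zeta>\<^sup>2 + 2) * min 1 (x\<^sup>2))"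
    proof (cases "\<bar>x\<bar> \<le> 1")
      case True
      then have "x\<^sup>2 \<le> 1" by (simp add: abs_square_le_1)
      moreover have "norm (cis (\<zeta> * x) - 1 - \<i> * complex_of_real (\<zeta> * x)) \<le> 2 * \<zeta>\<^sup>2 * x\<^sup>2"
        using cis_taylor_le_powr[of 2 "\<zeta> * x"] by (simp add: power_mult_distrib)
      moreover have "2 * \<zeta>\<^sup>2 * x\<^sup>2 \<le> (2 * \<zeta>\<^sup>2 + 2) * x\<^sup>2" by (simp add: distrib_right)
      ultimately show ?thesis using True by (auto simp: abs_mult abs_le_iff)
    next
      case False
      then have "1 \<le> x\<^sup>2" by (metis abs_le_square_iff abs_one linear one_power2)
      then have mn: "min 1 (x\<^sup>2) = 1" by simp
      have "indicat_real {-1..1} x = 0" using False by (auto simp: indicator_def)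
      then have "norm (cis (\<zeta> * x) - 1 - \<i> * complex_of_real (\<zeta> * x * indicator {-1..1} x)) = norm (cis (\<zeta> * x) - 1)" by simp
      also have "\<dots> \<le> 2" by (rule order_trans[OF norm_triangle_ineq4]) simp
      also have "2 \<le> norm ((2 * \<zeta>\<^sup>2 + 2) * 1)" by simp
      finally show ?thesis unfolding mn .
    qed
  qed
qed measurable

lemma integrable_one_minus_cos: "integrable \<mu> (\<lambda>x. 1 - cos (\<zeta> * x))"
  using integrable_minus[OF integrable_Re[OF integrable_cumulant_integrand[of \<zeta>]]] by simp

lemma Re_levy_cumulant: "Re (levy_cumulant a 0 \<mu> \<zeta>) = - (\<integral>x. 1 - cos (\<zeta> * x) \<partial>\<mu>)"
proof -
  have "Re (levy_cumulant a 0 \<mu> \<zeta>) = (\<integral>x. Re (cis (\<zeta> * x) - 1 - \<i> * complex_of_real (\<zeta> * x * indicator {-1..1} x)) \<partial>\<mu>)"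
    by (subst integral_Re[OF integrable_cumulant_integrand]) (simp add: levy_cumulant_def)
  also have "\<dots> = (\<integral>x. - (1 - cos (\<zeta> * x)) \<partial>\<mu>)" by (intro Bochner_Integration.integral_cong) auto
  also have "\<dots> = - (\<integral>x. 1 - cos (\<zeta> * x) \<partial>\<mu>)" by (rule Bochner_Integration.integral_minus)
  finally show ?thesis .
qed

lemma Re_levy_cumulant_nonpos: "Re (levy_cumulant a 0 \<mu> \<zeta>) \<le> 0"
  unfolding Re_levy_cumulant by (simp add: Bochner_Integration.integral_nonneg)

text \<open>For jumps in the window the phase \<open>z x\<close> has modulus between
  \<open>c\<close> and 1, where \<open>1 - cos\<close> is at least \<open>c\<^sup>2 / 4\<close>; the
  other jumps only help.\<close>

lemma Re_levy_cumulant_le: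
  assumes "0 < y0" and z: "y0 * z \<ge> c" "y1 * z \<le> 1" "0 < z" "0 \<le> c"
  shows "Re (levy_cumulant a 0 \<mu> z) \<le> - (c\<^sup>2 / 4 * measure \<mu> {x. y0 < \<bar>x\<bar> \<and> \<bar>x\<bar> \<le> y1})"
proof -
  let ?S = "{x. y0 < \<bar>x\<bar> \<and> \<bar>x\<bar> \<le> y1}"
  have S: "?S \<in> sets \<mu>"
  proof -
    have "{x\<in>space \<mu>. y0 < \<bar>x\<bar> \<and> \<bar>x\<bar> \<le> y1} \<in> sets \<mu>" by measurable
    then show ?thesis by simp
  qed
  have "emeasure \<mu> ?S \<le> emeasure \<mu> {x. y0 \<le> \<bar>x\<bar>}"
  proof (rule emeasure_mono)
    have "{x\<in>space \<mu>. y0 \<le> \<bar>x\<bar>} \<in> sets \<mu>" by measurable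
    then show "{x. y0 \<le> \<bar>x\<bar>} \<in> sets \<mu>" by simp
  qed auto
  also have "\<dots> < \<infinity>" by (rule emeasure_mu_away[OF \<open>0 < y0\<close>])
  finally have Sfin: "emeasure \<mu> ?S < \<infinity>" .
  have "c\<^sup>2 / 4 * measure \<mu> ?S = (\<integral>x. c\<^sup>2 / 4 * indicator ?S x \<partial>\<mu>)" by simp
  also have "\<dots> \<le> (\<integral>x. 1 - cos (z * x) \<partial>\<mu>)"
  proof (rule integral_mono)
    show "integrable \<mu> (\<lambda>x. c\<^sup>2 / 4 * indicator ?S x)"
      using S Sfin by (intro integrable_mult_right) (simp add: integrable_indicator_iff)
    show "c\<^sup>2 / 4 * indicator ?S x \<le> 1 - cos (z * x)" for x
    proof (cases "x \<in> ?S")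
      case True
      then have "\<bar>x\<bar> * z \<le> y1 * z" "y0 * z \<le> \<bar>x\<bar> * z" using z by (auto intro!: mult_right_mono)
      moreover have "\<bar>z * x\<bar> = \<bar>x\<bar> * z" using z by (simp add: abs_mult)
      ultimately have b: "\<bar>z * x\<bar> \<le> 1" "c \<le> \<bar>z * x\<bar>" using z by linarith+
      then have "c\<^sup>2 \<le> (z * x)\<^sup>2" using power_mono[OF b(2) z(4), of 2] by simp
      then show ?thesis using one_minus_cos_ge[OF b(1)] True by simp
    qed simp
  qed (rule integrable_one_minus_cos)
  finally show ?thesis by (simp add: Re_levy_cumulant)
qed

text \<open>The compensator is extended from \<open>[-1, 1]\<close> to all jumps, which a first
  moment of the large jumps permits. The price is the drift \<open>m\<close>; in the remainder
  \<open>k\<close>, large and small jumps may be estimated with different powers.\<close>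

lemma levy_cumulant_decomp:
  fixes q q' a :: real
  assumes q: "1 \<le> q" "q \<le> 2" and q': "1 \<le> q'" "q' \<le> 2"
    and large: "integrable \<mu> (\<lambda>x. indicator {x. 1 < \<bar>x\<bar>} x * \<bar>x\<bar> powr q)"
    and small: "integrable \<mu> (\<lambda>x. indicator {x. 0 < \<bar>x\<bar> \<and> \<bar>x\<bar> \<le> 1} x * \<bar>x\<bar> powr q')"
  defines "m \<equiv> a + (\<integral>x. x * indicator {x. 1 < \<bar>x\<bar>} x \<partial>\<mu>)"
    and "k \<equiv> \<lambda>z. (\<integral>x. cis (z * x) - 1 - \<i> * complex_of_real (z * x) \<partial>\<mu>)"
  shows "levy_cumulant a 0 \<mu> z = \<i> * complex_of_real (z * m) + k z"
    and "norm (k z) \<le> (2 * (\<integral>x. indicator {x. 1 < \<bar>x\<bar>} x * \<bar>x\<bar> powr q \<partial>\<mu>)) * \<bar>z\<bar> powr q +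
      (2 * (\<integral>x. indicator {x. 0 < \<bar>x\<bar> \<and> \<bar>x\<bar> \<le> 1} x * \<bar>x\<bar> powr q' \<partial>\<mu>)) * \<bar>z\<bar> powr q'"
proof -
  let ?L = "\<lambda>x. indicator {x. 1 < \<bar>x\<bar>} x * \<bar>x\<bar> powr q :: real"
  let ?S = "\<lambda>x. indicator {x. 0 < \<bar>x\<bar> \<and> \<bar>x\<bar> \<le> 1} x * \<bar>x\<bar> powr q' :: real"
  let ?b = "\<lambda>x. 2 * \<bar>z\<bar> powr q * ?L x + 2 * \<bar>z\<bar> powr q' * ?S x"
  have b: "integrable \<mu> ?b" using large small by (intro Bochner_Integration.integrable_add integrable_mult_right)
  have int: "integrable \<mu> (\<lambda>x. cis (z * x) - 1 - \<i> * complex_of_real (z * x))"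
  proof (rule Bochner_Integration.integrable_bound[OF b])
    have "0 \<le> ?b x" for x by simp
    then show "AE x in \<mu>. norm (cis (z * x) - 1 - \<i> * complex_of_real (z * x)) \<le> norm (?b x)"
      using cumulant_integrand_bound[OF q q', of z] by (intro AE_I2) simp
  qed measurable
  have int1: "integrable \<mu> (\<lambda>x. x * indicator {x. 1 < \<bar>x\<bar>} x)"
  proof (rule Bochner_Integration.integrable_bound[OF large])
    have "norm (x * indicator {x. 1 < \<bar>x\<bar>} x) \<le> norm (?L x)" for x :: real
    proof (cases "1 < \<bar>x\<bar>")
      case True
      then have "\<bar>x\<bar> powr 1 \<le> \<bar>x\<bar> powr q" using q by (intro powr_mono) auto
      then show ?thesis using True by simp
    qed simp
    then show "AE x in \<mu>. norm (x * indicator {x. 1 < \<bar>x\<bar>} x) \<le> norm (?L x)" by simp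
  qed measurable
  have "(\<integral>x. cis (z * x) - 1 - \<i> * complex_of_real (z * x * indicator {-1..1} x) \<partial>\<mu>)
      = (\<integral>x. (cis (z * x) - 1 - \<i> * complex_of_real (z * x)) + \<i> * complex_of_real (z * (x * indicator {x. 1 < \<bar>x\<bar>} x)) \<partial>\<mu>)"
    by (intro Bochner_Integration.integral_cong) (auto simp: indicator_def)
  also have "\<dots> = k z + (\<integral>x. \<i> * complex_of_real (z * (x * indicator {x. 1 < \<bar>x\<bar>} x)) \<partial>\<mu>)"
    unfolding k_def using int int1 by (intro Bochner_Integration.integral_add integrable_mult_right integrable_of_real)
  also have "(\<integral>x. \<i> * complex_of_real (z * (x * indicator {x. 1 < \<bar>x\<bar>} x)) \<partial>\<mu>) = \<i> * complex_of_real (z * (\<integral>x. x * indicator {x. 1 < \<bar>x\<bar>} x \<partial>\<mu>))"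
    by (simp only: integral_mult_right_zero integral_complex_of_real)
  finally show "levy_cumulant a 0 \<mu> z = \<i> * complex_of_real (z * m) + k z"
    by (simp add: levy_cumulant_def m_def algebra_simps)
  have "norm (k z) \<le> (\<integral>x. norm (cis (z * x) - 1 - \<i> * complex_of_real (z * x)) \<partial>\<mu>)"
    unfolding k_def by (rule integral_norm_bound)
  also have "\<dots> \<le> (\<integral>x. ?b x \<partial>\<mu>)"
    using cumulant_integrand_bound[OF q q', of z] by (intro integral_mono integrable_norm[OF int] b)
  also have "\<dots> = 2 * \<bar>z\<bar> powr q * (\<integral>x. ?L x \<partial>\<mu>) + 2 * \<bar>z\<bar> powr q' * (\<integral>x. ?S x \<partial>\<mu>)"
    using large small by (subst Bochner_Integration.integral_add) (auto intro: integrable_mult_right)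
  finally show "norm (k z) \<le> (2 * (\<integral>x. ?L x \<partial>\<mu>)) * \<bar>z\<bar> powr q + (2 * (\<integral>x. ?S x \<partial>\<mu>)) * \<bar>z\<bar> powr q'"
    by (simp add: mult_ac)
qed

text \<open>Tails of order \<open>x powr (- \<beta>)\<close> give the shell at distance
  \<open>2^(- j)\<close> a mass of order \<open>2^(\<beta> j)\<close>, which the power
  \<open>r > \<beta>\<close> turns into a convergent series.\<close>

lemma small_jump_moment:
  assumes right: "((\<lambda>x. measure \<mu> {x..} / x powr (- \<beta>)) \<longlongrightarrow> cp) (at_right 0)"
    and left: "((\<lambda>x. measure \<mu> {..- x} / x powr (- \<beta>)) \<longlongrightarrow> cm) (at_right 0)"
    and \<beta>: "0 \<le> \<beta>" "\<beta> < r"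
  shows "integrable \<mu> (\<lambda>x. indicator {x. 0 < \<bar>x\<bar> \<and> \<bar>x\<bar> \<le> 1} x * \<bar>x\<bar> powr r)"
proof -
  have "\<forall>\<^sub>F x in at_right 0. measure \<mu> {x..} / x powr (- \<beta>) < cp + 1"
    by (rule order_tendstoD[OF right]) simp
  moreover have "\<forall>\<^sub>F x in at_right 0. measure \<mu> {..- x} / x powr (- \<beta>) < cm + 1"
    by (rule order_tendstoD[OF left]) simp
  ultimately have "\<forall>\<^sub>F x in at_right 0. measure \<mu> {x..} / x powr (- \<beta>) < cp + 1 \<and> measure \<mu> {..- x} / x powr (- \<beta>) < cm + 1"
    by (rule eventually_conj)
  then obtain b where b: "0 < b" "\<And>x. 0 < x \<Longrightarrow> x < b \<Longrightarrow> measure \<mu> {x..} / x powr (- \<beta>) < cp + 1 \<and> measure \<mu> {..- x} / x powr (- \<beta>) < cm + 1"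
    unfolding eventually_at_right_field by auto
  define x0 where "x0 = min 1 (b / 2)"
  have x0: "0 < x0" "x0 \<le> 1" "x0 < b" using b(1) by (auto simp: x0_def)
  \<comment> \<open>The maximum with 0 supplies the nonnegativity required of the shell
    constant.\<close>
  define C where "C = max 0 ((cp + cm + 2) * (x0 / 2) powr (- \<beta>))"
  have "(\<integral>\<^sup>+x. ennreal (indicator {x. 0 < \<bar>x\<bar> \<and> \<bar>x\<bar> \<le> x0} x * \<bar>x\<bar> powr r) \<partial>\<mu>) < \<infinity>"
  proof (rule nn_integral_small_powr_finite[OF sets_mu, of C _ "- \<beta>"])
    fix j :: nat
    define y where "y = x0 * (1/2) ^ Suc j"
    have "x0 * (1/2) ^ Suc j \<le> x0 * 1"
      using x0 by (intro mult_left_mono power_le_one) auto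
    then have "y \<le> x0" by (simp only: y_def mult_1_right)
    then have y: "0 < y" "y < b" using x0 by (simp add: y_def, linarith)
    \<comment> \<open>\<open>measure\<close> is 0 on sets of infinite measure, so the limits bound
      \<open>emeasure\<close> only once the tails are known to be finite.\<close>
    have fin: "emeasure \<mu> {y..} < \<infinity>" "emeasure \<mu> {..-y} < \<infinity>"
    proof -
      have "{x\<in>space \<mu>. y \<le> \<bar>x\<bar>} \<in> sets \<mu>" by measurable
      then have *: "emeasure \<mu> A < \<infinity>" if "A \<subseteq> {x. y \<le> \<bar>x\<bar>}" for A
        using that by (intro le_less_trans[OF emeasure_mono emeasure_mu_away[OF y(1)]]) auto
      show "emeasure \<mu> {y..} < \<infinity>" by (rule *) (use y(1) in auto)
      show "emeasure \<mu> {..-y} < \<infinity>" by (rule *) (use y(1) in auto)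
    qed
    have "{x. y \<le> \<bar>x\<bar> \<and> \<bar>x\<bar> \<le> x0 * (1/2) ^ j} \<subseteq> {y..} \<union> {..-y}" by auto
    then have "emeasure \<mu> {x. y \<le> \<bar>x\<bar> \<and> \<bar>x\<bar> \<le> x0 * (1/2) ^ j} \<le> emeasure \<mu> {y..} + emeasure \<mu> {..-y}"
      by (intro order_trans[OF emeasure_mono emeasure_subadditive]) (auto simp: sets_mu)
    also have "\<dots> = ennreal (measure \<mu> {y..} + measure \<mu> {..-y})"
      using fin by (simp add: emeasure_eq_ennreal_measure less_top[symmetric])
    also have "\<dots> \<le> ennreal (C * 2 powr (- (- \<beta>) * real j))"
    proof (rule ennreal_leI)
      have "measure \<mu> {y..} + measure \<mu> {..-y} \<le> (cp + 1) * y powr (- \<beta>) + (cm + 1) * y powr (- \<beta>)"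
        using b(2)[OF y] y by (intro add_mono) (auto simp: field_simps)
      also have "\<dots> = (cp + cm + 2) * (x0 / 2) powr (- \<beta>) * 2 powr (\<beta> * real j)"
      proof -
        have "y powr (- \<beta>) = (x0 / 2) powr (- \<beta>) * ((1/2) ^ j) powr (- \<beta>)"
          using x0 by (simp add: y_def powr_mult[symmetric] mult_ac)
        also have "((1/2) ^ j) powr (- \<beta>) = 2 powr (\<beta> * real j)"
          by (simp add: powr_realpow[symmetric] powr_powr powr_divide powr_minus_divide mult.commute)
        finally show ?thesis by (simp add: algebra_simps)
      qed
      also have "\<dots> \<le> C * 2 powr (- (- \<beta>) * real j)" by (auto simp: C_def intro!: mult_right_mono)
      finally show "measure \<mu> {y..} + measure \<mu> {..-y} \<le> C * 2 powr (- (- \<beta>) * real j)" .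
    qed
    finally show "emeasure \<mu> {x. x0 * (1/2) ^ Suc j \<le> \<bar>x\<bar> \<and> \<bar>x\<bar> \<le> x0 * (1/2) ^ j} \<le> ennreal (C * 2 powr (- (- \<beta>) * real j))"
      unfolding y_def .
  qed (use x0 \<beta> in \<open>auto simp: C_def\<close>)
  then have 1: "integrable \<mu> (\<lambda>x. indicator {x. 0 < \<bar>x\<bar> \<and> \<bar>x\<bar> \<le> x0} x * \<bar>x\<bar> powr r)"
    by (intro integrableI_bounded) auto
  \<comment> \<open>The tail asymptotics reach only up to \<open>x0\<close>; between
    \<open>x0\<close> and 1 the power is at most 1 and the mass is finite.\<close>
  have 2: "integrable \<mu> (indicat_real {x. x0 \<le> \<bar>x\<bar>})"
  proof -
    have "{x\<in>space \<mu>. x0 \<le> \<bar>x\<bar>} \<in> sets \<mu>" by measurable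
    then show ?thesis using emeasure_mu_away[OF x0(1)] by (simp add: integrable_indicator_iff)
  qed
  show ?thesis
  proof (rule Bochner_Integration.integrable_bound[OF Bochner_Integration.integrable_add[OF 1 2]])
    have "norm (indicator {x. 0 < \<bar>x\<bar> \<and> \<bar>x\<bar> \<le> 1} x * \<bar>x\<bar> powr r)
        \<le> norm (indicator {x. 0 < \<bar>x\<bar> \<and> \<bar>x\<bar> \<le> x0} x * \<bar>x\<bar> powr r + indicat_real {x. x0 \<le> \<bar>x\<bar>} x)" for x :: real
      using powr_le1[of r "\<bar>x\<bar>"] \<beta> x0 by (auto simp: indicator_def)
    then show "AE x in \<mu>. norm (indicator {x. 0 < \<bar>x\<bar> \<and> \<bar>x\<bar> \<le> 1} x * \<bar>x\<bar> powr r)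
        \<le> norm (indicator {x. 0 < \<bar>x\<bar> \<and> \<bar>x\<bar> \<le> x0} x * \<bar>x\<bar> powr r + indicat_real {x. x0 \<le> \<bar>x\<bar>} x)" by simp
  qed measurable
qed

end

section \<open>Regular variation\<close>

text \<open>The ratio of \<open>T\<close> at \<open>2 x\<close> and \<open>x\<close> tends to
  \<open>2 powr (- \<gamma>)\<close>; lowering the exponent to \<open>q\<close> absorbs the slowly
  varying factor for large \<open>x\<close>.\<close>

lemma regularly_varying_doubling:
  fixes T k :: "real \<Rightarrow> real"
  assumes lim: "((\<lambda>x. T x / (k x * x powr (- \<gamma>))) \<longlongrightarrow> S) at_top" and "0 < S"
    and sv: "slowly_varying k" and "q < \<gamma>"
  shows "\<exists>X>0. \<forall>x\<ge>X. T (2 * x) \<le> 2 powr (- q) * T x"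
proof -
  define R where "R x = T x / (k x * x powr (- \<gamma>))" for x
  have R: "(R \<longlongrightarrow> S) at_top" using lim by (simp add: R_def[abs_def])
  have dbl: "filterlim (\<lambda>x::real. 2 * x) at_top at_top"
    by (rule filterlim_tendsto_pos_mult_at_top[OF tendsto_const]) (auto simp: filterlim_ident)
  have R2: "((\<lambda>x. R (2 * x)) \<longlongrightarrow> S) at_top" by (rule filterlim_compose[OF R dbl])
  have kr: "((\<lambda>x. k (2 * x) / k x) \<longlongrightarrow> 1) at_top" and kpos: "\<forall>\<^sub>F x in at_top. 0 < k x"
    using sv by (auto simp: slowly_varying_def)
  have kpos2: "\<forall>\<^sub>F x in at_top. 0 < k (2 * x)"
    using filterlim_iff[THEN iffD1, OF dbl] kpos by blast
  have "((\<lambda>x. R (2 * x) / R x * (k (2 * x) / k x) * 2 powr (- \<gamma>)) \<longlongrightarrow> S / S * 1 * 2 powr (- \<gamma>)) at_top"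
    using \<open>0 < S\<close> by (intro tendsto_intros R R2 kr) auto
  then have "((\<lambda>x. R (2 * x) / R x * (k (2 * x) / k x) * 2 powr (- \<gamma>)) \<longlongrightarrow> 2 powr (- \<gamma>)) at_top"
    using \<open>0 < S\<close> by simp
  then have "\<forall>\<^sub>F x in at_top. R (2 * x) / R x * (k (2 * x) / k x) * 2 powr (- \<gamma>) < 2 powr (- q)"
    by (rule order_tendstoD) (use \<open>q < \<gamma>\<close> in simp)
  moreover have "\<forall>\<^sub>F x in at_top. 0 < R x" using R \<open>0 < S\<close> by (rule order_tendstoD)
  ultimately have "\<forall>\<^sub>F x in at_top. T (2 * x) \<le> 2 powr (- q) * T x"
    using kpos kpos2 eventually_gt_at_top[of 0]
  proof eventually_elim
    case (elim x)
    have T: "T y = R y * (k y * y powr (- \<gamma>))" if "0 < k y" "0 < y" for y using that by (simp add: R_def)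
    have Tx: "0 < T x" using elim by (simp add: T)
    have "T (2 * x) / T x = R (2 * x) / R x * (k (2 * x) / k x) * 2 powr (- \<gamma>)"
      using elim by (simp add: T powr_mult)
    with elim(1) have "T (2 * x) / T x < 2 powr (- q)" by (simp only:)
    then show ?case using Tx by (simp only: pos_divide_less_eq less_imp_le)
  qed
  then obtain X where X: "\<And>x. X \<le> x \<Longrightarrow> T (2 * x) \<le> 2 powr (- q) * T x"
    by (auto simp: eventually_at_top_linorder)
  show ?thesis by (rule exI[of _ "max X 1"]) (use X in auto)
qed

text \<open>Iterating the doubling bound along powers of 2 gives tails of order
  \<open>2^(- q j)\<close> with \<open>r < q < \<gamma>\<close>, which is summable against
  \<open>2^(r j)\<close>.\<close>

lemma (in prob_space) integrable_powr_of_tail: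
  fixes Y :: "'a \<Rightarrow> real"
  assumes Y[measurable]: "Y \<in> borel_measurable M"
    and right: "((\<lambda>x. prob {\<omega>\<in>space M. Y \<omega> > x} / (k x * x powr (- \<gamma>))) \<longlongrightarrow> p0) at_top"
    and left: "((\<lambda>x. prob {\<omega>\<in>space M. Y \<omega> \<le> - x} / (k x * x powr (- \<gamma>))) \<longlongrightarrow> q0) at_top"
    and "0 < p0 + q0" and sv: "slowly_varying k" and r: "0 \<le> r" "r < \<gamma>"
  shows "integrable M (\<lambda>\<omega>. \<bar>Y \<omega>\<bar> powr r)"
proof -
  define T where "T x = prob {\<omega>\<in>space M. Y \<omega> > x} + prob {\<omega>\<in>space M. Y \<omega> \<le> - x}" for x
  define q where "q = (r + \<gamma>) / 2"
  have q: "r < q" "q < \<gamma>" using r by (auto simp: q_def)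
  have "((\<lambda>x. T x / (k x * x powr (- \<gamma>))) \<longlongrightarrow> p0 + q0) at_top"
    unfolding T_def add_divide_distrib by (intro tendsto_add right left)
  then obtain X where X: "0 < X" "\<And>x. X \<le> x \<Longrightarrow> T (2 * x) \<le> 2 powr (- q) * T x"
    using regularly_varying_doubling[OF _ \<open>0 < p0 + q0\<close> sv q(2), of T] by blast
  obtain J where J: "X < 2 ^ J" using real_arch_pow[of 2 X] by auto
  have T2: "T x \<le> 2" for x unfolding T_def using prob_le_1[of "{\<omega>\<in>space M. Y \<omega> > x}"] prob_le_1[of "{\<omega>\<in>space M. Y \<omega> \<le> - x}"] by linarith
  have dec: "T (2 ^ (J + n)) \<le> 2 * 2 powr (- q * real n)" for n
  proof (induction n)
    case 0 show ?case using T2 by simp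
  next
    case (Suc n)
    have "X \<le> 2 ^ J * 2 ^ n"
    proof -
      have "X \<le> 2 ^ J * 1" using J by simp
      also have "\<dots> \<le> 2 ^ J * 2 ^ n" by (intro mult_left_mono) auto
      finally show ?thesis .
    qed
    then have "T (2 * 2 ^ (J + n)) \<le> 2 powr (- q) * T (2 ^ (J + n))"
      by (intro X(2)) (simp add: power_add)
    also have "\<dots> \<le> 2 powr (- q) * (2 * 2 powr (- q * real n))" by (intro mult_left_mono Suc) auto
    also have "\<dots> = 2 * 2 powr (- q * real (Suc n))" by (simp add: powr_add[symmetric] algebra_simps)
    finally show ?case by simp
  qed
  \<comment> \<open>The factor \<open>2 powr (q * J)\<close> undoes the shift by \<open>J\<close>
    and also covers the indices below \<open>J\<close>, where only \<open>T \<le> 2\<close> is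
    known.\<close>
  define C where "C = 2 * 2 powr (q * real J)"
  have TC: "T (2 ^ j) \<le> C * 2 powr (- q * real j)" for j
  proof (cases "J \<le> j")
    case True
    then have "T (2 ^ j) \<le> 2 * 2 powr (- q * real (j - J))" using dec[of "j - J"] by simp
    also have "\<dots> = C * 2 powr (- q * real j)"
      using True by (simp add: C_def powr_add[symmetric] of_nat_diff algebra_simps)
    finally show ?thesis .
  next
    case False
    have "T (2 ^ j) \<le> 2 * 1" using T2 by simp
    also have "\<dots> \<le> 2 * 2 powr (q * (real J - real j))"
      using False q r by (intro mult_left_mono ge_one_powr_ge_zero) auto
    also have "\<dots> = C * 2 powr (- q * real j)" by (simp add: C_def powr_add[symmetric] algebra_simps)
    finally show ?thesis .
  qed
  have "integrable (distr M borel Y) (\<lambda>x. indicator {x. 1 < \<bar>x\<bar>} x * \<bar>x\<bar> powr r)"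
  proof (rule integrable_large_powr[where C = C and q = q])
    fix j :: nat
    have S: "{x. 2^j < \<bar>x\<bar> \<and> \<bar>x\<bar> \<le> (2::real)^Suc j} \<in> sets borel"
    proof -
      have "{x\<in>space borel. 2^j < \<bar>x\<bar> \<and> \<bar>x\<bar> \<le> (2::real)^Suc j} \<in> sets borel" by measurable
      then show ?thesis by simp
    qed
    have "emeasure (distr M borel Y) {x. 2^j < \<bar>x\<bar> \<and> \<bar>x\<bar> \<le> 2^Suc j}
        = prob (Y -` {x. 2^j < \<bar>x\<bar> \<and> \<bar>x\<bar> \<le> 2^Suc j} \<inter> space M)"
      unfolding emeasure_distr[OF Y S] emeasure_eq_measure ..
    also have "\<dots> \<le> ennreal (T (2 ^ j))"
    proof (rule ennreal_leI)
      have "prob (Y -` {x. 2^j < \<bar>x\<bar> \<and> \<bar>x\<bar> \<le> 2^Suc j} \<inter> space M)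
          \<le> prob ({\<omega>\<in>space M. Y \<omega> > 2 ^ j} \<union> {\<omega>\<in>space M. Y \<omega> \<le> - (2 ^ j)})"
        by (intro finite_measure_mono) auto
      also have "\<dots> \<le> T (2 ^ j)" unfolding T_def by (intro measure_Un_le) auto
      finally show "prob (Y -` {x. 2^j < \<bar>x\<bar> \<and> \<bar>x\<bar> \<le> 2^Suc j} \<inter> space M) \<le> T (2 ^ j)" .
    qed
    also have "\<dots> \<le> ennreal (C * 2 powr (- q * real j))" by (intro ennreal_leI TC)
    finally show "emeasure (distr M borel Y) {x. 2^j < \<bar>x\<bar> \<and> \<bar>x\<bar> \<le> 2^Suc j} \<le> ennreal (C * 2 powr (- q * real j))" .
  qed (use q r in \<open>auto simp: C_def\<close>)
  then have int: "integrable M (\<lambda>\<omega>. indicator {x. 1 < \<bar>x\<bar>} (Y \<omega>) * \<bar>Y \<omega>\<bar> powr r)"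
    by (subst (asm) integrable_distr_eq) auto
  show ?thesis
  proof (rule Bochner_Integration.integrable_bound)
    show "integrable M (\<lambda>\<omega>. indicator {x. 1 < \<bar>x\<bar>} (Y \<omega>) * \<bar>Y \<omega>\<bar> powr r + 1)"
      using int by simp
    have "norm (\<bar>y\<bar> powr r) \<le> norm (indicator {x. 1 < \<bar>x\<bar>} y * \<bar>y\<bar> powr r + 1)" for y :: real
      using powr_le1[of r "\<bar>y\<bar>"] r by (auto simp: indicator_def)
    then show "AE \<omega> in M. norm (\<bar>Y \<omega>\<bar> powr r) \<le> norm (indicator {x. 1 < \<bar>x\<bar>} (Y \<omega>) * \<bar>Y \<omega>\<bar> powr r + 1)" by simp
  qed measurable
qed

text \<open>The ratio \<open>p (x / 2) / p x\<close> tends to \<open>2 powr (1 - \<alpha>)\<close>,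
  as \<open>p\<close> varies like \<open>x powr (\<alpha> - 1)\<close>; moving \<alpha> to
  \<open>a'\<close> or \<open>a''\<close> absorbs the slowly varying factor near 0.\<close>

lemma regularly_varying_density_halving:
  fixes p ell :: "real \<Rightarrow> real"
  assumes lim: "((\<lambda>x. p x / (\<alpha> * ell (1 / x) * x powr (\<alpha> - 1))) \<longlongrightarrow> 1) (at_right 0)"
    and "0 < \<alpha>" and sv: "slowly_varying ell" and a: "a' < \<alpha>" "\<alpha> < a''"
  obtains x0 where "0 < x0" "\<And>x. 0 < x \<Longrightarrow> x \<le> x0 \<Longrightarrow> 0 < p x"
    "\<And>x. 0 < x \<Longrightarrow> x \<le> x0 \<Longrightarrow> p (x / 2) \<le> 2 powr (1 - a') * p x"
    "\<And>x. 0 < x \<Longrightarrow> x \<le> x0 \<Longrightarrow> 2 powr (1 - a'') * p x \<le> p (x / 2)"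
proof -
  define Q where "Q x = p x / (\<alpha> * ell (1 / x) * x powr (\<alpha> - 1))" for x
  have Q: "(Q \<longlongrightarrow> 1) (at_right 0)" using lim by (simp add: Q_def[abs_def])
  have half: "filterlim (\<lambda>x::real. x / 2) (at_right 0) (at_right 0)"
  proof -
    have "((\<lambda>x::real. x / 2) \<longlongrightarrow> 0 / 2) (at_right 0)" by (intro tendsto_intros) auto
    then show ?thesis
      by (auto simp: filterlim_at intro: eventually_mono[OF eventually_at_right_less])
  qed
  have inv: "filterlim (\<lambda>x::real. 1 / x) at_top (at_right 0)"
    using filterlim_inverse_at_top_right by (simp add: inverse_eq_divide)
  have Q2: "((\<lambda>x. Q (x / 2)) \<longlongrightarrow> 1) (at_right 0)" by (rule filterlim_compose[OF Q half])
  have "((\<lambda>y. ell (2 * y) / ell y) \<longlongrightarrow> 1) at_top" and lpos: "\<forall>\<^sub>F y in at_top. 0 < ell y"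
    using sv by (auto simp: slowly_varying_def)
  then have lr: "((\<lambda>x. ell (2 * (1 / x)) / ell (1 / x)) \<longlongrightarrow> 1) (at_right 0)"
    using filterlim_compose[OF _ inv, of "\<lambda>y. ell (2 * y) / ell y" "nhds 1"] by simp
  have lpos1: "\<forall>\<^sub>F x in at_right 0. 0 < ell (1 / x)"
    using filterlim_iff[THEN iffD1, OF inv] lpos by blast
  have lpos2: "\<forall>\<^sub>F x in at_right 0. 0 < ell (1 / (x / 2))"
    using filterlim_iff[THEN iffD1, OF filterlim_compose[OF inv half]] lpos by blast
  have L: "((\<lambda>x. Q (x / 2) / Q x * (ell (2 * (1 / x)) / ell (1 / x)) * 2 powr (1 - \<alpha>)) \<longlongrightarrow> 1 / 1 * 1 * 2 powr (1 - \<alpha>)) (at_right 0)"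
    by (intro tendsto_intros Q Q2 lr) auto
  have "\<forall>\<^sub>F x in at_right 0. Q (x / 2) / Q x * (ell (2 * (1 / x)) / ell (1 / x)) * 2 powr (1 - \<alpha>) < 2 powr (1 - a')"
    using L by (rule order_tendstoD) (use a in simp)
  moreover have "\<forall>\<^sub>F x in at_right 0. 2 powr (1 - a'') < Q (x / 2) / Q x * (ell (2 * (1 / x)) / ell (1 / x)) * 2 powr (1 - \<alpha>)"
    using L by (rule order_tendstoD) (use a in simp)
  moreover have "\<forall>\<^sub>F x in at_right 0. 0 < Q x" using Q by (rule order_tendstoD) simp
  ultimately have "\<forall>\<^sub>F x in at_right 0. 0 < p x \<and> p (x / 2) \<le> 2 powr (1 - a') * p x \<and> 2 powr (1 - a'') * p x \<le> p (x / 2)"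
    using lpos1 lpos2 eventually_at_right_less[of 0]
  proof eventually_elim
    case (elim x)
    have P: "p y = Q y * (\<alpha> * ell (1 / y) * y powr (\<alpha> - 1))" if "0 < ell (1 / y)" "0 < y" for y
      using that \<open>0 < \<alpha>\<close> by (simp add: Q_def)
    have px: "0 < p x" using elim \<open>0 < \<alpha>\<close> by (simp add: P)
    have "2 powr (1 - \<alpha>) = 1 / 2 powr (\<alpha> - 1)" by (simp add: powr_minus_divide[symmetric])
    moreover have "ell (1 / (x / 2)) = ell (2 * (1 / x))" by simp
    ultimately have "p (x / 2) / p x = Q (x / 2) / Q x * (ell (2 * (1 / x)) / ell (1 / x)) * 2 powr (1 - \<alpha>)"
      using elim \<open>0 < \<alpha>\<close> P[of x] P[of "x / 2"] by (simp add: powr_divide)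
    with elim(1,2) have "p (x / 2) / p x < 2 powr (1 - a')" "2 powr (1 - a'') < p (x / 2) / p x"
      by (simp_all only:)
    then show ?case using px by (simp only: pos_divide_less_eq pos_less_divide_eq less_imp_le simp_thms)
  qed
  then obtain b where b: "0 < b" "\<And>x. 0 < x \<Longrightarrow> x < b \<Longrightarrow> 0 < p x \<and> p (x / 2) \<le> 2 powr (1 - a') * p x \<and> 2 powr (1 - a'') * p x \<le> p (x / 2)"
    unfolding eventually_at_right_field by auto
  show thesis by (rule that[of "b / 2"]) (use b in auto)
qed

text \<open>Iterating the single ratio \<open>p (x / 2) / p x\<close> along dyadic shells takes the place of Potter bounds.\<close>
lemma dyadic_density_shells:
  fixes p :: "real \<Rightarrow> real"
  assumes [measurable]: "p \<in> borel_measurable borel" and p0: "\<And>x. 0 \<le> p x" and x0: "0 < x0"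
    and up: "\<And>x. 0 < x \<Longrightarrow> x \<le> x0 \<Longrightarrow> p (x / 2) \<le> 2 powr (1 - a') * p x"
    and lo: "\<And>x. 0 < x \<Longrightarrow> x \<le> x0 \<Longrightarrow> 2 powr (1 - a'') * p x \<le> p (x / 2)"
  defines "D \<equiv> \<lambda>n. emeasure (density lborel (\<lambda>x. ennreal (p x))) {x0 * (1/2) ^ Suc n..x0 * (1/2) ^ n}"
  shows "D n \<le> ennreal (2 powr (- a' * real n)) * D 0" "ennreal (2 powr (- a'' * real n)) * D 0 \<le> D n"
proof -
  let ?S = "\<lambda>n. {x0 * (1/2) ^ Suc n..x0 * (1/2) ^ n}"
  have Dn: "D n = (\<integral>\<^sup>+x. ennreal (p x) * indicator (?S n) x \<partial>lborel)" for n
    unfolding D_def by (rule emeasure_density) auto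
  \<comment> \<open>The substitution \<open>x / 2\<close> maps shell \<open>n\<close> onto shell
    \<open>n + 1\<close>; its Jacobian \<open>1 / 2\<close> changes the ratio
    \<open>2 powr (1 - a')\<close> of densities into the ratio \<open>2 powr (- a')\<close> of
    masses.\<close>
  have DS: "D (Suc n) = ennreal (1/2) * (\<integral>\<^sup>+x. ennreal (p (x / 2)) * indicator (?S n) x \<partial>lborel)" for n
  proof -
    have "D (Suc n) = ennreal \<bar>1/2\<bar> * (\<integral>\<^sup>+x. ennreal (p (0 + 1/2 * x)) * indicator (?S (Suc n)) (0 + 1/2 * x) \<partial>lborel)"
      unfolding Dn by (rule nn_integral_real_affine) auto
    also have "(\<integral>\<^sup>+x. ennreal (p (0 + 1/2 * x)) * indicator (?S (Suc n)) (0 + 1/2 * x) \<partial>lborel)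
        = (\<integral>\<^sup>+x. ennreal (p (x / 2)) * indicator (?S n) x \<partial>lborel)"
      by (intro nn_integral_cong) (auto simp: indicator_def)
    finally show ?thesis by simp
  qed
  have rng: "0 < x \<and> x \<le> x0" if "x \<in> ?S n" for x n
  proof -
    have "x0 * (1/2) ^ n \<le> x0 * 1" using x0 by (intro mult_left_mono power_le_one) auto
    moreover have "0 < x0 * (1/2) ^ Suc n" using x0 by simp
    ultimately show ?thesis using that by auto
  qed
  have step1: "D (Suc n) \<le> ennreal (2 powr (- a')) * D n" for n
  proof -
    have "(\<integral>\<^sup>+x. ennreal (p (x / 2)) * indicator (?S n) x \<partial>lborel)
        \<le> (\<integral>\<^sup>+x. ennreal (2 powr (1 - a')) * (ennreal (p x) * indicator (?S n) x) \<partial>lborel)"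
    proof (intro nn_integral_mono)
      fix x
      have "ennreal (p (x / 2)) \<le> ennreal (2 powr (1 - a')) * ennreal (p x)" if "x \<in> ?S n"
      proof -
        have "ennreal (p (x / 2)) \<le> ennreal (2 powr (1 - a') * p x)" using rng[OF that] by (intro ennreal_leI up) auto
        then show ?thesis by (simp only: ennreal_mult[OF powr_ge_zero p0])
      qed
      then show "ennreal (p (x / 2)) * indicator (?S n) x
          \<le> ennreal (2 powr (1 - a')) * (ennreal (p x) * indicator (?S n) x)"
        by (cases "x \<in> ?S n") (simp_all del: atLeastAtMost_iff)
    qed
    also have "\<dots> = ennreal (2 powr (1 - a')) * D n" unfolding Dn by (rule nn_integral_cmult) measurable
    finally have "D (Suc n) \<le> ennreal (1/2) * (ennreal (2 powr (1 - a')) * D n)"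
      unfolding DS by (rule mult_left_mono) simp
    also have "\<dots> = ennreal (2 powr (- a')) * D n"
      by (simp add: mult.assoc[symmetric] ennreal_mult[symmetric] powr_diff powr_minus_divide del: ennreal_half)
    finally show ?thesis .
  qed
  have step2: "ennreal (2 powr (- a'')) * D n \<le> D (Suc n)" for n
  proof -
    have "ennreal (2 powr (1 - a'')) * D n = (\<integral>\<^sup>+x. ennreal (2 powr (1 - a'')) * (ennreal (p x) * indicator (?S n) x) \<partial>lborel)"
      unfolding Dn by (rule nn_integral_cmult[symmetric]) measurable
    also have "\<dots> \<le> (\<integral>\<^sup>+x. ennreal (p (x / 2)) * indicator (?S n) x \<partial>lborel)"
    proof (intro nn_integral_mono)
      fix x
      have "ennreal (2 powr (1 - a'')) * ennreal (p x) \<le> ennreal (p (x / 2))" if "x \<in> ?S n"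
      proof -
        have "ennreal (2 powr (1 - a'') * p x) \<le> ennreal (p (x / 2))" using rng[OF that] by (intro ennreal_leI lo) auto
        then show ?thesis by (simp only: ennreal_mult[OF powr_ge_zero p0])
      qed
      then show "ennreal (2 powr (1 - a'')) * (ennreal (p x) * indicator (?S n) x)
          \<le> ennreal (p (x / 2)) * indicator (?S n) x"
        by (cases "x \<in> ?S n") (simp_all del: atLeastAtMost_iff)
    qed
    finally have "ennreal (1/2) * (ennreal (2 powr (1 - a'')) * D n) \<le> D (Suc n)"
      unfolding DS by (rule mult_left_mono) simp
    then show ?thesis
      by (simp add: mult.assoc[symmetric] ennreal_mult[symmetric] powr_diff powr_minus_divide del: ennreal_half)
  qed
  have e: "ennreal (2 powr (- c)) * ennreal (2 powr (- c * real n)) = ennreal (2 powr (- c * real (Suc n)))" for c n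
    by (simp add: ennreal_mult[symmetric] powr_add[symmetric]) (simp add: algebra_simps)
  show "D n \<le> ennreal (2 powr (- a' * real n)) * D 0"
  proof (induction n)
    case (Suc n)
    have "D (Suc n) \<le> ennreal (2 powr (- a')) * (ennreal (2 powr (- a' * real n)) * D 0)"
      by (rule order_trans[OF step1 mult_left_mono[OF Suc]]) simp
    also have "\<dots> = ennreal (2 powr (- a' * real (Suc n))) * D 0"
      by (simp only: mult.assoc[symmetric] e)
    finally show ?case .
  qed simp
  show "ennreal (2 powr (- a'' * real n)) * D 0 \<le> D n"
  proof (induction n)
    case (Suc n)
    have "ennreal (2 powr (- a'' * real (Suc n))) * D 0 = ennreal (2 powr (- a'')) * (ennreal (2 powr (- a'' * real n)) * D 0)"
      by (simp only: mult.assoc[symmetric] e)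
    also have "\<dots> \<le> D (Suc n)"
      by (rule order_trans[OF mult_left_mono[OF Suc] step2]) simp
    finally show ?case .
  qed simp
qed

text \<open>Negative moments need the shell masses from above, summed over all shells; the lower
  bound on the mass near 0 needs just one shell inside \<open>(0, x)\<close>.\<close>

lemma (in supou_intensity)
  assumes dens: "\<pi> = density lborel (\<lambda>x. ennreal (p x))" 
    and pm[measurable]: "p \<in> borel_measurable borel" and p0: "\<And>x. 0 \<le> p x"
    and lim: "((\<lambda>x. p x / (\<alpha> * ell (1 / x) * x powr (\<alpha> - 1))) \<longlongrightarrow> 1) (at_right 0)"
    and "0 < \<alpha>" and sv: "slowly_varying ell"
  shows integrable_inverse_powr: "0 \<le> m \<Longrightarrow> m < \<alpha> \<Longrightarrow> integrable \<pi> (\<lambda>\<xi>. \<xi> powr (- m))"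
    and measure_near_zero_ge: "\<alpha> < a'' \<Longrightarrow> \<exists>c>0. \<exists>x0>0. \<forall>x. 0 < x \<and> x \<le> x0 \<longrightarrow> c * x powr a'' \<le> measure \<pi> {0<..<x}"
proof -
  show "integrable \<pi> (\<lambda>\<xi>. \<xi> powr (- m))" if m: "0 \<le> m" "m < \<alpha>"
  proof -
    define a' where "a' = (m + \<alpha>) / 2"
    have a': "m < a'" "a' < \<alpha>" using m by (auto simp: a'_def)
    \<comment> \<open>\<open>\<alpha> + 1\<close> merely completes an admissible pair of exponents;
      the estimate rests on the upper ratio bound with \<open>a'\<close>.\<close>
    obtain x0 where x0: "0 < x0" "\<And>x. 0 < x \<Longrightarrow> x \<le> x0 \<Longrightarrow> p (x / 2) \<le> 2 powr (1 - a') * p x"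
      "\<And>x. 0 < x \<Longrightarrow> x \<le> x0 \<Longrightarrow> 2 powr (1 - (\<alpha> + 1)) * p x \<le> p (x / 2)"
      by (rule regularly_varying_density_halving[OF lim \<open>0 < \<alpha>\<close> sv a'(2), of "\<alpha> + 1"]) (simp, blast)
    have "(\<integral>\<^sup>+x. ennreal (indicator {x. 0 < \<bar>x\<bar> \<and> \<bar>x\<bar> \<le> x0} x * \<bar>x\<bar> powr (- m)) \<partial>\<pi>) < \<infinity>"
    proof (rule nn_integral_small_powr_finite[OF sets_pi, of 1 _ a'])
      fix j :: nat
      let ?I = "{x0 * (1/2) ^ Suc j..x0 * (1/2) ^ j}"
      have "AE x in \<pi>. x \<in> {x. x0 * (1/2) ^ Suc j \<le> \<bar>x\<bar> \<and> \<bar>x\<bar> \<le> x0 * (1/2) ^ j} \<longrightarrow> x \<in> ?I"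
        using pi_pos by eventually_elim auto
      then have "emeasure \<pi> {x. x0 * (1/2) ^ Suc j \<le> \<bar>x\<bar> \<and> \<bar>x\<bar> \<le> x0 * (1/2) ^ j} \<le> emeasure \<pi> ?I"
        by (rule emeasure_mono_AE) (simp add: sets_pi)
      also have "\<dots> \<le> ennreal (2 powr (- a' * real j)) * emeasure \<pi> {x0 * (1/2) ^ Suc 0..x0 * (1/2) ^ 0}"
        using dyadic_density_shells(1)[of p x0 a' "\<alpha> + 1" j, OF pm p0 x0(1) x0(2) x0(3)] by (simp add: dens[symmetric])
      also have "\<dots> \<le> ennreal (2 powr (- a' * real j)) * 1"
        by (intro mult_left_mono emeasure_le_1) simp
      finally show "emeasure \<pi> {x. x0 * (1/2) ^ Suc j \<le> \<bar>x\<bar> \<and> \<bar>x\<bar> \<le> x0 * (1/2) ^ j} \<le> ennreal (1 * 2 powr (- a' * real j))"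
        by simp
    qed (use x0 a' in auto)
    then have "integrable \<pi> (\<lambda>x. indicator {x. 0 < \<bar>x\<bar> \<and> \<bar>x\<bar> \<le> x0} x * \<bar>x\<bar> powr (- m))"
      by (intro integrableI_bounded) auto
    then have "integrable \<pi> (\<lambda>x. indicator {x. 0 < \<bar>x\<bar> \<and> \<bar>x\<bar> \<le> x0} x * \<bar>x\<bar> powr (- m) + x0 powr (- m))" by simp
    then show ?thesis
    proof (rule Bochner_Integration.integrable_bound)
      show "AE x in \<pi>. norm (x powr (- m)) \<le> norm (indicator {x. 0 < \<bar>x\<bar> \<and> \<bar>x\<bar> \<le> x0} x * \<bar>x\<bar> powr (- m) + x0 powr (- m))"
        using pi_pos
      proof eventually_elim
        case (elim x)
        then show ?case using powr_mono2'[of "- m" x0 x] m x0(1) by (auto simp: indicator_def)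
      qed
    qed measurable
  qed
  show "\<exists>c>0. \<exists>x0>0. \<forall>x. 0 < x \<and> x \<le> x0 \<longrightarrow> c * x powr a'' \<le> measure \<pi> {0<..<x}" if a'': "\<alpha> < a''"
  proof -
    \<comment> \<open>Here the pair is \<open>0 < \<alpha> < a''\<close>, and the lower ratio bound
      with \<open>a''\<close> carries the estimate.\<close>
    obtain x0 where x0: "0 < x0" "\<And>x. 0 < x \<Longrightarrow> x \<le> x0 \<Longrightarrow> p (x / 2) \<le> 2 powr (1 - 0) * p x"
      "\<And>x. 0 < x \<Longrightarrow> x \<le> x0 \<Longrightarrow> 2 powr (1 - a'') * p x \<le> p (x / 2)"
      and ppos: "\<And>x. 0 < x \<Longrightarrow> x \<le> x0 \<Longrightarrow> 0 < p x"
      by (rule regularly_varying_density_halving[OF lim \<open>0 < \<alpha>\<close> sv \<open>0 < \<alpha>\<close> a'']) blast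
    define D0 where "D0 = measure \<pi> {x0 * (1/2) ^ Suc 0..x0 * (1/2) ^ 0}"
    have D0: "0 < D0"
    proof (rule ccontr)
      assume "\<not> 0 < D0"
      then have "D0 = 0" unfolding D0_def using measure_nonneg[of \<pi> "{x0 * (1/2) ^ Suc 0..x0 * (1/2) ^ 0}"] by linarith
      then have "emeasure \<pi> {x0 / 2..x0} = 0" by (simp add: emeasure_eq_measure D0_def)
      then have "(\<integral>\<^sup>+x. ennreal (p x) * indicator {x0 / 2..x0} x \<partial>lborel) = 0"
        unfolding dens by (subst (asm) emeasure_density) auto
      then have "AE x in lborel. ennreal (p x) * indicator {x0 / 2..x0} x = 0"
        by (subst (asm) nn_integral_0_iff_AE) auto
      then have "AE x in lborel. x \<notin> {x0 / 2..x0}"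
      proof eventually_elim
        case (elim x)
        then show ?case using ppos[of x] x0(1) by (auto simp: indicator_def split: if_splits)
      qed
      then have "emeasure lborel {x0 / 2..x0} = 0"
        by (subst (asm) AE_iff_measurable[where N = "{x0 / 2..x0}"]) auto
      then show False using x0(1) by simp
    qed
    \<comment> \<open>Below, \<open>k\<close> satisfies
      \<open>x0 2^(- k) \<le> x < 2 x0 2^(- k)\<close>. Shell \<open>k\<close> may touch
      \<open>x\<close>, so shell \<open>k + 1\<close> is used; the factor 4 comes from
      \<open>x / (4 x0) < 2^(- (k + 1))\<close>.\<close>
    define c where "c = D0 * (4 * x0) powr (- a'')"
    have "c * x powr a'' \<le> measure \<pi> {0<..<x}" if x: "0 < x" "x \<le> x0" for x
    proof -
      obtain k where "(1/2) ^ k * (x0 / x) \<in> {1/2<..1}"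
        using dyadic_reduce[of "x0 / x"] x by auto
      then have k: "x0 * (1/2) ^ k \<le> x" "x / 2 < x0 * (1/2) ^ k" using x by (auto simp: field_simps)
      have "ennreal (2 powr (- a'' * real (Suc k)) * D0) = ennreal (2 powr (- a'' * real (Suc k))) * emeasure \<pi> {x0 * (1/2) ^ Suc 0..x0 * (1/2) ^ 0}"
        by (simp add: D0_def emeasure_eq_measure ennreal_mult)
      also have "\<dots> \<le> emeasure \<pi> {x0 * (1/2) ^ Suc (Suc k)..x0 * (1/2) ^ Suc k}"
        using dyadic_density_shells(2)[of p x0 0 a'' "Suc k", OF pm p0 x0(1) x0(2) x0(3)] by (simp add: dens[symmetric])
      also have "\<dots> \<le> emeasure \<pi> {0<..<x}"
      proof (rule emeasure_mono)
        have "0 < x0 * (1/2) ^ Suc (Suc k)" "x0 * (1/2) ^ Suc k < x" using k x x0(1) by auto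
        then show "{x0 * (1/2) ^ Suc (Suc k)..x0 * (1/2) ^ Suc k} \<subseteq> {0<..<x}" by auto
      qed (simp add: sets_pi)
      finally have 1: "2 powr (- a'' * real (Suc k)) * D0 \<le> measure \<pi> {0<..<x}"
        by (simp add: emeasure_eq_measure)
      have "x powr a'' * (4 * x0) powr (- a'') = (x / (4 * x0)) powr a''"
        using x x0(1) by (simp add: powr_divide powr_minus_divide)
      also have "\<dots> \<le> ((1/2) ^ Suc k) powr a''"
        using k x x0(1) a'' \<open>0 < \<alpha>\<close> by (intro powr_mono2) (auto simp: field_simps)
      also have "\<dots> = 2 powr (- a'' * real (Suc k))"
        by (simp add: powr_realpow[symmetric] powr_powr powr_divide powr_minus_divide mult.commute del: power_Suc of_nat_Suc)
      finally have "D0 * (x powr a'' * (4 * x0) powr (- a'')) \<le> D0 * 2 powr (- a'' * real (Suc k))"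
        using D0 by (intro mult_left_mono) auto
      then show ?thesis using 1 by (simp add: c_def mult_ac)
    qed
    moreover have "0 < c" using D0 x0(1) by (simp add: c_def)
    ultimately show ?thesis using x0(1) by blast
  qed
qed

section \<open>SupOU processes\<close>

lemma one_minus_exp_neg_ge_min: "min u 1 / 2 \<le> 1 - exp (- u)" if "0 \<le> u" for u :: real
proof (cases "u \<le> 1")
  case True
  then show ?thesis using one_minus_exp_neg_ge[OF that] by simp
next
  case False
  then have "exp (- u) \<le> exp (- 1)" by simp
  moreover have "1 / 2 \<le> 1 - exp (- 1 :: real)" using one_minus_exp_neg_ge[of 1] by simp
  moreover have "min u 1 = 1" using False by simp
  ultimately show ?thesis by linarith
qed

text \<open>Values up to \<eta> cost \<eta>; above it the dyadic levels are summed, and the sums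
  converge as both exponents exceed 1. \<open>D\<close> is kept as a separate factor because it is
  the quantity that tends to 0 for fixed \<eta> when \<open>Z\<close> is an increment of
  \<open>Y\<close>.\<close>

lemma (in prob_space) nn_integral_abs_le_of_tail:
  assumes Z[measurable]: "Z \<in> borel_measurable M"
    and tail: "\<And>x. 0 < x \<Longrightarrow> prob {\<omega>\<in>space M. x \<le> \<bar>Z \<omega>\<bar>} \<le> D * (A * x powr (- q) + B * x powr (- q'))"
    and "0 \<le> A" "0 \<le> B" "1 < q" "1 < q'" "0 \<le> D" "0 < \<eta>"
  shows "(\<integral>\<^sup>+\<omega>. ennreal \<bar>Z \<omega>\<bar> \<partial>M) \<le>
    ennreal (\<eta> + D * (2 * A * \<eta> powr (1 - q) * (1 / (1 - 2 powr (1 - q))) + 2 * B * \<eta> powr (1 - q') * (1 / (1 - 2 powr (1 - q')))))"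
proof -
  let ?T = "\<lambda>j. D * (2 * A * \<eta> powr (1 - q) * (2 powr (1 - q)) ^ j + 2 * B * \<eta> powr (1 - q') * (2 powr (1 - q')) ^ j)" and ?C = "D * (2 * A * \<eta> powr (1 - q) * (1 / (1 - 2 powr (1 - q))) + 2 * B * \<eta> powr (1 - q') * (1 / (1 - 2 powr (1 - q'))))"
  define S where "S j = {\<omega>\<in>space M. \<eta> * 2 ^ j \<le> \<bar>Z \<omega>\<bar>}" for j :: nat
  have [measurable]: "S j \<in> sets M" for j unfolding S_def by measurable
  have pt: "ennreal \<bar>Z \<omega>\<bar> \<le> ennreal \<eta> + (\<Sum>j. ennreal (\<eta> * 2 ^ Suc j) * indicator (S j) \<omega>)" if \<omega>: "\<omega> \<in> space M" for \<omega>
  proof (cases "\<bar>Z \<omega>\<bar> \<le> \<eta>")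
    case True
    then show ?thesis by (intro add_increasing2) (auto intro: ennreal_leI)
  next
    case False
    then have "1 \<le> \<bar>Z \<omega>\<bar> / \<eta>" using \<open>0 < \<eta>\<close> by simp
    then obtain k where k: "(1/2) ^ k * (\<bar>Z \<omega>\<bar> / \<eta>) \<in> {1/2<..1}" using dyadic_reduce by blast
    then have k': "\<bar>Z \<omega>\<bar> \<le> \<eta> * 2 ^ k" "\<eta> * 2 ^ k \<le> 2 * \<bar>Z \<omega>\<bar>"
      using \<open>0 < \<eta>\<close> by (auto simp: field_simps)
    then obtain j where j: "k = Suc j" using False by (cases k) auto
    have "\<omega> \<in> S j" using k'(2) \<omega> by (simp add: S_def j)
    then have "ennreal \<bar>Z \<omega>\<bar> \<le> ennreal (\<eta> * 2 ^ Suc j) * indicator (S j) \<omega>"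
      using k'(1) j by (auto intro!: ennreal_leI)
    also have "\<dots> \<le> (\<Sum>j. ennreal (\<eta> * 2 ^ Suc j) * indicator (S j) \<omega>)" by (rule ennreal_le_suminf)
    finally show ?thesis by (intro add_increasing) auto
  qed
  have "(\<integral>\<^sup>+\<omega>. ennreal \<bar>Z \<omega>\<bar> \<partial>M) \<le> (\<integral>\<^sup>+\<omega>. ennreal \<eta> + (\<Sum>j. ennreal (\<eta> * 2 ^ Suc j) * indicator (S j) \<omega>) \<partial>M)"
    by (intro nn_integral_mono pt)
  also have "\<dots> = ennreal \<eta> + (\<Sum>j. ennreal (\<eta> * 2 ^ Suc j) * emeasure M (S j))"
    by (subst nn_integral_add) (auto simp: nn_integral_suminf nn_integral_cmult_indicator emeasure_space_1)
  also have "\<dots> \<le> ennreal \<eta> + (\<Sum>j. ennreal (?T j))"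
  proof (intro add_left_mono suminf_le allI)
    fix j :: nat
    have p: "\<eta> * 2 ^ Suc j * (\<eta> * 2 ^ j) powr (- r) = 2 * \<eta> powr (1 - r) * (2 powr (1 - r)) ^ j" for r :: real
    proof -
      have "\<eta> * 2 ^ Suc j * (\<eta> * 2 ^ j) powr (- r) = 2 * ((\<eta> * 2 ^ j) powr 1 * (\<eta> * 2 ^ j) powr (- r))"
        using \<open>0 < \<eta>\<close> by simp
      also have "\<dots> = 2 * (\<eta> * 2 ^ j) powr (1 - r)" by (simp only: powr_add[symmetric]) simp
      also have "\<dots> = 2 * \<eta> powr (1 - r) * (2 powr (1 - r)) ^ j"
        using \<open>0 < \<eta>\<close> by (simp add: powr_mult powr_realpow[symmetric] powr_powr mult.commute)
      finally show ?thesis .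
    qed
    have "\<eta> * 2 ^ Suc j * prob (S j) \<le> \<eta> * 2 ^ Suc j * (D * (A * (\<eta> * 2 ^ j) powr (- q) + B * (\<eta> * 2 ^ j) powr (- q')))"
      unfolding S_def using \<open>0 < \<eta>\<close> by (intro mult_left_mono tail) auto
    also have "\<dots> = D * (A * (\<eta> * 2 ^ Suc j * (\<eta> * 2 ^ j) powr (- q)) + B * (\<eta> * 2 ^ Suc j * (\<eta> * 2 ^ j) powr (- q')))"
      by (simp only: distrib_left mult_ac)
    also have "\<dots> = ?T j"
      unfolding p by (simp only: mult_ac)
    finally have *: "\<eta> * 2 ^ Suc j * prob (S j) \<le> ?T j" .
    have "ennreal (\<eta> * 2 ^ Suc j) * emeasure M (S j) = ennreal (\<eta> * 2 ^ Suc j * prob (S j))"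
      using \<open>0 < \<eta>\<close> by (simp only: emeasure_eq_measure) (rule ennreal_mult[symmetric], auto)
    also have "\<dots> \<le> ennreal (?T j)"
      by (rule ennreal_leI[OF *])
    finally show "ennreal (\<eta> * 2 ^ Suc j) * emeasure M (S j) \<le> ennreal (?T j)" .
  qed auto
  also have "(\<Sum>j. ennreal (?T j))
      = ennreal ?C"
  proof (rule suminf_ennreal_eq)
    have "norm (2 powr (1 - r)) < 1" if "1 < r" for r :: real using that by (simp add: powr_less_one)
    then show "(\<lambda>j. ?T j)
      sums ?C"
      using assms by (intro sums_mult sums_add geometric_sums) auto
  qed (use assms in auto)
  also have "ennreal \<eta> + ennreal ?C
      = ennreal (\<eta> + ?C)"
  proof (rule ennreal_plus[symmetric])
    have "0 \<le> 1 - 2 powr (1 - r)" if "1 < r" for r :: real using that powr_mono[of "1 - r" 0 "2::real"] by simp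
    then show "0 \<le> ?C"
      using assms by (intro mult_nonneg_nonneg add_nonneg_nonneg divide_nonneg_nonneg) auto
  qed (use assms in auto)
  finally show ?thesis .
qed

lemma (in prob_space) expectation_one_minus_cos_eq:
  assumes [measurable]: "Z \<in> borel_measurable M"
  shows "integrable M (\<lambda>\<omega>. 1 - cos (\<zeta> * Z \<omega>))" "expectation (\<lambda>\<omega>. 1 - cos (\<zeta> * Z \<omega>)) = 1 - Re (chf M Z \<zeta>)"
proof -
  have i: "integrable M (\<lambda>\<omega>. cis (\<zeta> * Z \<omega>))" by (rule integrable_const_bound[where B = 1]) auto
  have c: "integrable M (\<lambda>\<omega>. cos (\<zeta> * Z \<omega>))" using integrable_Re[OF i] by simp
  then show "integrable M (\<lambda>\<omega>. 1 - cos (\<zeta> * Z \<omega>))" by simp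
  have "Re (chf M Z \<zeta>) = expectation (\<lambda>\<omega>. cos (\<zeta> * Z \<omega>))" using integral_Re[OF i] by simp
  then show "expectation (\<lambda>\<omega>. 1 - cos (\<zeta> * Z \<omega>)) = 1 - Re (chf M Z \<zeta>)" using c by (simp add: prob_space)
qed

lemma (in prob_space) expectation_one_minus_cos_le:
  assumes [measurable]: "Z \<in> borel_measurable M"
  shows "expectation (\<lambda>\<omega>. 1 - cos (\<zeta> * Z \<omega>)) \<le> norm (1 - chf M Z \<zeta>)"
    and "1 - norm (chf M Z \<zeta>) \<le> expectation (\<lambda>\<omega>. 1 - cos (\<zeta> * Z \<omega>))"
  using complex_Re_le_cmod[of "1 - chf M Z \<zeta>"] complex_Re_le_cmod[of "chf M Z \<zeta>"]
  by (simp_all add: expectation_one_minus_cos_eq(2))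

text \<open>The asymptotic hypotheses on \<open>Y 1\<close>, on small jumps and on \<pi> enter
  through their consequences: moments of \<open>Y 1\<close>, moments of the small jumps, some jump
  mass away from 0, and negative moments of \<pi>. The lower bound on \<pi> near 0 is supplied only
  where the window probability is bounded from below.\<close>

locale supou_process =
  levy_random_measure M \<Lambda> "\<pi> \<Otimes>\<^sub>M lborel" "levy_cumulant a 0 \<mu>" + pi: supou_intensity \<pi> + jumps: levy_jump_measure \<mu>
  for M :: "'w measure" and \<Lambda> and \<pi> :: "real measure" and a :: real and \<mu> :: "real measure" +
  fixes Y X :: "real \<Rightarrow> 'w \<Rightarrow> real" and \<alpha> \<beta> \<gamma> :: real
  assumes Y: "\<And>t. levy_integral_of M \<Lambda> (\<pi> \<Otimes>\<^sub>M lborel) (supou_kernel t) (Y t)"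
    and Y_joint [measurable]: "(\<lambda>(s, \<omega>). Y s \<omega>) \<in> borel_measurable (lborel \<Otimes>\<^sub>M M)"
    and Y_loc_int: "AE \<omega> in M. \<forall>t\<ge>0. set_integrable lborel {0..t} (\<lambda>s. Y s \<omega>)"
    and X: "\<And>t \<omega>. 0 \<le> t \<Longrightarrow> \<omega> \<in> space M \<Longrightarrow> X t \<omega> = (LBINT s:{0..t}. Y s \<omega>)"
    and gamma: "1 < \<gamma>" "\<gamma> < 2"
    and Y_moment: "\<And>r. 0 \<le> r \<Longrightarrow> r < \<gamma> \<Longrightarrow> integrable M (\<lambda>\<omega>. \<bar>Y 1 \<omega>\<bar> powr r)"
    and Y_mean: "integrable M (Y 1) \<Longrightarrow> integral\<^sup>L M (Y 1) = 0"
    and beta: "0 \<le> \<beta>" "\<beta> < 2"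
    and small_jumps: "\<And>r. \<beta> < r \<Longrightarrow> integrable \<mu> (\<lambda>x. indicator {x. 0 < \<bar>x\<bar> \<and> \<bar>x\<bar> \<le> 1} x * \<bar>x\<bar> powr r)"
    and jumps_nontrivial: "\<exists>y>0. 0 < measure \<mu> {x. y \<le> \<bar>x\<bar>}"
    and alpha: "0 < \<alpha>"
    and pi_moment: "\<And>m. 0 \<le> m \<Longrightarrow> m < \<alpha> \<Longrightarrow> integrable \<pi> (\<lambda>\<xi>. \<xi> powr (- m))"
begin

section \<open>From the law of \<open>Y 1\<close> to the jump measure\<close>

lemma Y_measurable [measurable]: "Y t \<in> borel_measurable M"
  using Y by (simp add: levy_integral_of_def)

lemma step_limit_lincomb_Y:
  fixes J :: "nat set"
  assumes "finite J"
  shows "step_limit (\<lambda>x. \<Sum>j\<in>J. c j * supou_kernel (u j) x) (\<lambda>x. \<Sum>j\<in>J. \<bar>c j\<bar> * supou_kernel (u j) x) (\<lambda>\<omega>. \<Sum>j\<in>J. c j * Y (u j) \<omega>)"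
  using assms by (intro step_limit_lincomb Y pi.supou_kernel_superlevel) (auto simp: pi.supou_kernel_bounds)

lemma step_limit_Y: "step_limit (supou_kernel t) (supou_kernel t) (Y t)"
  using step_limit_lincomb_Y[of "{0}" "\<lambda>_. 1" "\<lambda>_. t"] by simp

text \<open>The vanishing mean permits subtracting the linear term, so a moment of order
  \<open>r\<close> above 1 improves the behaviour at frequency 0 beyond linear.\<close>

lemma one_minus_chf_Y:
  assumes r: "1 \<le> r" "r < \<gamma>"
  shows "norm (1 - chf M (Y 1) \<zeta>) \<le> 2 * expectation (\<lambda>\<omega>. \<bar>Y 1 \<omega>\<bar> powr r) * \<bar>\<zeta>\<bar> powr r"
proof -
  have mom: "integrable M (\<lambda>\<omega>. \<bar>Y 1 \<omega>\<bar> powr r)" using Y_moment r by simp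
  have "integrable M (\<lambda>\<omega>. \<bar>Y 1 \<omega>\<bar> powr 1)" using gamma by (intro Y_moment) auto
  then have iY: "integrable M (Y 1)" by (simp add: integrable_iff_bounded)
  then have mean: "integral\<^sup>L M (Y 1) = 0" by (rule Y_mean)
  have i: "integrable M (\<lambda>\<omega>. cis (\<zeta> * Y 1 \<omega>))" by (rule integrable_const_bound[where B = 1]) auto
  have iY': "integrable M (\<lambda>\<omega>. \<i> * complex_of_real (\<zeta> * Y 1 \<omega>))"
    using iY by (intro integrable_mult_right integrable_of_real)
  have "(\<integral>\<omega>. \<i> * complex_of_real (\<zeta> * Y 1 \<omega>) \<partial>M) = 0"
    by (simp only: integral_mult_right_zero integral_complex_of_real mean) simp
  then have "chf M (Y 1) \<zeta> - 1 = (\<integral>\<omega>. cis (\<zeta> * Y 1 \<omega>) - 1 - \<i> * complex_of_real (\<zeta> * Y 1 \<omega>) \<partial>M)"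
    using i iY' by (subst Bochner_Integration.integral_diff) (auto simp: prob_space)
  also have "norm \<dots> \<le> (\<integral>\<omega>. norm (cis (\<zeta> * Y 1 \<omega>) - 1 - \<i> * complex_of_real (\<zeta> * Y 1 \<omega>)) \<partial>M)"
    by (rule integral_norm_bound)
  also have "\<dots> \<le> (\<integral>\<omega>. 2 * \<bar>\<zeta>\<bar> powr r * \<bar>Y 1 \<omega>\<bar> powr r \<partial>M)"
  proof (rule integral_mono)
    show "norm (cis (\<zeta> * Y 1 \<omega>) - 1 - \<i> * complex_of_real (\<zeta> * Y 1 \<omega>)) \<le> 2 * \<bar>\<zeta>\<bar> powr r * \<bar>Y 1 \<omega>\<bar> powr r" for \<omega>
      using cis_taylor_le_powr[of r "\<zeta> * Y 1 \<omega>"] r gamma by (simp add: abs_mult powr_mult)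
  qed (use mom i iY' in \<open>auto intro!: integrable_norm Bochner_Integration.integrable_diff simp del: of_real_mult\<close>)
  finally show ?thesis by (simp add: norm_minus_commute mult_ac)
qed

text \<open>\<open>1 - |chf|\<close> of \<open>Y 1\<close> is squeezed at the frequency matching the
  shell. From above it is bounded by the moment of order \<open>q\<close>; from below, jumps in the
  shell make the real part of the exponent negative wherever the kernel exceeds
  \<open>1 / 2\<close>, in proportion to the mass of the shell.\<close>

lemma jump_shell_bound:
  assumes q: "1 \<le> q" "q < \<gamma>"
  shows "\<exists>C\<ge>0. \<forall>j::nat. emeasure \<mu> {x. 2^j < \<bar>x\<bar> \<and> \<bar>x\<bar> \<le> 2^Suc j} \<le> ennreal (C * 2 powr (- q * real j))"
proof -
  let ?J = "\<lambda>j::nat. {x::real. 2^j < \<bar>x\<bar> \<and> \<bar>x\<bar> \<le> 2^Suc j}"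
  define K where "K = 2 * expectation (\<lambda>\<omega>. \<bar>Y 1 \<omega>\<bar> powr q)"
  have K: "0 \<le> K" by (simp add: K_def Bochner_Integration.integral_nonneg)
  define N where "N j = measure \<mu> (?J j)" for j :: nat
  define B where "B = measure \<mu> {x. 1 \<le> \<bar>x\<bar>}"
  have S1: "{x. 1 \<le> \<bar>x\<bar>} \<in> sets \<mu>"
  proof -
    have "{x\<in>space \<mu>. 1 \<le> \<bar>x\<bar>} \<in> sets \<mu>" by measurable
    then show ?thesis by simp
  qed
  have sub: "?J j \<subseteq> {x::real. 1 \<le> \<bar>x\<bar>}" for j
  proof -
    have "(1::real) \<le> 2 ^ j" by simp
    then show ?thesis by (auto intro: order_trans less_imp_le simp del: one_le_power)
  qed
  have fin1: "emeasure \<mu> {x. 1 \<le> \<bar>x\<bar>} < \<infinity>" by (rule jumps.emeasure_mu_away) simp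
  have NB: "N j \<le> B" for j
    unfolding N_def B_def using S1 fin1 sub by (intro measure_mono_fmeasurable fmeasurableI) (auto simp: jumps.sets_mu)
  have emN: "emeasure \<mu> (?J j) = ennreal (N j)" for j
    unfolding N_def using le_less_trans[OF emeasure_mono[OF sub S1] fin1]
    by (simp add: emeasure_eq_ennreal_measure less_top[symmetric])
  \<comment> \<open>All shells have mass at most \<open>B\<close>, so this factor converts a bound
    on \<open>min (N j / 256) 1\<close> into one on \<open>N j / 256\<close>.\<close>
  define U where "U = max 1 (B / 256)"
  \<comment> \<open>For each \<xi>, the \<open>s\<close> within distance \<open>1 / 2\<close> below
    \<xi> satisfy \<open>exp (s - \<xi>) > 1 / 2\<close>, by \<open>1 + u \<le> exp u\<close>. The
    level set thus has measure at least \<open>1 / 2\<close>; \<open>1 / 4\<close> leaves the strict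
    inequality needed for the limit.\<close>
  have level: "ennreal (1/4) < emeasure (\<pi> \<Otimes>\<^sub>M lborel) {x. \<zeta> * supou_kernel 1 x \<in> {\<zeta> / 2<..<\<zeta>}}" if \<zeta>: "0 < \<zeta>" for \<zeta>
  proof -
    let ?E = "{x. \<zeta> * supou_kernel 1 x \<in> {\<zeta> / 2<..<\<zeta>}}"
    have [measurable]: "?E \<in> sets (\<pi> \<Otimes>\<^sub>M lborel)"
    proof -
      have "{x\<in>space (\<pi> \<Otimes>\<^sub>M lborel). \<zeta> * supou_kernel 1 x \<in> {\<zeta> / 2<..<\<zeta>}} \<in> sets (\<pi> \<Otimes>\<^sub>M lborel)" by measurable
      then show ?thesis by simp
    qed
    have "ennreal (1/2) = (\<integral>\<^sup>+\<xi>. ennreal (1/2) \<partial>\<pi>)" by (simp add: pi.emeasure_space_1[simplified])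
    also have "\<dots> \<le> (\<integral>\<^sup>+\<xi>. (\<integral>\<^sup>+s. indicator ?E (\<xi>, s) \<partial>lborel) \<partial>\<pi>)"
    proof (rule nn_integral_mono_AE, use pi.pi_pos in eventually_elim)
      fix \<xi> :: real assume \<xi>: "0 < \<xi>"
      have "ennreal (1/2) = (\<integral>\<^sup>+s. indicator {\<xi> - 1/2<..<\<xi>} s \<partial>lborel)" by simp
      also have "\<dots> \<le> (\<integral>\<^sup>+s. indicator ?E (\<xi>, s) \<partial>lborel)"
      proof (rule nn_integral_mono)
        fix s
        have "(\<xi>, s) \<in> ?E" if s: "s \<in> {\<xi> - 1/2<..<\<xi>}"
        proof -
          have "1 + (s - \<xi>) \<le> exp (s - \<xi>)" by simp
          moreover have "exp (s - \<xi>) < 1" using s by simp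
          ultimately have "1/2 < exp (s - \<xi>)" "exp (s - \<xi>) < 1" using s by (simp_all, linarith)
          then have "\<zeta> * (1/2) < \<zeta> * exp (s - \<xi>)" "\<zeta> * exp (s - \<xi>) < \<zeta> * 1"
            using \<zeta> by (simp_all only: mult_less_cancel_left_pos)
          then have "\<zeta> / 2 < \<zeta> * exp (s - \<xi>)" "\<zeta> * exp (s - \<xi>) < \<zeta>" by linarith+
          moreover have "supou_kernel 1 (\<xi>, s) = exp (s - \<xi>)" using s \<xi> by (simp add: pi.supou_kernel_pos)
          ultimately show ?thesis by (simp only: mem_Collect_eq greaterThanLessThan_iff simp_thms)
        qed
        then show "indicator {\<xi> - 1/2<..<\<xi>} s \<le> (indicator ?E (\<xi>, s) :: ennreal)"
          by (auto simp: indicator_def)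
      qed
      finally show "ennreal (1/2) \<le> (\<integral>\<^sup>+s. indicator ?E (\<xi>, s) \<partial>lborel)" .
    qed
    also have "\<dots> = (\<integral>\<^sup>+x. indicator ?E x \<partial>(\<pi> \<Otimes>\<^sub>M lborel))"
      by (rule pi.nn_integral_intensity[symmetric]) measurable
    also have "\<dots> = emeasure (\<pi> \<Otimes>\<^sub>M lborel) ?E" by (rule nn_integral_indicator) measurable
    finally have *: "ennreal (1/2) \<le> emeasure (\<pi> \<Otimes>\<^sub>M lborel) ?E" .
    have "ennreal (1/4) < ennreal (1/2)" by (rule ennreal_lessI) auto
    then show ?thesis using * by (rule less_le_trans)
  qed
  have "N j \<le> 512 * U * K * 2 powr (- q * real j)" for j
  proof -
    define \<zeta> where "\<zeta> = (1/2::real) ^ Suc j"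
    have \<zeta>: "0 < \<zeta>" by (simp add: \<zeta>_def)
    have "norm (chf M (Y 1) \<zeta>) \<le> exp (- (N j / 64) * (1/4))"
    proof (rule step_limit_norm_chf_le[OF step_limit_Y jumps.Re_levy_cumulant_nonpos, of "\<zeta> / 2" \<zeta>])
      fix z assume z: "z \<in> {\<zeta> / 2<..<\<zeta>}"
      \<comment> \<open>A jump from the shell times \<open>z\<close> has modulus between
        \<open>1 / 4\<close> and 1. This gives \<open>(1 / 4)^2 / 4 = 1 / 64\<close>, and the level
        set of measure above \<open>1 / 4\<close> gives \<open>1 / 256\<close>; the final 512
        includes the 2 lost in \<open>min u 1 / 2\<close>.\<close>
      have e: "2 ^ j * \<zeta> = 1/2" "2 ^ Suc j * \<zeta> = 1" by (simp_all add: \<zeta>_def power_divide)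
      have "2 ^ j * (\<zeta> / 2) \<le> 2 ^ j * z" "2 ^ Suc j * z \<le> 2 ^ Suc j * \<zeta>" using z by (auto intro!: mult_left_mono)
      then have "Re (levy_cumulant a 0 \<mu> z) \<le> - ((1/4)\<^sup>2 / 4 * measure \<mu> (?J j))"
        using e z \<zeta> by (intro jumps.Re_levy_cumulant_le) auto
      then show "Re (levy_cumulant a 0 \<mu> z) \<le> - (N j / 64)" by (simp add: N_def power2_eq_square)
    qed (use \<zeta> level[OF \<zeta>] in \<open>auto simp: N_def\<close>)
    then have "1 - exp (- (N j / 256)) \<le> 1 - norm (chf M (Y 1) \<zeta>)" by simp
    also have "\<dots> \<le> norm (1 - chf M (Y 1) \<zeta>)" using norm_triangle_ineq2[of 1 "chf M (Y 1) \<zeta>"] by simp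
    also have "\<dots> \<le> K * \<bar>\<zeta>\<bar> powr q" unfolding K_def by (rule one_minus_chf_Y[OF q])
    finally have "min (N j / 256) 1 / 2 \<le> K * \<zeta> powr q"
      using one_minus_exp_neg_ge_min[of "N j / 256"] \<zeta> by (simp add: N_def)
    moreover have "N j / 256 \<le> U * min (N j / 256) 1"
    proof (cases "N j / 256 \<le> 1")
      case True
      have "1 * (N j / 256) \<le> U * (N j / 256)" by (intro mult_right_mono) (auto simp: U_def N_def)
      then show ?thesis using True by simp
    next
      case False
      then show ?thesis using NB[of j] by (simp add: U_def)
    qed
    moreover have "U * min (N j / 256) 1 \<le> U * (2 * (K * \<zeta> powr q))"
      using calculation(1) by (intro mult_left_mono) (auto simp: U_def)
    moreover have "\<zeta> powr q \<le> 2 powr (- q * real j)"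
    proof -
      have "\<zeta> powr q \<le> ((1/2) ^ j) powr q" using q by (intro powr_mono2) (auto simp: \<zeta>_def)
      also have "\<dots> = 2 powr (- q * real j)"
        by (simp add: powr_realpow[symmetric] powr_powr powr_divide powr_minus_divide mult.commute)
      finally show ?thesis .
    qed
    then have "U * (2 * (K * \<zeta> powr q)) \<le> U * (2 * (K * 2 powr (- q * real j)))"
      using K by (intro mult_left_mono) (auto simp: U_def)
    ultimately have "N j / 256 \<le> U * (2 * (K * 2 powr (- q * real j)))" by linarith
    then show ?thesis by simp
  qed
  then have "\<forall>j. emeasure \<mu> (?J j) \<le> ennreal (512 * U * K * 2 powr (- q * real j))"
    unfolding emN by (intro allI ennreal_leI)
  moreover have "0 \<le> 512 * U * K" using K by (simp add: U_def)
  ultimately show ?thesis by blast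
qed

lemma large_jumps:
  assumes "1 \<le> r" "r < \<gamma>"
  shows "integrable \<mu> (\<lambda>x. indicator {x. 1 < \<bar>x\<bar>} x * \<bar>x\<bar> powr r)"
proof -
  define q where "q = (r + \<gamma>) / 2"
  have q: "1 \<le> q" "q < \<gamma>" "r < q" using assms by (auto simp: q_def)
  obtain C where "0 \<le> C" "\<And>j::nat. emeasure \<mu> {x. 2^j < \<bar>x\<bar> \<and> \<bar>x\<bar> \<le> 2^Suc j} \<le> ennreal (C * 2 powr (- q * real j))"
    using jump_shell_bound[OF q(1,2)] by blast
  then show ?thesis
    using assms q by (intro integrable_large_powr[OF jumps.sets_mu, of C r q]) auto
qed

text \<open>The centring of \<open>Y 1\<close> makes \<open>1 - chf\<close> of order
  \<open>|\<zeta>|\<close> to a power above 1, so the exponent admits no linear term; as the kernel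
  has integral 1, that term is the drift itself.\<close>

lemma drift_zero: "a + (\<integral>x. x * indicator {x. 1 < \<bar>x\<bar>} x \<partial>\<mu>) = 0"
proof -
  define q where "q = (1 + \<gamma>) / 2"
  have q: "1 < q" "q < \<gamma>" "q \<le> 2" using gamma by (auto simp: q_def)
  have two: "1 \<le> (2::real)" "(2::real) \<le> 2" by simp_all
  note D = jumps.levy_cumulant_decomp[OF less_imp_le[OF q(1)] q(3) two large_jumps[OF less_imp_le[OF q(1)] q(2)] small_jumps[OF beta(2)]]
  have "0 \<le> (\<integral>x. indicator {x. 1 < \<bar>x\<bar>} x * \<bar>x\<bar> powr q \<partial>\<mu>)"
    "0 \<le> (\<integral>x. indicator {x. 0 < \<bar>x\<bar> \<and> \<bar>x\<bar> \<le> 1} x * \<bar>x\<bar> powr 2 \<partial>\<mu>)"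
    "0 \<le> expectation (\<lambda>\<omega>. \<bar>Y 1 \<omega>\<bar> powr q)"
    by (auto intro!: Bochner_Integration.integral_nonneg)
  then show ?thesis
    by (intro step_limit_drift_zero[OF step_limit_Y pi.integrable_supou_kernel pi.integral_supou_kernel pi.supou_kernel_bounds
          D(1) D(2) _ _ _ _ _ one_minus_chf_Y])
      (use q in auto)
qed

lemma cumulant_bound:
  assumes q: "1 < q" "q < \<gamma>" and q': "1 \<le> q'" "q' \<le> 2" "\<beta> < q'"
  shows "\<exists>A B. 0 \<le> A \<and> 0 \<le> B \<and> (\<forall>z. norm (levy_cumulant a 0 \<mu> z) \<le> A * \<bar>z\<bar> powr q + B * \<bar>z\<bar> powr q')"
proof -
  have q2: "1 \<le> q" "q \<le> 2" using q gamma by auto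
  note D = jumps.levy_cumulant_decomp[OF q2 q'(1,2) large_jumps[OF q2(1) q(2)] small_jumps[OF q'(3)]]
  have "0 \<le> (\<integral>x. indicator {x. 1 < \<bar>x\<bar>} x * \<bar>x\<bar> powr q \<partial>\<mu>)"
    "0 \<le> (\<integral>x. indicator {x. 0 < \<bar>x\<bar> \<and> \<bar>x\<bar> \<le> 1} x * \<bar>x\<bar> powr q' \<partial>\<mu>)"
    by (auto intro!: Bochner_Integration.integral_nonneg)
  then show ?thesis
    using D(2) D(1)[where a = a, unfolded drift_zero]
    by (intro exI[where P = "\<lambda>A. \<exists>B. 0 \<le> A \<and> 0 \<le> B \<and> (\<forall>z. norm (levy_cumulant a 0 \<mu> z) \<le> A * \<bar>z\<bar> powr q + B * \<bar>z\<bar> powr q')"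
        and x = "2 * (\<integral>x. indicator {x. 1 < \<bar>x\<bar>} x * \<bar>x\<bar> powr q \<partial>\<mu>)"]
      exI[where x = "2 * (\<integral>x. indicator {x. 0 < \<bar>x\<bar> \<and> \<bar>x\<bar> \<le> 1} x * \<bar>x\<bar> powr q' \<partial>\<mu>)"]) simp
qed

section \<open>Continuity in mean of the stationary process\<close>

definition increment_modulus :: "real \<Rightarrow> real" where
  "increment_modulus \<delta> = (\<integral>\<xi>. 2 * (1 - exp (- \<bar>\<xi>\<bar> * \<delta>)) \<partial>\<pi>)"

lemma increment_modulus_integrable:
  assumes "0 \<le> \<delta>"
  shows "integrable \<pi> (\<lambda>\<xi>. 2 * (1 - exp (- \<bar>\<xi>\<bar> * \<delta>)))"
proof (rule pi.integrable_const_bound[where B = 2])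
  have "norm (2 * (1 - exp (- \<bar>\<xi>\<bar> * \<delta>))) \<le> 2" for \<xi> :: real
  proof -
    have "exp (- \<bar>\<xi>\<bar> * \<delta>) \<le> 1" using assms by simp
    then show ?thesis by simp
  qed
  then show "AE \<xi> in \<pi>. norm (2 * (1 - exp (- \<bar>\<xi>\<bar> * \<delta>))) \<le> 2" by simp
qed measurable

lemma increment_modulus_mono:
  assumes "0 \<le> \<delta>" "\<delta> \<le> \<delta>'"
  shows "increment_modulus \<delta> \<le> increment_modulus \<delta>'"
  unfolding increment_modulus_def using assms
  by (intro integral_mono increment_modulus_integrable) (auto intro: mult_left_mono)

lemma increment_modulus_nonneg: "0 \<le> \<delta> \<Longrightarrow> 0 \<le> increment_modulus \<delta>"
  unfolding increment_modulus_def by (intro Bochner_Integration.integral_nonneg) simp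

text \<open>Dominated convergence yields no rate, as the mass of \<pi> at large \<xi> is not
  controlled. Convergence alone suffices: the Riemann sums are refined at fixed
  \<open>t\<close>.\<close>

lemma increment_modulus_tendsto: "(\<lambda>n. increment_modulus (t / real n)) \<longlonglongrightarrow> 0" if "0 \<le> t"
proof -
  have "(\<lambda>n. increment_modulus (t / real n)) \<longlonglongrightarrow> (\<integral>\<xi>. 0 \<partial>\<pi>)"
    unfolding increment_modulus_def
  proof (rule integral_dominated_convergence[where w = "\<lambda>_. 2"])
    show "AE \<xi> in \<pi>. (\<lambda>n. 2 * (1 - exp (- \<bar>\<xi>\<bar> * (t / real n)))) \<longlonglongrightarrow> 0"
    proof (rule AE_I2)
      fix \<xi> :: real
      have "(\<lambda>n. 2 * (1 - exp (- \<bar>\<xi>\<bar> * (t / real n)))) \<longlonglongrightarrow> 2 * (1 - exp (- \<bar>\<xi>\<bar> * 0))"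
        by (intro tendsto_intros lim_const_over_n)
      then show "(\<lambda>n. 2 * (1 - exp (- \<bar>\<xi>\<bar> * (t / real n)))) \<longlonglongrightarrow> 0" by simp
    qed
    have "norm (2 * (1 - exp (- \<bar>\<xi>\<bar> * (t / real n)))) \<le> 2" for \<xi> :: real and n :: nat
    proof -
      have "exp (- \<bar>\<xi>\<bar> * (t / real n)) \<le> 1" using that by simp
      then show ?thesis by simp
    qed
    then show "AE \<xi> in \<pi>. norm (2 * (1 - exp (- \<bar>\<xi>\<bar> * (t / real n)))) \<le> 2" for n by simp
  qed auto
  then show ?thesis by simp
qed

text \<open>The difference of two kernels has modulus at most 1, so its powers above 1 are at most
  the modulus itself. One distance in mean then controls both terms and appears as a common factor
  of the tail bound.\<close>

lemma increment_tail:
  assumes q: "1 < q" and q': "1 < q'" and AB: "0 \<le> A" "0 \<le> B"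
    and kappa: "\<And>z. norm (levy_cumulant a 0 \<mu> z) \<le> A * \<bar>z\<bar> powr q + B * \<bar>z\<bar> powr q'"
    and uv: "u \<le> v" "v \<le> u + \<delta>" and x: "0 < x"
  shows "prob {\<omega>\<in>space M. x \<le> \<bar>Y u \<omega> - Y v \<omega>\<bar>} \<le> increment_modulus \<delta> * (32 * A * x powr (- q) + 32 * B * x powr (- q'))"
proof -
  let ?g = "\<lambda>x. supou_kernel u x - supou_kernel v x" and ?G = "\<lambda>x. supou_kernel u x + supou_kernel v x"
  have sl: "step_limit ?g ?G (\<lambda>\<omega>. Y u \<omega> - Y v \<omega>)"
    using step_limit_lincomb_Y[of "{0,1}" "\<lambda>j. if j = 0 then 1 else - 1" "\<lambda>j. if j = 0 then u else v"]
    by simp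
  define D where "D = increment_modulus (v - u)"
  have intg: "integrable (\<pi> \<Otimes>\<^sub>M lborel) ?g"
    by (intro Bochner_Integration.integrable_diff pi.integrable_supou_kernel)
  have gD: "(\<integral>x. \<bar>?g x\<bar> \<partial>(\<pi> \<Otimes>\<^sub>M lborel)) \<le> D"
  proof -
    have "ennreal (\<integral>x. \<bar>?g x\<bar> \<partial>(\<pi> \<Otimes>\<^sub>M lborel)) = (\<integral>\<^sup>+x. ennreal \<bar>?g x\<bar> \<partial>(\<pi> \<Otimes>\<^sub>M lborel))"
      using intg by (subst nn_integral_eq_integral) auto
    also have "\<dots> \<le> (\<integral>\<^sup>+\<xi>. ennreal (2 * (1 - exp (- \<bar>\<xi>\<bar> * (v - u)))) \<partial>\<pi>)"
      by (rule pi.nn_integral_supou_kernel_diff[OF uv(1)])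
    also have "\<dots> = ennreal D"
      unfolding D_def increment_modulus_def using uv
      by (intro nn_integral_eq_integral increment_modulus_integrable) auto
    finally show ?thesis using uv increment_modulus_nonneg[of "v - u"] by (simp add: D_def)
  qed
  have D0: "0 \<le> D" using uv increment_modulus_nonneg[of "v - u"] by (simp add: D_def)
  have "expectation (\<lambda>\<omega>. 1 - cos (\<zeta> * (Y u \<omega> - Y v \<omega>))) \<le> A * D * \<zeta> powr q + B * D * \<zeta> powr q'" if \<zeta>: "0 < \<zeta>" for \<zeta>
  proof -
    have pw: "\<bar>\<zeta> * y\<bar> powr r \<le> \<zeta> powr r * \<bar>y\<bar>" if "\<bar>y\<bar> \<le> 1" "1 < r" for y r
      using powr_mono'[of 1 r "\<bar>y\<bar>"] that \<zeta> by (simp add: abs_mult powr_mult)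
    \<comment> \<open>The dominating sum of the two kernels is only bounded by 2, hence the
      rescaling by \<open>1 / 2\<close>.\<close>
    have pw2: "\<bar>\<zeta> * y\<bar> powr r \<le> (2 * \<zeta>) powr r * \<bar>y\<bar>" if "\<bar>y\<bar> \<le> 2" "1 < r" for y r
    proof -
      have "\<bar>y / 2\<bar> powr r \<le> \<bar>y / 2\<bar>" using powr_mono'[of 1 r "\<bar>y / 2\<bar>"] that by simp
      then have "(2 * \<zeta>) powr r * \<bar>y / 2\<bar> powr r \<le> (2 * \<zeta>) powr r * \<bar>y / 2\<bar>" by (intro mult_left_mono) auto
      also have "(2 * \<zeta>) powr r * \<bar>y / 2\<bar> powr r = \<bar>\<zeta> * y\<bar> powr r"
        using \<zeta> by (simp add: powr_mult[symmetric] abs_mult)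
      also have "(2 * \<zeta>) powr r * \<bar>y / 2\<bar> \<le> (2 * \<zeta>) powr r * \<bar>y\<bar>" by (intro mult_left_mono) auto
      finally show ?thesis .
    qed
    have g1: "\<bar>?g x\<bar> \<le> 1" and G2: "\<bar>?G x\<bar> \<le> 2" for x
      using pi.supou_kernel_bounds[of u x] pi.supou_kernel_bounds[of v x] by auto
    have iG: "integrable (\<pi> \<Otimes>\<^sub>M lborel) (\<lambda>x. A * \<bar>\<zeta> * ?G x\<bar> powr q + B * \<bar>\<zeta> * ?G x\<bar> powr q')"
    proof (rule Bochner_Integration.integrable_bound)
      show "integrable (\<pi> \<Otimes>\<^sub>M lborel) (\<lambda>x. (A * (2 * \<zeta>) powr q + B * (2 * \<zeta>) powr q') * \<bar>?G x\<bar>)"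
        by (intro integrable_mult_right integrable_abs Bochner_Integration.integrable_add pi.integrable_supou_kernel)
      have "norm (A * \<bar>\<zeta> * ?G x\<bar> powr q + B * \<bar>\<zeta> * ?G x\<bar> powr q') \<le> norm ((A * (2 * \<zeta>) powr q + B * (2 * \<zeta>) powr q') * \<bar>?G x\<bar>)" for x
      proof -
        have "A * \<bar>\<zeta> * ?G x\<bar> powr q + B * \<bar>\<zeta> * ?G x\<bar> powr q' \<le> A * ((2 * \<zeta>) powr q * \<bar>?G x\<bar>) + B * ((2 * \<zeta>) powr q' * \<bar>?G x\<bar>)"
          using AB q q' by (intro add_mono mult_left_mono pw2 G2) auto
        also have "\<dots> = (A * (2 * \<zeta>) powr q + B * (2 * \<zeta>) powr q') * \<bar>?G x\<bar>" by (simp only: distrib_right mult.assoc)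
        finally show ?thesis using AB by (simp only: real_norm_def) (subst (1 2) abs_of_nonneg, auto)
      qed
      then show "AE x in \<pi> \<Otimes>\<^sub>M lborel. norm (A * \<bar>\<zeta> * ?G x\<bar> powr q + B * \<bar>\<zeta> * ?G x\<bar> powr q') \<le> norm ((A * (2 * \<zeta>) powr q + B * (2 * \<zeta>) powr q') * \<bar>?G x\<bar>)"
        by (intro AE_I2)
    qed measurable
    have "expectation (\<lambda>\<omega>. 1 - cos (\<zeta> * (Y u \<omega> - Y v \<omega>))) \<le> norm (1 - chf M (\<lambda>\<omega>. Y u \<omega> - Y v \<omega>) \<zeta>)"
      by (rule expectation_one_minus_cos_le) measurable
    also have "\<dots> \<le> (\<integral>x. A * \<bar>\<zeta> * ?g x\<bar> powr q + B * \<bar>\<zeta> * ?g x\<bar> powr q' \<partial>(\<pi> \<Otimes>\<^sub>M lborel))"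
      by (rule step_limit_one_minus_chf_le[OF sl _ jumps.Re_levy_cumulant_nonpos kappa AB _ _ iG]) (use q q' in auto)
    also have "\<dots> \<le> (\<integral>x. (A * \<zeta> powr q + B * \<zeta> powr q') * \<bar>?g x\<bar> \<partial>(\<pi> \<Otimes>\<^sub>M lborel))"
    proof (rule integral_mono_AE')
      show "integrable (\<pi> \<Otimes>\<^sub>M lborel) (\<lambda>x. (A * \<zeta> powr q + B * \<zeta> powr q') * \<bar>?g x\<bar>)"
        using intg by (intro integrable_mult_right integrable_abs)
      have "A * \<bar>\<zeta> * ?g x\<bar> powr q + B * \<bar>\<zeta> * ?g x\<bar> powr q' \<le> (A * \<zeta> powr q + B * \<zeta> powr q') * \<bar>?g x\<bar>" for x
      proof -
        have "A * \<bar>\<zeta> * ?g x\<bar> powr q + B * \<bar>\<zeta> * ?g x\<bar> powr q' \<le> A * (\<zeta> powr q * \<bar>?g x\<bar>) + B * (\<zeta> powr q' * \<bar>?g x\<bar>)"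
          using AB q q' by (intro add_mono mult_left_mono pw g1) auto
        then show ?thesis by (simp only: distrib_right mult.assoc)
      qed
      then show "AE x in \<pi> \<Otimes>\<^sub>M lborel. A * \<bar>\<zeta> * ?g x\<bar> powr q + B * \<bar>\<zeta> * ?g x\<bar> powr q' \<le> (A * \<zeta> powr q + B * \<zeta> powr q') * \<bar>?g x\<bar>"
        by (intro AE_I2)
      show "AE x in \<pi> \<Otimes>\<^sub>M lborel. 0 \<le> (A * \<zeta> powr q + B * \<zeta> powr q') * \<bar>?g x\<bar>"
        using AB by (intro AE_I2) auto
    qed
    also have "\<dots> = (A * \<zeta> powr q + B * \<zeta> powr q') * (\<integral>x. \<bar>?g x\<bar> \<partial>(\<pi> \<Otimes>\<^sub>M lborel))" by (rule integral_mult_right_zero)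
    also have "\<dots> \<le> (A * \<zeta> powr q + B * \<zeta> powr q') * D" using AB by (intro mult_left_mono gD) auto
    also have "\<dots> = A * D * \<zeta> powr q + B * D * \<zeta> powr q'" by (simp add: algebra_simps)
    finally show ?thesis .
  qed
  then have "prob {\<omega>\<in>space M. x \<le> \<bar>Y u \<omega> - Y v \<omega>\<bar>} \<le> 32 * (A * D * x powr (- q) + B * D * x powr (- q'))"
    using AB D0 q q' x by (intro tail_le_of_chf) auto
  also have "\<dots> = D * (32 * A * x powr (- q) + 32 * B * x powr (- q'))" by (simp add: algebra_simps)
  also have "\<dots> \<le> increment_modulus \<delta> * (32 * A * x powr (- q) + 32 * B * x powr (- q'))"
    unfolding D_def using uv AB by (intro mult_right_mono increment_modulus_mono) auto
  finally show ?thesis .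
qed

text \<open>The bound is uniform in the position of the cell, so that summing over the
  \<open>n\<close> cells of a Riemann sum costs only the length \<open>t\<close>.\<close>

lemma increments_L1_small:
  assumes t: "0 \<le> t" and e: "0 < e"
  shows "\<forall>\<^sub>F n in sequentially. \<forall>u v. u \<le> v \<longrightarrow> v \<le> u + t / real n \<longrightarrow> (\<integral>\<^sup>+\<omega>. ennreal \<bar>Y u \<omega> - Y v \<omega>\<bar> \<partial>M) \<le> ennreal e"
proof -
  define q where "q = (1 + \<gamma>) / 2"
  have q: "1 < q" "q < \<gamma>" using gamma by (auto simp: q_def)
  obtain A B where AB: "0 \<le> A" "0 \<le> B" and kappa: "\<And>z. norm (levy_cumulant a 0 \<mu> z) \<le> A * \<bar>z\<bar> powr q + B * \<bar>z\<bar> powr 2"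
    using cumulant_bound[OF q, of 2] beta by auto
  \<comment> \<open>This is the constant of the expectation bound at level \<open>e / 2\<close>;
    fixing the level before letting \<open>n\<close> grow leaves only the increment modulus to tend
    to 0.\<close>
  define C where "C = 2 * (32 * A) * (e / 2) powr (1 - q) * (1 / (1 - 2 powr (1 - q))) + 2 * (32 * B) * (e / 2) powr (1 - 2) * (1 / (1 - 2 powr (1 - 2)))"
  have "(\<lambda>n. increment_modulus (t / real n) * C) \<longlonglongrightarrow> 0 * C"
    by (intro tendsto_intros increment_modulus_tendsto t)
  then have "\<forall>\<^sub>F n in sequentially. increment_modulus (t / real n) * C < e / 2"
    by (rule order_tendstoD) (use e in simp)
  then show ?thesis
  proof eventually_elim
    case (elim n)
    show ?case
    proof (intro allI impI)
      fix u v :: real assume uv: "u \<le> v" "v \<le> u + t / real n"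
      have "(\<integral>\<^sup>+\<omega>. ennreal \<bar>Y u \<omega> - Y v \<omega>\<bar> \<partial>M) \<le> ennreal (e / 2 + increment_modulus (t / real n) * C)"
        unfolding C_def using e t AB q
        by (intro nn_integral_abs_le_of_tail increment_tail[OF q(1) _ AB kappa uv] increment_modulus_nonneg) auto
      also have "\<dots> \<le> ennreal e" using elim by (intro ennreal_leI) simp
      finally show "(\<integral>\<^sup>+\<omega>. ennreal \<bar>Y u \<omega> - Y v \<omega>\<bar> \<partial>M) \<le> ennreal e" .
    qed
  qed
qed

end

section \<open>The integrated process\<close>

context supou_process
begin

section \<open>Riemann approximation of the integrated process in mean\<close>

lemma X_measurable [measurable]:
  assumes "0 \<le> t"
  shows "X t \<in> borel_measurable M"
proof -
  have [measurable]: "(\<lambda>(\<omega>, s). Y s \<omega>) \<in> borel_measurable (M \<Otimes>\<^sub>M lborel)"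
    using measurable_pair_swap[OF Y_joint] by (simp add: case_prod_unfold)
  have "(\<lambda>\<omega>. LBINT s:{0..t}. Y s \<omega>) \<in> borel_measurable M"
    unfolding set_lebesgue_integral_def by measurable
  then show ?thesis using X[OF assms] by (simp cong: measurable_cong)
qed

text \<open>Along almost every path the error on one cell is at most the integral of
  \<open>|Y s - Y (c + \<delta>)|\<close>. Joint measurability allows Tonelli's theorem to put the
  expectation inside, where the uniform bound on increments applies.\<close>

lemma riemann_step_bound:
  assumes c: "0 \<le> c" and \<delta>: "0 < \<delta>" and e: "0 \<le> e"
    and incr: "\<And>u v. u \<le> v \<Longrightarrow> v \<le> u + \<delta> \<Longrightarrow> (\<integral>\<^sup>+\<omega>. ennreal \<bar>Y u \<omega> - Y v \<omega>\<bar> \<partial>M) \<le> ennreal e"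
  shows "(\<integral>\<^sup>+\<omega>. ennreal \<bar>\<delta> * Y (c + \<delta>) \<omega> - (X (c + \<delta>) \<omega> - X c \<omega>)\<bar> \<partial>M) \<le> ennreal (\<delta> * e)"
proof -
  let ?I = "{c<..c + \<delta>}" and ?u = "c + \<delta>"
  have [measurable]: "(\<lambda>(\<omega>, s). Y s \<omega>) \<in> borel_measurable (M \<Otimes>\<^sub>M lborel)"
    using measurable_pair_swap[OF Y_joint] by (simp add: case_prod_unfold)
  have "AE \<omega> in M. ennreal \<bar>\<delta> * Y ?u \<omega> - (X ?u \<omega> - X c \<omega>)\<bar> \<le> (\<integral>\<^sup>+s. ennreal \<bar>Y s \<omega> - Y ?u \<omega>\<bar> * indicator ?I s \<partial>lborel)"
    using Y_loc_int AE_space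
  proof eventually_elim
    case (elim \<omega>)
    have i: "set_integrable lborel {0..?u} (\<lambda>s. Y s \<omega>)" using elim c \<delta> by simp
    have iI: "set_integrable lborel ?I (\<lambda>s. Y s \<omega>)"
      by (rule set_integrable_subset[OF i]) (use c in auto)
    have ic: "set_integrable lborel {0..c} (\<lambda>s. Y s \<omega>)"
      by (rule set_integrable_subset[OF i]) (use \<delta> in auto)
    have U: "{0..?u} = {0..c} \<union> ?I" using c \<delta> by auto
    have "(LBINT s:{0..?u}. Y s \<omega>) = (LBINT s:{0..c}. Y s \<omega>) + (LBINT s:?I. Y s \<omega>)"
      unfolding U by (rule set_integral_Un[OF _ ic iI]) auto
    then have Xd: "X ?u \<omega> - X c \<omega> = (LBINT s:?I. Y s \<omega>)" using X elim(2) c \<delta> by simp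
    have icst: "set_integrable lborel ?I (\<lambda>s. Y ?u \<omega>)"
      unfolding set_integrable_def using \<delta> by (intro integrable_scaleR_left integrable_real_indicator) auto
    have "(LBINT s:?I. Y ?u \<omega>) = \<delta> * Y ?u \<omega>"
      unfolding set_lebesgue_integral_def using \<delta> by simp
    then have "\<delta> * Y ?u \<omega> - (X ?u \<omega> - X c \<omega>) = (LBINT s:?I. Y ?u \<omega> - Y s \<omega>)"
      unfolding Xd using set_integral_diff(2)[OF icst iI] by simp
    moreover have "integrable lborel (\<lambda>s. indicator ?I s *\<^sub>R (Y ?u \<omega> - Y s \<omega>))"
      using set_integral_diff(1)[OF icst iI] by (simp add: set_integrable_def)
    then have "ennreal (norm (LBINT s:?I. Y ?u \<omega> - Y s \<omega>)) \<le> (\<integral>\<^sup>+s. ennreal (norm (indicator ?I s *\<^sub>R (Y ?u \<omega> - Y s \<omega>))) \<partial>lborel)"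
      unfolding set_lebesgue_integral_def by (rule integral_norm_bound_ennreal)
    ultimately have "ennreal \<bar>\<delta> * Y ?u \<omega> - (X ?u \<omega> - X c \<omega>)\<bar> \<le> (\<integral>\<^sup>+s. ennreal (norm (indicator ?I s *\<^sub>R (Y ?u \<omega> - Y s \<omega>))) \<partial>lborel)"
      by (simp only: real_norm_def)
    also have "\<dots> = (\<integral>\<^sup>+s. ennreal \<bar>Y s \<omega> - Y ?u \<omega>\<bar> * indicator ?I s \<partial>lborel)"
      by (intro nn_integral_cong) (auto simp: indicator_def abs_minus_commute)
    finally show ?case .
  qed
  then have "(\<integral>\<^sup>+\<omega>. ennreal \<bar>\<delta> * Y ?u \<omega> - (X ?u \<omega> - X c \<omega>)\<bar> \<partial>M)
      \<le> (\<integral>\<^sup>+\<omega>. (\<integral>\<^sup>+s. ennreal \<bar>Y s \<omega> - Y ?u \<omega>\<bar> * indicator ?I s \<partial>lborel) \<partial>M)"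
    by (rule nn_integral_mono_AE)
  also have "\<dots> = (\<integral>\<^sup>+s. (\<integral>\<^sup>+\<omega>. ennreal \<bar>Y s \<omega> - Y ?u \<omega>\<bar> * indicator ?I s \<partial>M) \<partial>lborel)"
  proof -
    interpret MP: pair_sigma_finite M lborel ..
    show ?thesis by (rule MP.Fubini'[symmetric]) measurable
  qed
  also have "\<dots> \<le> (\<integral>\<^sup>+s. ennreal e * indicator ?I s \<partial>lborel)"
  proof (rule nn_integral_mono)
    fix s
    show "(\<integral>\<^sup>+\<omega>. ennreal \<bar>Y s \<omega> - Y ?u \<omega>\<bar> * indicator ?I s \<partial>M) \<le> ennreal e * indicator ?I s"
    proof (cases "s \<in> ?I")
      case True
      then show ?thesis using incr[of s ?u] by simp
    qed simp
  qed
  also have "\<dots> = ennreal (\<delta> * e)"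
    using \<delta> e by (subst nn_integral_cmult_indicator) (auto simp: ennreal_mult mult.commute)
  finally show ?thesis .
qed

lemma riemann_sum_bound:
  assumes \<delta>: "0 < \<delta>" and e: "0 \<le> e"
    and incr: "\<And>u v. u \<le> v \<Longrightarrow> v \<le> u + \<delta> \<Longrightarrow> (\<integral>\<^sup>+\<omega>. ennreal \<bar>Y u \<omega> - Y v \<omega>\<bar> \<partial>M) \<le> ennreal e"
  shows "(\<integral>\<^sup>+\<omega>. ennreal \<bar>(\<Sum>j=1..k. \<delta> * Y (real j * \<delta>) \<omega>) - X (real k * \<delta>) \<omega>\<bar> \<partial>M) \<le> ennreal (real k * (\<delta> * e))"
proof (induction k)
  case 0
  have "X 0 \<omega> = 0" if "\<omega> \<in> space M" for \<omega>
  proof -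
    have "AE s in lborel. s \<noteq> (0::real)" by (rule AE_lborel_singleton)
    then have "AE s in lborel. indicator {0..0::real} s *\<^sub>R Y s \<omega> = 0"
      by eventually_elim simp
    then have "(LBINT s:{0..0::real}. Y s \<omega>) = 0"
      unfolding set_lebesgue_integral_def by (rule integral_eq_zero_AE)
    then show ?thesis using X[of 0] that by simp
  qed
  then have "(\<integral>\<^sup>+\<omega>. ennreal \<bar>(\<Sum>j=1..0. \<delta> * Y (real j * \<delta>) \<omega>) - X (real 0 * \<delta>) \<omega>\<bar> \<partial>M) = (\<integral>\<^sup>+\<omega>. 0 \<partial>M)"
    by (intro nn_integral_cong) simp
  then show ?case by simp
next
  case (Suc k)
  let ?R = "\<lambda>k \<omega>. (\<Sum>j=1..k. \<delta> * Y (real j * \<delta>) \<omega>) - X (real k * \<delta>) \<omega>"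
  let ?c = "real k * \<delta>"
  have c: "0 \<le> ?c" using \<delta> by simp
  have Sk: "real (Suc k) * \<delta> = ?c + \<delta>" by (simp add: algebra_simps)
  have [measurable]: "X ?c \<in> borel_measurable M" "X (?c + \<delta>) \<in> borel_measurable M"
    using c \<delta> by (auto intro!: X_measurable)
  have "(\<integral>\<^sup>+\<omega>. ennreal \<bar>?R (Suc k) \<omega>\<bar> \<partial>M) \<le> (\<integral>\<^sup>+\<omega>. ennreal \<bar>?R k \<omega>\<bar> + ennreal \<bar>\<delta> * Y (?c + \<delta>) \<omega> - (X (?c + \<delta>) \<omega> - X ?c \<omega>)\<bar> \<partial>M)"
  proof (rule nn_integral_mono)
    fix \<omega>
    have "?R (Suc k) \<omega> = ?R k \<omega> + (\<delta> * Y (?c + \<delta>) \<omega> - (X (?c + \<delta>) \<omega> - X ?c \<omega>))"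
      unfolding Sk[symmetric] by simp
    then have "\<bar>?R (Suc k) \<omega>\<bar> \<le> \<bar>?R k \<omega>\<bar> + \<bar>\<delta> * Y (?c + \<delta>) \<omega> - (X (?c + \<delta>) \<omega> - X ?c \<omega>)\<bar>"
      by (simp only: abs_triangle_ineq)
    then show "ennreal \<bar>?R (Suc k) \<omega>\<bar> \<le> ennreal \<bar>?R k \<omega>\<bar> + ennreal \<bar>\<delta> * Y (?c + \<delta>) \<omega> - (X (?c + \<delta>) \<omega> - X ?c \<omega>)\<bar>"
      by (subst ennreal_plus[symmetric]) (auto intro: ennreal_leI simp del: ennreal_plus)
  qed
  also have "\<dots> = (\<integral>\<^sup>+\<omega>. ennreal \<bar>?R k \<omega>\<bar> \<partial>M) + (\<integral>\<^sup>+\<omega>. ennreal \<bar>\<delta> * Y (?c + \<delta>) \<omega> - (X (?c + \<delta>) \<omega> - X ?c \<omega>)\<bar> \<partial>M)"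
    by (rule nn_integral_add) measurable
  also have "\<dots> \<le> ennreal (real k * (\<delta> * e)) + ennreal (\<delta> * e)"
    by (intro add_mono Suc riemann_step_bound[OF c \<delta> e incr])
  also have "\<dots> = ennreal (real (Suc k) * (\<delta> * e))"
    using \<delta> e by (subst ennreal_plus[symmetric]) (auto simp: algebra_simps simp del: ennreal_plus)
  finally show ?case .
qed

definition riemann_sum :: "real \<Rightarrow> nat \<Rightarrow> 'w \<Rightarrow> real" where
  "riemann_sum t n \<omega> = (\<Sum>j=1..n. t / real n * Y (real j * (t / real n)) \<omega>)"

lemma riemann_sum_measurable [measurable]: "riemann_sum t n \<in> borel_measurable M"
  unfolding riemann_sum_def[abs_def] by measurable

lemma step_limit_riemann_sum:
  assumes "0 \<le> t"
  shows "step_limit (pi.riemann_kernel t n) (pi.riemann_kernel t n) (riemann_sum t n)"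
proof -
  have "\<bar>t / real n\<bar> = t / real n" using assms by simp
  then show ?thesis
    using step_limit_lincomb_Y[of "{1..n}" "\<lambda>_. t / real n" "\<lambda>j. real j * (t / real n)"]
    by (simp only: pi.riemann_kernel_def[abs_def] riemann_sum_def[abs_def] finite_atLeastAtMost simp_thms)
qed

text \<open>This takes the place of a stochastic Fubini theorem: it links the pathwise integral to
  finite combinations of the \<open>Y u\<close>, whose kernels are explicit. Convergence in mean
  suffices, as \<open>cis\<close> is Lipschitz.\<close>

lemma chf_riemann_sum_tendsto:
  assumes t: "0 < t"
  shows "(\<lambda>n. chf M (riemann_sum t n) \<zeta>) \<longlonglongrightarrow> chf M (X t) \<zeta>"
proof (rule LIMSEQ_I)
  fix r :: real assume r: "0 < r"
  define z where "z = \<bar>\<zeta>\<bar> + 1"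
  have z: "0 < z" "\<bar>\<zeta>\<bar> \<le> z" by (simp_all add: z_def add_nonneg_pos)
  define e where "e = r / (2 * t * z)"
  have e: "0 < e" using r t z by (simp add: e_def)
  have te: "\<bar>\<zeta>\<bar> * (t * e) < r"
  proof -
    have "\<bar>\<zeta>\<bar> * (t * e) \<le> z * (t * e)" using t e z by (intro mult_right_mono) auto
    also have "\<dots> = r / 2" using t z by (simp add: e_def)
    also have "\<dots> < r" using r by simp
    finally show ?thesis .
  qed
  have [measurable]: "X t \<in> borel_measurable M" using t by (intro X_measurable) simp
  have "\<forall>\<^sub>F n in sequentially. norm (chf M (riemann_sum t n) \<zeta> - chf M (X t) \<zeta>) < r"
    using increments_L1_small[OF less_imp_le[OF t] e] eventually_gt_at_top[of 0]
  proof eventually_elim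
    case (elim n)
    have \<delta>: "0 < t / real n" "real n * (t / real n) = t" using elim t by auto
    have L1: "(\<integral>\<^sup>+\<omega>. ennreal \<bar>riemann_sum t n \<omega> - X t \<omega>\<bar> \<partial>M) \<le> ennreal (t * e)"
    proof -
      have "(\<integral>\<^sup>+\<omega>. ennreal \<bar>(\<Sum>j=1..n. t / real n * Y (real j * (t / real n)) \<omega>) - X (real n * (t / real n)) \<omega>\<bar> \<partial>M)
          \<le> ennreal (real n * (t / real n * e))"
        by (rule riemann_sum_bound[OF \<delta>(1) less_imp_le[OF e]]) (use elim(1) in blast)
      moreover have "real n * (t / real n * e) = t * e" unfolding mult.assoc[symmetric] \<delta>(2) ..
      ultimately show ?thesis by (simp only: riemann_sum_def \<delta>(2))
    qed
    have ic: "integrable M (\<lambda>\<omega>. cis (\<zeta> * Z \<omega>))" if [measurable]: "Z \<in> borel_measurable M" for Z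
      by (rule integrable_const_bound[where B = 1]) auto
    have id: "integrable M (\<lambda>\<omega>. cis (\<zeta> * riemann_sum t n \<omega>) - cis (\<zeta> * X t \<omega>))"
      by (intro Bochner_Integration.integrable_diff ic) measurable
    have "ennreal (norm (chf M (riemann_sum t n) \<zeta> - chf M (X t) \<zeta>)) =
        ennreal (norm (\<integral>\<omega>. cis (\<zeta> * riemann_sum t n \<omega>) - cis (\<zeta> * X t \<omega>) \<partial>M))"
      by (subst Bochner_Integration.integral_diff) (auto intro!: ic)
    also have "\<dots> \<le> (\<integral>\<^sup>+\<omega>. ennreal (norm (cis (\<zeta> * riemann_sum t n \<omega>) - cis (\<zeta> * X t \<omega>))) \<partial>M)"
      by (rule integral_norm_bound_ennreal[OF id])
    also have "\<dots> \<le> (\<integral>\<^sup>+\<omega>. ennreal \<bar>\<zeta>\<bar> * ennreal \<bar>riemann_sum t n \<omega> - X t \<omega>\<bar> \<partial>M)"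
    proof (rule nn_integral_mono)
      fix \<omega>
      have "norm (cis (\<zeta> * riemann_sum t n \<omega>) - cis (\<zeta> * X t \<omega>)) \<le> \<bar>\<zeta> * riemann_sum t n \<omega> - \<zeta> * X t \<omega>\<bar>"
        by (rule norm_cis_diff_le)
      also have "\<dots> = \<bar>\<zeta>\<bar> * \<bar>riemann_sum t n \<omega> - X t \<omega>\<bar>" by (simp add: abs_mult[symmetric] right_diff_distrib)
      finally show "ennreal (norm (cis (\<zeta> * riemann_sum t n \<omega>) - cis (\<zeta> * X t \<omega>))) \<le> ennreal \<bar>\<zeta>\<bar> * ennreal \<bar>riemann_sum t n \<omega> - X t \<omega>\<bar>"
        by (subst ennreal_mult[symmetric]) (auto intro: ennreal_leI)
    qed
    also have "\<dots> = ennreal \<bar>\<zeta>\<bar> * (\<integral>\<^sup>+\<omega>. ennreal \<bar>riemann_sum t n \<omega> - X t \<omega>\<bar> \<partial>M)"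
      by (rule nn_integral_cmult) measurable
    also have "\<dots> \<le> ennreal \<bar>\<zeta>\<bar> * ennreal (t * e)" by (intro mult_left_mono L1) simp
    also have "\<dots> = ennreal (\<bar>\<zeta>\<bar> * (t * e))" using t e by (simp add: ennreal_mult)
    finally have "norm (chf M (riemann_sum t n) \<zeta> - chf M (X t) \<zeta>) \<le> \<bar>\<zeta>\<bar> * (t * e)"
      using t e by (subst (asm) ennreal_le_iff) auto
    then show ?case using te by simp
  qed
  then show "\<exists>no. \<forall>n\<ge>no. norm (chf M (riemann_sum t n) \<zeta> - chf M (X t) \<zeta>) < r"
    by (simp add: eventually_sequentially)
qed

section \<open>Two-sided bounds on \<open>1 - cos\<close> of the integrated process\<close>

lemma X_cos_upper:
  assumes q: "1 < q" "q < \<gamma>" and q': "1 \<le> q'" "q' \<le> 2" "\<beta> < q'"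
    and m: "0 \<le> m" "m \<le> q - 1" "m < \<alpha>" and m': "0 \<le> m'" "m' \<le> q' - 1" "m' < \<alpha>"
  shows "\<exists>K\<ge>0. \<forall>t>0. \<forall>\<zeta>>0. expectation (\<lambda>\<omega>. 1 - cos (\<zeta> * X t \<omega>)) \<le>
    K * t powr (q - m) * \<zeta> powr q + K * t powr (q' - m') * \<zeta> powr q'"
proof -
  obtain A B where AB: "0 \<le> A" "0 \<le> B" and kappa: "\<And>z. norm (levy_cumulant a 0 \<mu> z) \<le> A * \<bar>z\<bar> powr q + B * \<bar>z\<bar> powr q'"
    using cumulant_bound[OF q q'] by blast
  define C where "C = 2 powr m * (\<integral>\<xi>. \<xi> powr (- m) \<partial>\<pi>) + 1"
  define C' where "C' = 2 powr m' * (\<integral>\<xi>. \<xi> powr (- m') \<partial>\<pi>) + 1"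
  have C: "0 \<le> C" "0 \<le> C'"
    unfolding C_def C'_def by (auto intro!: add_nonneg_nonneg mult_nonneg_nonneg Bochner_Integration.integral_nonneg)
  define K where "K = max (A * C) (B * C')"
  have K: "A * C \<le> K" "B * C' \<le> K" "0 \<le> K" using AB C by (auto simp: K_def le_max_iff_disj)
  have "expectation (\<lambda>\<omega>. 1 - cos (\<zeta> * X t \<omega>)) \<le> K * t powr (q - m) * \<zeta> powr q + K * t powr (q' - m') * \<zeta> powr q'"
    if t: "0 < t" and \<zeta>: "0 < \<zeta>" for t \<zeta>
  proof -
    have [measurable]: "X t \<in> borel_measurable M" using t by (intro X_measurable) simp
    let ?b = "A * C * t powr (q - m) * \<zeta> powr q + B * C' * t powr (q' - m') * \<zeta> powr q'"
    \<comment> \<open>The moments of the Riemann kernels are controlled only from some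
      \<open>n\<close> on, but the bound itself is free of \<open>n\<close> and survives the limit
      at fixed \<open>t\<close> and \<zeta>.\<close>
    have "\<forall>\<^sub>F n in sequentially. norm (1 - chf M (riemann_sum t n) \<zeta>) \<le> ?b"
      using pi.eventually_riemann_kernel_powr[OF t less_imp_le[OF q(1)] m(1,2) pi_moment[OF m(1,3)]]
        pi.eventually_riemann_kernel_powr[OF t q'(1) m'(1,2) pi_moment[OF m'(1,3)]]
    proof eventually_elim
      case (elim n)
      let ?g = "pi.riemann_kernel t n"
      have g0: "0 \<le> ?g x" for x using pi.riemann_kernel_bounds(1)[of t n x] t by simp
      have i: "integrable (\<pi> \<Otimes>\<^sub>M lborel) (\<lambda>x. ?g x powr q)"
        by (rule integrableI_bounded) (use elim(1) in \<open>auto intro: le_less_trans\<close>)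
      have i': "integrable (\<pi> \<Otimes>\<^sub>M lborel) (\<lambda>x. ?g x powr q')"
        by (rule integrableI_bounded) (use elim(2) in \<open>auto intro: le_less_trans\<close>)
      have le: "(\<integral>x. ?g x powr q \<partial>(\<pi> \<Otimes>\<^sub>M lborel)) \<le> C * t powr (q - m)"
        using elim(1) C by (subst (asm) nn_integral_eq_integral[OF i]) (auto simp: C_def)
      have le': "(\<integral>x. ?g x powr q' \<partial>(\<pi> \<Otimes>\<^sub>M lborel)) \<le> C' * t powr (q' - m')"
        using elim(2) C by (subst (asm) nn_integral_eq_integral[OF i']) (auto simp: C'_def)
      have eq: "A * \<bar>\<zeta> * ?g x\<bar> powr q + B * \<bar>\<zeta> * ?g x\<bar> powr q' = A * \<zeta> powr q * ?g x powr q + B * \<zeta> powr q' * ?g x powr q'" for x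
        using \<zeta> g0[of x] by (simp add: abs_mult powr_mult)
      have int: "integrable (\<pi> \<Otimes>\<^sub>M lborel) (\<lambda>x. A * \<bar>\<zeta> * ?g x\<bar> powr q + B * \<bar>\<zeta> * ?g x\<bar> powr q')"
        unfolding eq by (intro Bochner_Integration.integrable_add integrable_mult_right i i')
      have "norm (1 - chf M (riemann_sum t n) \<zeta>) \<le> (\<integral>x. A * \<bar>\<zeta> * ?g x\<bar> powr q + B * \<bar>\<zeta> * ?g x\<bar> powr q' \<partial>(\<pi> \<Otimes>\<^sub>M lborel))"
        by (rule step_limit_one_minus_chf_le[OF step_limit_riemann_sum _ jumps.Re_levy_cumulant_nonpos kappa AB _ _ int])
           (use t q q' in auto)
      also have "\<dots> = A * \<zeta> powr q * (\<integral>x. ?g x powr q \<partial>(\<pi> \<Otimes>\<^sub>M lborel)) + B * \<zeta> powr q' * (\<integral>x. ?g x powr q' \<partial>(\<pi> \<Otimes>\<^sub>M lborel))"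
        unfolding eq using i i' by (subst Bochner_Integration.integral_add) (auto intro: integrable_mult_right)
      also have "\<dots> \<le> A * \<zeta> powr q * (C * t powr (q - m)) + B * \<zeta> powr q' * (C' * t powr (q' - m'))"
        using AB by (intro add_mono mult_left_mono le le') auto
      finally show ?case by (simp only: mult_ac)
    qed
    then have "norm (1 - chf M (X t) \<zeta>) \<le> ?b"
      by (intro tendsto_upperbound[OF tendsto_norm[OF tendsto_diff[OF tendsto_const chf_riemann_sum_tendsto[OF t]]]]) auto
    then have "expectation (\<lambda>\<omega>. 1 - cos (\<zeta> * X t \<omega>)) \<le> ?b"
      by (intro order_trans[OF expectation_one_minus_cos_le(1)]) auto
    also have "\<dots> \<le> K * t powr (q - m) * \<zeta> powr q + K * t powr (q' - m') * \<zeta> powr q'"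
      using K by (intro add_mono mult_right_mono) auto
    finally show ?thesis .
  qed
  then show ?thesis using K(3) by blast
qed

text \<open>Bounded windows exhaust all jumps of size at least \<open>y\<close>, so one of them has
  positive mass. The upper end is needed later to keep the phase within
  \<open>[-1, 1]\<close>.\<close>

lemma jump_window:
  obtains y0 y1 where "0 < y0" "y0 < y1" "0 < measure \<mu> {x. y0 < \<bar>x\<bar> \<and> \<bar>x\<bar> \<le> y1}"
proof -
  obtain y where y: "0 < y" "0 < measure \<mu> {x. y \<le> \<bar>x\<bar>}" using jumps_nontrivial by blast
  define F where "F n = {x::real. y / 2 < \<bar>x\<bar> \<and> \<bar>x\<bar> \<le> y + real n}" for n
  have F: "F n \<in> sets \<mu>" for n
  proof -
    have "{x\<in>space \<mu>. y / 2 < \<bar>x\<bar> \<and> \<bar>x\<bar> \<le> y + real n} \<in> sets \<mu>" by measurable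
    then show ?thesis by (simp add: F_def)
  qed
  have "\<exists>n. 0 < measure \<mu> (F n)"
  proof (rule ccontr)
    assume "\<not> ?thesis"
    then have m0: "measure \<mu> (F n) = 0" for n using zero_less_measure_iff by auto
    have "{x\<in>space \<mu>. y / 2 \<le> \<bar>x\<bar>} \<in> sets \<mu>" by measurable
    then have "emeasure \<mu> (F n) \<le> emeasure \<mu> {x. y / 2 \<le> \<bar>x\<bar>}" for n
      by (intro emeasure_mono) (auto simp: F_def)
    then have "emeasure \<mu> (F n) < \<infinity>" for n
      using jumps.emeasure_mu_away[of "y / 2"] y(1) by (auto intro: le_less_trans)
    then have e0: "emeasure \<mu> (F n) = 0" for n
      using m0[of n] by (simp add: emeasure_eq_ennreal_measure less_top[symmetric])
    have U0: "emeasure \<mu> (\<Union>n. F n) = 0"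
      by (rule emeasure_UN_eq_0) (use e0 F in auto)
    have US: "(\<Union>n. F n) \<in> sets \<mu>" by (rule sets.countable_nat_UN) (use F in blast)
    have "{x. y \<le> \<bar>x\<bar>} \<subseteq> (\<Union>n. F n)"
    proof
      fix x assume x: "x \<in> {x. y \<le> \<bar>x\<bar>}"
      obtain n where "\<bar>x\<bar> - y \<le> real n" using real_arch_simple by blast
      then show "x \<in> (\<Union>n. F n)" using x y by (auto simp: F_def intro!: exI[of _ n])
    qed
    then have "emeasure \<mu> {x. y \<le> \<bar>x\<bar>} = 0" by (rule emeasure_eq_0[OF US U0])
    then show False using y(2) by (simp add: measure_def)
  qed
  then obtain n where "0 < measure \<mu> (F n)" by blast
  then show thesis using y(1) by (intro that[of "y / 2" "y + real n"]) (auto simp: F_def add_pos_nonneg)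
qed

lemma X_cos_lower:
  "\<exists>w>0. \<exists>c>0. \<forall>t>0. c * measure \<pi> {0<..<1/t} \<le> expectation (\<lambda>\<omega>. 1 - cos (w / t * X t \<omega>))"
proof -
  obtain y0 y1 where y: "0 < y0" "y0 < y1" and N: "0 < measure \<mu> {x. y0 < \<bar>x\<bar> \<and> \<bar>x\<bar> \<le> y1}"
    by (rule jump_window)
  define N where "N = measure \<mu> {x. y0 < \<bar>x\<bar> \<and> \<bar>x\<bar> \<le> y1}"
  \<comment> \<open>A kernel value below \<open>w\<close> times a jump of size at most
    \<open>y1\<close> then stays within \<open>[-1, 1]\<close>, where \<open>1 - cos\<close> is
    bounded below by a square. The lower ends \<open>exp (- 2) * w\<close> and \<open>y0\<close>
    produce \<open>c0\<close>.\<close>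
  define w where "w = 1 / y1"
  define c0 where "c0 = (y0 * (exp (- 2) * w))\<^sup>2 / 4 * N"
  have w: "0 < w" using y by (simp add: w_def)
  have c0: "0 < c0" using y w N by (simp add: c0_def N_def)
  define c where "c = min (c0 / 2) 1 / 2"
  have c: "0 < c" using c0 by (simp add: c_def)
  have "c * measure \<pi> {0<..<1/t} \<le> expectation (\<lambda>\<omega>. 1 - cos (w / t * X t \<omega>))" if t: "0 < t" for t
  proof -
    have [measurable]: "X t \<in> borel_measurable M" using t by (intro X_measurable) simp
    define P where "P = measure \<pi> {0<..<1/t}"
    have P: "0 \<le> P" "P \<le> 1" by (auto simp: P_def)
    show ?thesis
    proof (cases "P = 0")
      case True
      then show ?thesis by (simp add: P_def[symmetric] Bochner_Integration.integral_nonneg)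
    next
      case False
      then have P0: "0 < P" using P by simp
      \<comment> \<open>The half of \<open>P\<close> provides a finite value strictly below the
        measure of the level set, as the passage to the limit demands.\<close>
      have "norm (chf M (riemann_sum t n) (w / t)) \<le> exp (- c0 * (P / 2))" if n: "0 < n" for n
      proof (rule step_limit_norm_chf_le[OF step_limit_riemann_sum jumps.Re_levy_cumulant_nonpos, of t "exp (- 2) * w" w])
        fix z assume z: "z \<in> {exp (- 2) * w<..<w}"
        have "y1 * w = 1" using y by (simp add: w_def)
        moreover have "y1 * z \<le> y1 * w" "y0 * (exp (- 2) * w) \<le> y0 * z"
          using z y by (auto intro!: mult_left_mono)
        moreover have "0 < z" using z w by (auto intro: less_trans[rotated])
        ultimately show "Re (levy_cumulant a 0 \<mu> z) \<le> - c0"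
          unfolding c0_def N_def using y w by (intro jumps.Re_levy_cumulant_le) auto
      next
        show "ennreal (P / 2) < emeasure (\<pi> \<Otimes>\<^sub>M lborel) {x. w / t * pi.riemann_kernel t n x \<in> {exp (- 2) * w<..<w}}"
          using pi.riemann_kernel_level_set[OF t n w] P0
          by (intro less_le_trans[OF ennreal_lessI]) (auto simp: P_def)
      qed (use t c0 w P in auto)
      then have "\<forall>\<^sub>F n in sequentially. norm (chf M (riemann_sum t n) (w / t)) \<le> exp (- c0 * (P / 2))"
        by (rule eventually_mono[OF eventually_gt_at_top[of 0]])
      then have "norm (chf M (X t) (w / t)) \<le> exp (- c0 * (P / 2))"
        by (intro tendsto_upperbound[OF tendsto_norm[OF chf_riemann_sum_tendsto[OF t]]]) auto
      then have "1 - exp (- (c0 / 2 * P)) \<le> expectation (\<lambda>\<omega>. 1 - cos (w / t * X t \<omega>))"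
        using expectation_one_minus_cos_le(2)[of "X t" "w / t"] by simp
      moreover have "min (c0 / 2 * P) 1 / 2 \<le> 1 - exp (- (c0 / 2 * P))"
        using c0 P by (intro one_minus_exp_neg_ge_min) auto
      moreover have "min (c0 / 2) 1 * P \<le> min (c0 / 2 * P) 1"
      proof (rule min.boundedI)
        show "min (c0 / 2) 1 * P \<le> c0 / 2 * P" using P by (intro mult_right_mono) auto
        have "min (c0 / 2) 1 * P \<le> 1 * 1" using P c0 by (intro mult_mono) auto
        then show "min (c0 / 2) 1 * P \<le> 1" by simp
      qed
      ultimately have "min (c0 / 2) 1 * P / 2 \<le> expectation (\<lambda>\<omega>. 1 - cos (w / t * X t \<omega>))" by linarith
      then show ?thesis unfolding c_def P_def[symmetric] by (simp only: times_divide_eq_left)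
    qed
  qed
  then show ?thesis using w c by blast
qed

end

section \<open>Large deviation exponents\<close>

lemma Limsup_log_ratio_le:
  assumes "0 < C" and P: "\<forall>\<^sub>F t in at_top. P t \<le> ennreal (C * t powr \<kappa>)"
  shows "Limsup at_top (\<lambda>t. eln (P t) / ereal (ln t)) \<le> ereal \<kappa>"
proof -
  have "\<forall>\<^sub>F t in at_top. eln (P t) / ereal (ln t) \<le> ereal (ln C / ln t + \<kappa>)"
    using P eventually_gt_at_top[of 1]
  proof eventually_elim
    case (elim t)
    have l: "0 < ln t" using elim by simp
    have fin: "P t < \<infinity>" using elim(1) by (rule le_less_trans) simp
    show ?case
    proof (cases "P t = 0")
      case True
      then show ?thesis using l by (simp add: eln_def)
    next
      case False
      then have p: "0 < enn2real (P t)" using fin by (simp add: enn2real_positive_iff zero_less_iff_neq_zero)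
      have "enn2real (P t) \<le> C * t powr \<kappa>" using elim(1) \<open>0 < C\<close> by (intro enn2real_leI) auto
      then have "ln (enn2real (P t)) \<le> ln (C * t powr \<kappa>)" using p by simp
      also have "\<dots> = ln C + \<kappa> * ln t" using \<open>0 < C\<close> elim(2) by (simp add: ln_mult ln_powr)
      finally have "ln (enn2real (P t)) / ln t \<le> ln C / ln t + \<kappa>"
        using l by (simp add: field_simps)
      then show ?thesis using False fin l by (simp add: eln_def)
    qed
  qed
  then have "Limsup at_top (\<lambda>t. eln (P t) / ereal (ln t)) \<le> Limsup at_top (\<lambda>t. ereal (ln C / ln t + \<kappa>))"
    by (rule Limsup_mono)
  also have "\<dots> = ereal \<kappa>"
  proof (rule lim_imp_Limsup)
    have "((\<lambda>t. ln C / ln t + \<kappa>) \<longlongrightarrow> 0 + \<kappa>) at_top"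
      by (intro tendsto_add tendsto_const tendsto_divide_0[OF tendsto_const] filterlim_at_top_imp_at_infinity ln_at_top)
    then show "((\<lambda>t. ereal (ln C / ln t + \<kappa>)) \<longlongrightarrow> ereal \<kappa>) at_top" by simp
  qed simp
  finally show ?thesis .
qed

lemma Liminf_log_ratio_ge:
  assumes "0 < C" and P: "\<forall>\<^sub>F t in at_top. ennreal (C * t powr \<kappa>) \<le> P t" and fin: "\<And>t. P t < \<infinity>"
  shows "ereal \<kappa> \<le> Liminf at_top (\<lambda>t. eln (P t) / ereal (ln t))"
proof -
  have "\<forall>\<^sub>F t in at_top. ereal (ln C / ln t + \<kappa>) \<le> eln (P t) / ereal (ln t)"
    using P eventually_gt_at_top[of 1]
  proof eventually_elim
    case (elim t)
    have l: "0 < ln t" using elim by simp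
    have pos: "0 < C * t powr \<kappa>" using \<open>0 < C\<close> elim by simp
    then have nz: "P t \<noteq> 0" using elim(1) by (auto simp: ennreal_eq_0_iff)
    have "C * t powr \<kappa> \<le> enn2real (P t)"
      using enn2real_mono[OF elim(1)] fin[of t] pos by (simp add: less_top)
    then have "ln (C * t powr \<kappa>) \<le> ln (enn2real (P t))" using pos by simp
    moreover have "ln (C * t powr \<kappa>) = ln C + \<kappa> * ln t" using \<open>0 < C\<close> elim(2) by (simp add: ln_mult ln_powr)
    ultimately have "(ln C + \<kappa> * ln t) / ln t \<le> ln (enn2real (P t)) / ln t"
      using l by (intro divide_right_mono) auto
    moreover have "(ln C + \<kappa> * ln t) / ln t = ln C / ln t + \<kappa>" using l by (simp add: add_divide_distrib)
    ultimately have "ln C / ln t + \<kappa> \<le> ln (enn2real (P t)) / ln t" by (simp only:)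
    then show ?case using nz fin[of t] l by (simp add: eln_def)
  qed
  then have "Liminf at_top (\<lambda>t. ereal (ln C / ln t + \<kappa>)) \<le> Liminf at_top (\<lambda>t. eln (P t) / ereal (ln t))"
    by (rule Liminf_mono)
  moreover have "Liminf at_top (\<lambda>t. ereal (ln C / ln t + \<kappa>)) = ereal \<kappa>"
  proof (rule lim_imp_Liminf)
    have "((\<lambda>t. ln C / ln t + \<kappa>) \<longlongrightarrow> 0 + \<kappa>) at_top"
      by (intro tendsto_add tendsto_const tendsto_divide_0[OF tendsto_const] filterlim_at_top_imp_at_infinity ln_at_top)
    then show "((\<lambda>t. ereal (ln C / ln t + \<kappa>)) \<longlongrightarrow> ereal \<kappa>) at_top" by simp
  qed simp
  ultimately show ?thesis by simp
qed

text \<open>The ranges of the exponents are open (\<open>q < \<gamma>\<close>,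
  \<open>\<beta> < q'\<close>, \<open>m < \<alpha>\<close>), so estimates come with a slack
  \<open>s\<close>, which is removed here in the limit.\<close>

lemma ereal_le_of_vanishing:
  fixes L :: ereal
  assumes s0: "0 < s0" and c: "0 \<le> c" and "\<And>s. 0 < s \<Longrightarrow> s < s0 \<Longrightarrow> L \<le> ereal (x + c * s)"
  shows "L \<le> ereal x"
proof -
  have "((\<lambda>s. ereal (x + c * s)) \<longlongrightarrow> ereal (x + c * 0)) (at_right 0)"
    by (intro tendsto_intros)
  moreover have "\<forall>\<^sub>F s in at_right 0. L \<le> ereal (x + c * s)"
    unfolding eventually_at_right_field using assms by (intro exI[of _ s0]) auto
  ultimately show ?thesis by (intro tendsto_lowerbound[of "\<lambda>s. ereal (x + c * s)" _ "at_right 0"]) auto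
qed

lemma (in levy_jump_measure) jumps_nontrivial_of_tails:
  assumes right: "((\<lambda>x. measure \<mu> {x..} / x powr (- \<beta>)) \<longlongrightarrow> cp) (at_right 0)"
    and left: "((\<lambda>x. measure \<mu> {..- x} / x powr (- \<beta>)) \<longlongrightarrow> cm) (at_right 0)"
    and c: "0 < cp + cm"
  shows "\<exists>y>0. 0 < measure \<mu> {x. y \<le> \<bar>x\<bar>}"
proof -
  have "((\<lambda>x. measure \<mu> {x..} / x powr (- \<beta>) + measure \<mu> {..- x} / x powr (- \<beta>)) \<longlongrightarrow> cp + cm) (at_right 0)"
    by (intro tendsto_add right left)
  then have "\<forall>\<^sub>F x in at_right 0. 0 < measure \<mu> {x..} / x powr (- \<beta>) + measure \<mu> {..- x} / x powr (- \<beta>)"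
    using c by (rule order_tendstoD)
  then have "\<forall>\<^sub>F x in at_right 0. 0 < x \<and> 0 < measure \<mu> {x..} / x powr (- \<beta>) + measure \<mu> {..- x} / x powr (- \<beta>)"
    by (rule eventually_conj[OF eventually_at_right_less])
  from eventually_happens'[OF trivial_limit_at_right_real this] obtain x where x: "0 < x" "0 < measure \<mu> {x..} / x powr (- \<beta>) + measure \<mu> {..- x} / x powr (- \<beta>)" by blast
  then have pos: "0 < measure \<mu> {x..} \<or> 0 < measure \<mu> {..- x}"
    by (auto simp: zero_less_measure_iff)
  have "{z\<in>space \<mu>. x \<le> \<bar>z\<bar>} \<in> sets \<mu>" by measurable
  then have "{z. x \<le> \<bar>z\<bar>} \<in> fmeasurable \<mu>" using emeasure_mu_away[OF x(1)] by (intro fmeasurableI) auto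
  then have "measure \<mu> {x..} \<le> measure \<mu> {z. x \<le> \<bar>z\<bar>}" "measure \<mu> {..- x} \<le> measure \<mu> {z. x \<le> \<bar>z\<bar>}"
    using x(1) by (auto intro!: measure_mono_fmeasurable simp: sets_mu)
  then show ?thesis using pos x(1) by (intro exI[of _ x]) auto
qed

section \<open>Exponents of the window probability\<close>

context supou_process
begin

text \<open>At level \<open>x = t powr (1 - e)\<close> the bound \<open>t powr (r - m)\<close> times
  \<open>x powr (- r)\<close> becomes \<open>t powr (r * e - m)\<close>. \<open>e\<close> may have
  either sign: \<epsilon> gives the lower edge of the window and \<open>- \<epsilon>\<close> its
  upper edge.\<close>

lemma X_tail:
  assumes q: "1 < q" "q < \<gamma>" and q': "1 \<le> q'" "q' \<le> 2" "\<beta> < q'"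
    and m: "0 \<le> m" "m \<le> q - 1" "m < \<alpha>" and m': "0 \<le> m'" "m' \<le> q' - 1" "m' < \<alpha>"
  shows "\<exists>K>0. \<forall>t>1. \<forall>e. prob {\<omega>\<in>space M. t powr (1 - e) \<le> \<bar>X t \<omega>\<bar>} \<le> K * (t powr (q * e - m) + t powr (q' * e - m')) \<and>
    expectation (\<lambda>\<omega>. 1 - cos (t powr (- (1 - e)) * X t \<omega>)) \<le> K * (t powr (q * e - m) + t powr (q' * e - m'))"
proof -
  obtain K where K: "0 \<le> K" and bound: "\<And>t \<zeta>. 0 < t \<Longrightarrow> 0 < \<zeta> \<Longrightarrow> expectation (\<lambda>\<omega>. 1 - cos (\<zeta> * X t \<omega>)) \<le>
      K * t powr (q - m) * \<zeta> powr q + K * t powr (q' - m') * \<zeta> powr q'"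
    using X_cos_upper[OF q q' m m'] by blast
  have e: "t powr (r - l) * (t powr (1 - e)) powr (- r) = t powr (r * e - l)" if "1 < t" for t r l e :: real
    using that by (simp add: powr_powr powr_add[symmetric] algebra_simps)
  \<comment> \<open>The 32 comes from the tail inequality; the added 1 makes the common constant
    positive even if \<open>K = 0\<close>.\<close>
  have "prob {\<omega>\<in>space M. t powr (1 - e) \<le> \<bar>X t \<omega>\<bar>} \<le> (32 * K + 1) * (t powr (q * e - m) + t powr (q' * e - m')) \<and>
      expectation (\<lambda>\<omega>. 1 - cos (t powr (- (1 - e)) * X t \<omega>)) \<le> (32 * K + 1) * (t powr (q * e - m) + t powr (q' * e - m'))"
    if t: "1 < t" for t e
  proof -
    let ?S = "t powr (q * e - m) + t powr (q' * e - m')"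
    have [measurable]: "X t \<in> borel_measurable M" using t by (intro X_measurable) simp
    have S0: "0 \<le> ?S" by simp
    have "prob {\<omega>\<in>space M. t powr (1 - e) \<le> \<bar>X t \<omega>\<bar>} \<le>
        32 * (K * t powr (q - m) * (t powr (1 - e)) powr (- q) + K * t powr (q' - m') * (t powr (1 - e)) powr (- q'))"
      using t K q q' bound by (intro tail_le_of_chf) auto
    also have "\<dots> = 32 * K * ?S" unfolding mult.assoc e[OF t] by (simp only: distrib_left mult.assoc)
    also have "\<dots> \<le> (32 * K + 1) * ?S" using S0 by (intro mult_right_mono) auto
    finally have 1: "prob {\<omega>\<in>space M. t powr (1 - e) \<le> \<bar>X t \<omega>\<bar>} \<le> (32 * K + 1) * ?S" .
    have f: "(t powr (- (1 - e))) powr r = (t powr (1 - e)) powr (- r)" for r by (simp add: powr_powr algebra_simps)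
    have "expectation (\<lambda>\<omega>. 1 - cos (t powr (- (1 - e)) * X t \<omega>)) \<le>
        K * t powr (q - m) * (t powr (- (1 - e))) powr q + K * t powr (q' - m') * (t powr (- (1 - e))) powr q'"
      using t by (intro bound) auto
    also have "\<dots> = K * ?S" unfolding f mult.assoc e[OF t] by (simp only: distrib_left)
    also have "\<dots> \<le> (32 * K + 1) * ?S" using S0 K by (intro mult_right_mono) auto
    finally show ?thesis using 1 by blast
  qed
  moreover have "0 < 32 * K + 1" using K by simp
  ultimately show ?thesis by blast
qed

lemma Limsup_log_prob_ratio_le:
  assumes q: "1 < q" "q < \<gamma>" and q': "1 \<le> q'" "q' \<le> 2" "\<beta> < q'"
    and m: "0 \<le> m" "m \<le> q - 1" "m < \<alpha>" and m': "0 \<le> m'" "m' \<le> q' - 1" "m' < \<alpha>"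
    and \<kappa>: "q * \<epsilon> - m \<le> \<kappa>" "q' * \<epsilon> - m' \<le> \<kappa>"
  shows "Limsup at_top (log_prob_ratio M X \<epsilon>) \<le> ereal \<kappa>"
proof -
  obtain K where K: "0 < K" and tail: "\<And>t. 1 < t \<Longrightarrow> prob {\<omega>\<in>space M. t powr (1 - \<epsilon>) \<le> \<bar>X t \<omega>\<bar>} \<le> K * (t powr (q * \<epsilon> - m) + t powr (q' * \<epsilon> - m'))"
    using X_tail[OF q q' m m'] by blast
  have "\<forall>\<^sub>F t in at_top. emeasure M {\<omega>\<in>space M. t powr (1 - \<epsilon>) < \<bar>X t \<omega>\<bar> \<and> \<bar>X t \<omega>\<bar> < t powr (1 + \<epsilon>)} \<le> ennreal (2 * K * t powr \<kappa>)"
    using eventually_gt_at_top[of 1]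
  proof eventually_elim
    case (elim t)
    have [measurable]: "X t \<in> borel_measurable M" using elim by (intro X_measurable) simp
    have "prob {\<omega>\<in>space M. t powr (1 - \<epsilon>) < \<bar>X t \<omega>\<bar> \<and> \<bar>X t \<omega>\<bar> < t powr (1 + \<epsilon>)} \<le> prob {\<omega>\<in>space M. t powr (1 - \<epsilon>) \<le> \<bar>X t \<omega>\<bar>}"
      by (intro finite_measure_mono) auto
    also have "\<dots> \<le> K * (t powr (q * \<epsilon> - m) + t powr (q' * \<epsilon> - m'))" by (rule tail[OF elim])
    also have "\<dots> \<le> K * (t powr \<kappa> + t powr \<kappa>)"
      using elim K \<kappa> by (intro mult_left_mono add_mono powr_mono) auto
    finally show ?case by (simp add: emeasure_eq_measure ennreal_leI)
  qed
  then show ?thesis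
    unfolding log_prob_ratio_def[abs_def] using K by (intro Limsup_log_ratio_le[of "2 * K"]) auto
qed

text \<open>The exponents need not be sharp here: within their ranges all that matters is that they
  lie in \<open>[1 + \<alpha>, 2)\<close>, so that the errors gain some positive power over
  \<open>t powr (- m)\<close>.\<close>

lemma Liminf_log_prob_ratio_ge:
  assumes pi_lower: "\<And>a''. \<alpha> < a'' \<Longrightarrow> \<exists>c>0. \<exists>x0>0. \<forall>x. 0 < x \<and> x \<le> x0 \<longrightarrow> c * x powr a'' \<le> measure \<pi> {0<..<x}"
    and q: "1 + \<alpha> \<le> q" "q < \<gamma>" and q': "1 + \<alpha> \<le> q'" "q' < 2" "\<beta> < q'" and \<epsilon>: "0 < \<epsilon>"
  shows "- ereal \<alpha> \<le> Liminf at_top (log_prob_ratio M X \<epsilon>)"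
proof -
  \<comment> \<open>A gain common to all four error terms: \<open>q \<epsilon>\<close> and
    \<open>q' \<epsilon>\<close> arise beyond the upper edge of the window,
    \<open>(2 - q) \<epsilon>\<close> and \<open>(2 - q') \<epsilon>\<close> from the truncated
    second moment below the lower edge.\<close>
  define \<eta> where "\<eta> = \<epsilon> * min (min q (2 - q)) (min q' (2 - q'))"
  have \<eta>: "0 < \<eta>" using \<epsilon> q q' alpha gamma by (auto simp: \<eta>_def)
  have \<eta>_le: "\<eta> \<le> q * \<epsilon>" "\<eta> \<le> (2 - q) * \<epsilon>" "\<eta> \<le> q' * \<epsilon>" "\<eta> \<le> (2 - q') * \<epsilon>"
    unfolding \<eta>_def using \<epsilon> by (simp_all add: mult.commute)
  \<comment> \<open>Only a quarter of the gain is given up by taking \<open>m\<close> below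
    \<alpha>; \<open>\<alpha> / 2\<close> keeps \<open>m\<close> nonnegative.\<close>
  define m where "m = max (\<alpha> / 2) (\<alpha> - \<eta> / 4)"
  have m: "0 \<le> m" "m < \<alpha>" "\<alpha> - \<eta> / 4 \<le> m" "m \<le> q - 1" "m \<le> q' - 1" using alpha \<eta> q q' by (auto simp: m_def)
  obtain K where K: "0 < K"
    and tail: "\<And>t e. 1 < t \<Longrightarrow> prob {\<omega>\<in>space M. t powr (1 - e) \<le> \<bar>X t \<omega>\<bar>} \<le> K * (t powr (q * e - m) + t powr (q' * e - m))"
    and cosb: "\<And>t e. 1 < t \<Longrightarrow> expectation (\<lambda>\<omega>. 1 - cos (t powr (- (1 - e)) * X t \<omega>)) \<le> K * (t powr (q * e - m) + t powr (q' * e - m))"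
    using X_tail[of q q' m m] q q' m alpha by auto
  obtain w c0 where w: "0 < w" and c0: "0 < c0"
    and lower: "\<And>t. 0 < t \<Longrightarrow> c0 * measure \<pi> {0<..<1/t} \<le> expectation (\<lambda>\<omega>. 1 - cos (w / t * X t \<omega>))"
    using X_cos_lower by blast
  have main: "ereal (- (\<alpha> + s)) \<le> Liminf at_top (log_prob_ratio M X \<epsilon>)" if s: "0 < s" "s < \<eta> / 4" for s
  proof -
    obtain c1 x0 where c1: "0 < c1" "0 < x0" and pl: "\<And>x. 0 < x \<Longrightarrow> x \<le> x0 \<Longrightarrow> c1 * x powr (\<alpha> + s) \<le> measure \<pi> {0<..<x}"
      using pi_lower[of "\<alpha> + s"] s by auto
    \<comment> \<open>The tail beyond the upper edge contributes twice \<open>2 K\<close> and the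
      truncated second moment \<open>16 w\<^sup>2 K\<close>.\<close>
    define B where "B = 4 * K + 16 * w\<^sup>2 * K"
    define c where "c = c0 * c1"
    have c: "0 < c" using c0 c1 by (simp add: c_def)
    have "((\<lambda>t. B * t powr (- (\<eta> / 2))) \<longlongrightarrow> B * 0) at_top"
      using \<eta> by (intro tendsto_mult tendsto_const tendsto_neg_powr filterlim_ident) auto
    then have "\<forall>\<^sub>F t in at_top. B * t powr (- (\<eta> / 2)) < c / 2"
      by (rule order_tendstoD) (use c in simp)
    then have "\<forall>\<^sub>F t in at_top. ennreal (c / 4 * t powr (- (\<alpha> + s))) \<le>
        emeasure M {\<omega>\<in>space M. t powr (1 - \<epsilon>) < \<bar>X t \<omega>\<bar> \<and> \<bar>X t \<omega>\<bar> < t powr (1 + \<epsilon>)}"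
      using eventually_gt_at_top[of 1] eventually_ge_at_top[of "1 / x0"]
    proof eventually_elim
      case (elim t)
      have t: "1 < t" "0 < t" using elim by auto
      have [measurable]: "X t \<in> borel_measurable M" using t by (intro X_measurable) simp
      let ?W = "{\<omega>\<in>space M. t powr (1 - \<epsilon>) < \<bar>X t \<omega>\<bar> \<and> \<bar>X t \<omega>\<bar> < t powr (1 + \<epsilon>)}"
      let ?U = "{\<omega>\<in>space M. t powr (1 + \<epsilon>) \<le> \<bar>X t \<omega>\<bar>}"
      let ?z = "t powr (- (1 - \<epsilon>))"
      have z: "0 < ?z" using t by simp
      have "1 / t \<le> x0" using elim c1 t by (simp add: field_simps)
      then have "c1 * (1 / t) powr (\<alpha> + s) \<le> measure \<pi> {0<..<1/t}" using t by (intro pl) auto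
      moreover have "(1 / t) powr (\<alpha> + s) = t powr (- (\<alpha> + s))" using t by (simp only: powr_minus_divide powr_divide powr_one_eq_one)
      ultimately have "c0 * (c1 * t powr (- (\<alpha> + s))) \<le> c0 * measure \<pi> {0<..<1/t}" using c0 by simp
      then have L: "c * t powr (- (\<alpha> + s)) \<le> expectation (\<lambda>\<omega>. 1 - cos (w / t * X t \<omega>))"
        using lower[OF t(2)] by (simp add: c_def mult.assoc)
      \<comment> \<open>Inside the window and beyond it, the trivial bound 2 is used. Below it,
        \<open>(w X / t)\<^sup>2\<close> equals \<open>w\<^sup>2 t powr (- 2 \<epsilon>)\<close>
        times \<open>(?z X)\<^sup>2\<close> with \<open>|?z X| \<le> 1\<close>, and that square is
        at most \<open>4 (1 - cos (?z X))\<close>; the factor 8 is 2 times 4.\<close>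
      have pt: "1 - cos (w / t * X t \<omega>) \<le> 2 * indicator ?W \<omega> + 2 * indicator ?U \<omega> + 8 * w\<^sup>2 * t powr (- 2 * \<epsilon>) * (1 - cos (?z * X t \<omega>))"
        if \<omega>: "\<omega> \<in> space M" for \<omega>
      proof (cases "\<bar>X t \<omega>\<bar> \<le> t powr (1 - \<epsilon>)")
        case True
        have "\<bar>?z * X t \<omega>\<bar> \<le> ?z * t powr (1 - \<epsilon>)" using True z by (simp add: abs_mult)
        also have "\<dots> = 1" using t by (simp add: powr_add[symmetric])
        finally have "\<bar>?z * X t \<omega>\<bar> \<le> 1" .
        then have "(?z * X t \<omega>)\<^sup>2 \<le> 4 * (1 - cos (?z * X t \<omega>))" using one_minus_cos_ge by fastforce
        then have "2 * w\<^sup>2 * t powr (- 2 * \<epsilon>) * (?z * X t \<omega>)\<^sup>2 \<le> 2 * w\<^sup>2 * t powr (- 2 * \<epsilon>) * (4 * (1 - cos (?z * X t \<omega>)))"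
          by (intro mult_left_mono) auto
        moreover have "1 - cos (w / t * X t \<omega>) \<le> 2 * (w / t * X t \<omega>)\<^sup>2"
        proof -
          have "\<bar>u\<bar> powr 2 = u\<^sup>2" for u :: real by simp
          then show ?thesis using one_minus_cos_le_powr[of 2 "w / t * X t \<omega>"] by (simp only:)
        qed
        moreover have "2 * (w / t * X t \<omega>)\<^sup>2 = 2 * w\<^sup>2 * t powr (- 2 * \<epsilon>) * (?z * X t \<omega>)\<^sup>2"
        proof -
          have "t powr (- 2 * \<epsilon>) * ?z\<^sup>2 = t powr (- 2)"
            using t by (simp add: power2_eq_square powr_add[symmetric])
          also have "\<dots> = 1 / t\<^sup>2" using t by (simp add: powr_minus_divide)
          finally have "w\<^sup>2 * (X t \<omega>)\<^sup>2 * (t powr (- 2 * \<epsilon>) * ?z\<^sup>2) = w\<^sup>2 * (X t \<omega>)\<^sup>2 * (1 / t\<^sup>2)" by (simp only:)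
          then show ?thesis by (simp add: power_mult_distrib power_divide mult_ac)
        qed
        moreover have "0 \<le> 2 * indicator ?W \<omega> + 2 * (indicator ?U \<omega> :: real)" by simp
        ultimately show ?thesis by linarith
      next
        case False
        then have "\<omega> \<in> ?W \<or> \<omega> \<in> ?U" using \<omega> by auto
        then have "2 \<le> 2 * indicator ?W \<omega> + 2 * (indicator ?U \<omega> :: real)" by (auto simp: indicator_def)
        moreover have "0 \<le> 8 * w\<^sup>2 * t powr (- 2 * \<epsilon>) * (1 - cos (?z * X t \<omega>))" by (intro mult_nonneg_nonneg) auto
        ultimately show ?thesis using cos_ge_minus_one[of "w / t * X t \<omega>"] by linarith
      qed
      have ii: "integrable M (\<lambda>\<omega>. 2 * indicat_real ?W \<omega> + 2 * indicat_real ?U \<omega>)"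
        by (intro Bochner_Integration.integrable_add integrable_mult_right integrable_real_indicator) (auto simp: less_top[symmetric])
      have ic: "integrable M (\<lambda>\<omega>. 8 * w\<^sup>2 * t powr (- 2 * \<epsilon>) * (1 - cos (?z * X t \<omega>)))"
        by (intro integrable_mult_right expectation_one_minus_cos_eq(1)) measurable
      have "expectation (\<lambda>\<omega>. 1 - cos (w / t * X t \<omega>)) \<le>
          expectation (\<lambda>\<omega>. 2 * indicator ?W \<omega> + 2 * indicator ?U \<omega> + 8 * w\<^sup>2 * t powr (- 2 * \<epsilon>) * (1 - cos (?z * X t \<omega>)))"
        by (rule integral_mono[OF expectation_one_minus_cos_eq(1) Bochner_Integration.integrable_add[OF ii ic]]) (use pt in auto)
      also have "\<dots> = expectation (\<lambda>\<omega>. 2 * indicator ?W \<omega> + 2 * indicator ?U \<omega>) + 8 * w\<^sup>2 * t powr (- 2 * \<epsilon>) * expectation (\<lambda>\<omega>. 1 - cos (?z * X t \<omega>))"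
        by (subst Bochner_Integration.integral_add[OF ii ic]) (simp only: integral_mult_right_zero)
      also have "expectation (\<lambda>\<omega>. 2 * indicator ?W \<omega> + 2 * indicator ?U \<omega>) = 2 * prob ?W + 2 * prob ?U"
        by (subst Bochner_Integration.integral_add) (auto intro!: integrable_mult_right integrable_real_indicator simp: less_top[symmetric])
      finally have E: "expectation (\<lambda>\<omega>. 1 - cos (w / t * X t \<omega>)) \<le>
          2 * prob ?W + 2 * prob ?U + 8 * w\<^sup>2 * t powr (- 2 * \<epsilon>) * expectation (\<lambda>\<omega>. 1 - cos (?z * X t \<omega>))" .
      \<comment> \<open>The gain is spent as follows: \<open>- m - \<eta> \<le> - \<alpha> - 3
        \<eta> / 4 \<le> - (\<alpha> + s) - \<eta> / 2\<close>, by
        \<open>\<alpha> - \<eta> / 4 \<le> m\<close> and \<open>s < \<eta> / 4\<close>. The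
        remaining half makes the errors negligible.\<close>
      have ex: "t powr r \<le> t powr (- (\<alpha> + s) - \<eta> / 2)" if "r \<le> - m - \<eta>" for r
        using that m s t by (intro powr_mono) auto
      let ?R = "t powr (- (\<alpha> + s) - \<eta> / 2)"
      have "prob ?U \<le> K * (t powr (q * (- \<epsilon>) - m) + t powr (q' * (- \<epsilon>) - m))"
        using tail[OF t(1), of "- \<epsilon>"] by simp
      also have "\<dots> \<le> K * (?R + ?R)"
        using K \<eta>_le by (intro mult_left_mono add_mono ex) auto
      finally have U: "prob ?U \<le> 2 * K * ?R" by simp
      have "8 * w\<^sup>2 * t powr (- 2 * \<epsilon>) * expectation (\<lambda>\<omega>. 1 - cos (?z * X t \<omega>)) \<le>
          8 * w\<^sup>2 * t powr (- 2 * \<epsilon>) * (K * (t powr (q * \<epsilon> - m) + t powr (q' * \<epsilon> - m)))"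
        by (intro mult_left_mono cosb t) auto
      also have "\<dots> = 8 * w\<^sup>2 * (K * (t powr (- 2 * \<epsilon> + (q * \<epsilon> - m)) + t powr (- 2 * \<epsilon> + (q' * \<epsilon> - m))))"
        by (simp only: powr_add distrib_left mult_ac)
      also have "\<dots> \<le> 8 * w\<^sup>2 * (K * (?R + ?R))"
        using K \<eta>_le by (intro mult_left_mono add_mono ex) (auto simp: algebra_simps)
      finally have V: "8 * w\<^sup>2 * t powr (- 2 * \<epsilon>) * expectation (\<lambda>\<omega>. 1 - cos (?z * X t \<omega>)) \<le> 16 * w\<^sup>2 * K * ?R" by simp
      have "c * t powr (- (\<alpha> + s)) \<le> 2 * prob ?W + B * ?R"
        using L E U V by (simp add: B_def algebra_simps)
      also have "B * ?R = t powr (- (\<alpha> + s)) * (B * t powr (- (\<eta> / 2)))"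
        by (simp add: powr_add[symmetric] mult_ac)
      also have "\<dots> \<le> t powr (- (\<alpha> + s)) * (c / 2)" using elim by (intro mult_left_mono) auto
      finally have "c / 4 * t powr (- (\<alpha> + s)) \<le> prob ?W" by (simp add: field_simps)
      then show ?case by (simp add: emeasure_eq_measure ennreal_leI)
    qed
    then show ?thesis
      unfolding log_prob_ratio_def[abs_def] using c
      by (intro Liminf_log_ratio_ge[of "c / 4"]) (auto simp: emeasure_eq_measure)
  qed
  have "- Liminf at_top (log_prob_ratio M X \<epsilon>) \<le> ereal \<alpha>"
  proof (rule ereal_le_of_vanishing[of "\<eta> / 4" 1])
    fix s assume "0 < s" "s < \<eta> / 4"
    from main[OF this] show "- Liminf at_top (log_prob_ratio M X \<epsilon>) \<le> ereal (\<alpha> + 1 * s)"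
      by (metis ereal_minus_le_minus ereal_uminus_uminus mult_1 uminus_ereal.simps(1))
  qed (use \<eta> in auto)
  then show ?thesis by (metis ereal_minus_le_minus ereal_uminus_uminus)
qed

text \<open>One exponent \<open>1 + \<alpha> - s\<close> serves large and small jumps, with the
  largest permitted \<open>m\<close>, namely \<open>\<alpha> - s\<close>. The bounds on
  \<open>s\<close> keep this exponent above 1 and above \<beta>; it lies below \<gamma> since
  \<open>1 + \<alpha>\<close> does.\<close>

lemma Limsup_case_i:
  assumes "\<beta> < 1 + \<alpha>" "1 + \<alpha> < \<gamma>" and \<epsilon>: "0 < \<epsilon>"
  shows "Limsup at_top (log_prob_ratio M X \<epsilon>) \<le> - ereal (\<alpha> - (1 + \<alpha>) * \<epsilon>)"
proof -
  have "Limsup at_top (log_prob_ratio M X \<epsilon>) \<le> ereal (- (\<alpha> - (1 + \<alpha>) * \<epsilon>))"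
  proof (rule ereal_le_of_vanishing[of "min \<alpha> (1 + \<alpha> - \<beta>)" 1])
    fix s assume s: "0 < s" "s < min \<alpha> (1 + \<alpha> - \<beta>)"
    let ?q = "1 + \<alpha> - s"
    have "0 \<le> s * \<epsilon>" using s \<epsilon> by simp
    then have k: "?q * \<epsilon> - (?q - 1) \<le> - (\<alpha> - (1 + \<alpha>) * \<epsilon>) + 1 * s" by (simp add: algebra_simps)
    show "Limsup at_top (log_prob_ratio M X \<epsilon>) \<le> ereal (- (\<alpha> - (1 + \<alpha>) * \<epsilon>) + 1 * s)"
      by (rule Limsup_log_prob_ratio_le[of ?q ?q "?q - 1" "?q - 1", OF _ _ _ _ _ _ _ _ _ _ _ k k])
         (use s assms gamma in auto)
  qed (use assms alpha in auto)
  then show ?thesis by simp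
qed

text \<open>As \<beta> may equal \<gamma>, no single exponent need lie both below \<gamma> and above
  \<beta>. Large jumps get \<open>\<beta> - s\<close> and small jumps \<open>\<beta> + s\<close>;
  both exceed \<open>1 + \<alpha>\<close>, so \<open>m = \<alpha> - s\<close> is permitted for
  either.\<close>

lemma Limsup_case_ii:
  assumes "1 + \<alpha> < \<beta>" "\<beta> \<le> \<gamma>" and \<epsilon>: "0 < \<epsilon>" "\<epsilon> \<le> 1"
  shows "Limsup at_top (log_prob_ratio M X \<epsilon>) \<le> - ereal (\<alpha> - \<beta> * \<epsilon>)"
proof -
  have "Limsup at_top (log_prob_ratio M X \<epsilon>) \<le> ereal (- (\<alpha> - \<beta> * \<epsilon>))"
  proof (rule ereal_le_of_vanishing[of "min \<alpha> (min (\<beta> - (1 + \<alpha>)) (2 - \<beta>))" 2])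
    fix s assume s: "0 < s" "s < min \<alpha> (min (\<beta> - (1 + \<alpha>)) (2 - \<beta>))"
    have "0 \<le> s * \<epsilon>" "s * \<epsilon> \<le> s" using s \<epsilon> by (auto simp: mult_left_le)
    then have k: "(\<beta> - s) * \<epsilon> - (\<alpha> - s) \<le> - (\<alpha> - \<beta> * \<epsilon>) + 2 * s" "(\<beta> + s) * \<epsilon> - (\<alpha> - s) \<le> - (\<alpha> - \<beta> * \<epsilon>) + 2 * s"
      using s by (simp_all add: algebra_simps)
    show "Limsup at_top (log_prob_ratio M X \<epsilon>) \<le> ereal (- (\<alpha> - \<beta> * \<epsilon>) + 2 * s)"
      by (rule Limsup_log_prob_ratio_le[of "\<beta> - s" "\<beta> + s" "\<alpha> - s" "\<alpha> - s", OF _ _ _ _ _ _ _ _ _ _ _ k])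
         (use s assms alpha in auto)
  qed (use assms alpha beta in auto)
  then show ?thesis by simp
qed

end

theorem theorem5p4:
  fixes M :: "'w measure"
    and \<Lambda> :: "(real \<times> real) set \<Rightarrow> 'w \<Rightarrow> real"
    and Y X :: "real \<Rightarrow> 'w \<Rightarrow> real"
    and a b :: real and \<mu> \<pi> :: "real measure"
    and p k ell :: "real \<Rightarrow> real"
    and p0 q0 \<gamma> \<alpha> cp cm \<beta> :: real
    and \<tau> :: "real \<Rightarrow> ereal"
  assumes levy: "levy_measure \<mu>" and b_nonneg: "b \<ge> 0"
    and pi_density: "\<pi> = density lborel (\<lambda>x. ennreal (p x))"
    and pi_prob: "prob_space \<pi>"
    and p_meas: "p \<in> borel_measurable borel"
    and p_nonneg: "\<forall>x. p x \<ge> 0" and p_supp: "\<forall>x\<le>0. p x = 0"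
    and basis: "levy_basis M \<Lambda> (\<pi> \<Otimes>\<^sub>M lborel) (levy_cumulant a b \<mu>)"
    and supOU: "\<forall>t. levy_integral_of M \<Lambda> (\<pi> \<Otimes>\<^sub>M lborel) (supou_kernel t) (Y t)"
    and Y_meas: "(\<lambda>(s, \<omega>). Y s \<omega>) \<in> borel_measurable (lborel \<Otimes>\<^sub>M M)"
    and Y_loc_int: "AE \<omega> in M. \<forall>t\<ge>0. set_integrable lborel {0..t} (\<lambda>s. Y s \<omega>)"
    and X_def: "\<forall>t\<ge>0. \<forall>\<omega>\<in>space M. X t \<omega> = (LBINT s:{0..t}. Y s \<omega>)"
    \<comment> \<open>(1)\<close>
    and tail_right: "((\<lambda>x. measure M {\<omega>\<in>space M. Y 1 \<omega> > x} / (k x * x powr (- \<gamma>))) \<longlongrightarrow> p0) at_top"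
    and tail_left: "((\<lambda>x. measure M {\<omega>\<in>space M. Y 1 \<omega> \<le> - x} / (k x * x powr (- \<gamma>))) \<longlongrightarrow> q0) at_top"
    and p0q0: "p0 \<ge> 0" "q0 \<ge> 0" "p0 + q0 > 0"
    and gamma: "0 < \<gamma>" "\<gamma> < 2" "\<gamma> = 1 \<longrightarrow> p0 = q0"
    and k_sv: "slowly_varying k"
    \<comment> \<open>(2)\<close>
    and mean_zero: "integrable M (Y 1) \<longrightarrow> integral\<^sup>L M (Y 1) = 0"
    \<comment> \<open>(3)\<close>
    and alpha_pos: "\<alpha> > 0" and l_sv: "slowly_varying ell"
    and p_zero: "((\<lambda>x. p x / (\<alpha> * ell (1 / x) * x powr (\<alpha> - 1))) \<longlongrightarrow> 1) (at_right 0)"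
    \<comment> \<open>(4)\<close>
    and mu_right: "((\<lambda>x. measure \<mu> {x..} / x powr (- \<beta>)) \<longlongrightarrow> cp) (at_right 0)"
    and mu_left: "((\<lambda>x. measure \<mu> {..- x} / x powr (- \<beta>)) \<longlongrightarrow> cm) (at_right 0)"
    and cpm: "cp \<ge> 0" "cm \<ge> 0" "cp + cm > 0"
    and beta: "0 \<le> \<beta>" "\<beta> < 2"
    \<comment> \<open>(5)\<close>
    and tau: "\<forall>q. ((\<lambda>t. eln (abs_moment M (X t) q) / ereal (ln t)) \<longlongrightarrow> \<tau> q) at_top"
    and tau_dom: "0 \<in> interior {q. \<tau> q < \<infinity>}"
  shows
    "(b = 0 \<and> \<beta> < 1 + \<alpha> \<and> 1 + \<alpha> < \<gamma> \<longrightarrow>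
       (\<forall>\<epsilon>. 0 < \<epsilon> \<and> \<epsilon> < 1 - 1 / (1 + \<alpha>) \<longrightarrow>
          - ereal \<alpha> \<le> Liminf at_top (log_prob_ratio M X \<epsilon>) \<and>
          Liminf at_top (log_prob_ratio M X \<epsilon>) \<le> Limsup at_top (log_prob_ratio M X \<epsilon>) \<and>
          Limsup at_top (log_prob_ratio M X \<epsilon>) \<le> - ereal (\<alpha> - (1 + \<alpha>) * \<epsilon>)))
     \<and>
     (b = 0 \<and> 1 + \<alpha> < \<beta> \<and> \<beta> \<le> \<gamma> \<longrightarrow>
       (\<forall>\<epsilon>. 0 < \<epsilon> \<and> \<epsilon> < \<alpha> / \<beta> \<longrightarrow>
          - ereal \<alpha> \<le> Liminf at_top (log_prob_ratio M X \<epsilon>) \<and>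
          Liminf at_top (log_prob_ratio M X \<epsilon>) \<le> Limsup at_top (log_prob_ratio M X \<epsilon>) \<and>
          Limsup at_top (log_prob_ratio M X \<epsilon>) \<le> - ereal (\<alpha> - \<beta> * \<epsilon>)))"
proof -
  \<comment> \<open>Either claim presupposes \<open>b = 0\<close> and, through
    \<open>1 + \<alpha> < \<gamma>\<close> or \<open>1 + \<alpha> < \<beta> \<le> \<gamma>\<close>,
    also \<open>1 < \<gamma>\<close>; in all other cases both implications are vacuous.\<close>
  have main: ?thesis if b: "b = 0" and \<gamma>1: "1 < \<gamma>"
  proof -
    interpret prob_space M using basis by (simp add: levy_basis_def)
    interpret jumps: levy_jump_measure \<mu> by unfold_locales (rule levy)
    interpret pi0: prob_space \<pi> by (rule pi_prob)
    have pi_int: "supou_intensity \<pi>"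
    proof unfold_locales
      show "sets \<pi> = sets borel" by (simp add: pi_density)
      have "0 < p x \<longrightarrow> 0 < x" for x using p_supp by (metis less_irrefl not_less)
      then show "AE \<xi> in \<pi>. 0 < \<xi>"
        unfolding pi_density using p_meas by (subst AE_density) auto
    qed
    interpret pi: supou_intensity \<pi> by (rule pi_int)
    have Y1: "Y 1 \<in> borel_measurable M" using supOU by (simp add: levy_integral_of_def)
    have p0': "\<And>x. 0 \<le> p x" using p_nonneg by blast
    interpret supou_process M \<Lambda> \<pi> a \<mu> Y X \<alpha> \<beta> \<gamma>
    proof unfold_locales
      show "levy_basis M \<Lambda> (\<pi> \<Otimes>\<^sub>M lborel) (levy_cumulant a 0 \<mu>)" using basis b by simp
      show "integrable M (\<lambda>\<omega>. \<bar>Y 1 \<omega>\<bar> powr r)" if "0 \<le> r" "r < \<gamma>" for r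
        by (rule integrable_powr_of_tail[OF Y1 tail_right tail_left p0q0(3) k_sv that])
      show "integrable \<mu> (\<lambda>x. indicator {x. 0 < \<bar>x\<bar> \<and> \<bar>x\<bar> \<le> 1} x * \<bar>x\<bar> powr r)" if "\<beta> < r" for r
        by (rule jumps.small_jump_moment[OF mu_right mu_left beta(1) that])
      show "\<exists>y>0. 0 < measure \<mu> {x. y \<le> \<bar>x\<bar>}"
        by (rule jumps.jumps_nontrivial_of_tails[OF mu_right mu_left cpm(3)])
      show "integrable \<pi> (\<lambda>\<xi>. \<xi> powr (- m))" if "0 \<le> m" "m < \<alpha>" for m
        by (rule pi.integrable_inverse_powr[OF pi_density p_meas p0' p_zero alpha_pos l_sv that])
    qed (use supOU Y_meas Y_loc_int X_def \<gamma>1 gamma(2) mean_zero beta alpha_pos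
        in \<open>auto simp: levy_cumulant_def pi.space_intensity\<close>)
    note pi_lower = pi.measure_near_zero_ge[OF pi_density p_meas p0' p_zero alpha_pos l_sv]
    have LL: "Liminf at_top (log_prob_ratio M X \<epsilon>) \<le> Limsup at_top (log_prob_ratio M X \<epsilon>)" for \<epsilon>
      by (rule Liminf_le_Limsup) simp
    show ?thesis
    proof (intro conjI impI allI)
      fix \<epsilon> assume c: "b = 0 \<and> \<beta> < 1 + \<alpha> \<and> 1 + \<alpha> < \<gamma>" and \<epsilon>: "0 < \<epsilon> \<and> \<epsilon> < 1 - 1 / (1 + \<alpha>)"
      \<comment> \<open>The midpoint lies strictly between \<open>1 + \<alpha>\<close> and \<gamma>,
        hence also above \<beta> and below 2.\<close>
      let ?q = "(1 + \<alpha> + \<gamma>) / 2"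
      show "- ereal \<alpha> \<le> Liminf at_top (log_prob_ratio M X \<epsilon>)"
        by (rule Liminf_log_prob_ratio_ge[OF pi_lower, of ?q ?q]) (use c \<epsilon> gamma in \<open>auto simp: field_simps\<close>)
      show "Limsup at_top (log_prob_ratio M X \<epsilon>) \<le> - ereal (\<alpha> - (1 + \<alpha>) * \<epsilon>)"
        using Limsup_case_i c \<epsilon> by simp
    next
      fix \<epsilon> assume c: "b = 0 \<and> 1 + \<alpha> < \<beta> \<and> \<beta> \<le> \<gamma>" and \<epsilon>: "0 < \<epsilon> \<and> \<epsilon> < \<alpha> / \<beta>"
      \<comment> \<open>The large-jump exponent is the midpoint of \<open>1 + \<alpha>\<close> and
        \<beta>, hence below \<gamma>; the small-jump exponent is the midpoint of \<beta> and
        2.\<close>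
      show "- ereal \<alpha> \<le> Liminf at_top (log_prob_ratio M X \<epsilon>)"
        by (rule Liminf_log_prob_ratio_ge[OF pi_lower, of "(1 + \<alpha> + \<beta>) / 2" "(\<beta> + 2) / 2"])
           (use c \<epsilon> gamma beta in \<open>auto simp: field_simps\<close>)
      \<comment> \<open>This yields \<open>\<epsilon> \<le> 1\<close>, which bounds the slack
        \<open>s * \<epsilon>\<close> by \<open>s\<close>.\<close>
      have "\<alpha> / \<beta> \<le> 1" using c alpha_pos by simp
      then show "Limsup at_top (log_prob_ratio M X \<epsilon>) \<le> - ereal (\<alpha> - \<beta> * \<epsilon>)"
        using c \<epsilon> by (intro Limsup_case_ii) auto
    qed (rule LL)+
  qed
  then show ?thesis
  proof (cases "b = 0 \<and> 1 < \<gamma>")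
    case False
    then show ?thesis using alpha_pos by auto
  qed blast
qed

end
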